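(* Let $(\mathcal{X},\mathcal{Y}_1,\mathcal{Y}_2,\mathcal{Z},P_{Y_1,Y_2,Z|X})$ be a discrete memoryless two-user broadcast channel with a warden, with $\mathcal{X}=\{0,1,\ldots,K\}$, $Q_x:=P_{Z|X}(\cdot|x)$, $\operatorname{supp}(Q_0)=\mathcal{Z}$, and the no-input symbol $0$ not redundant, i.e. $Q_0\notin\mathrm{conv}\{Q_{x'}: x'\in\mathcal{X}, x'\neq 0\}$. Let $W:=P_{Y_1|X}$ and $V:=P_{Y_2|X}$, and assume $W(\cdot|k)\ll W(\cdot|0)$ and $V(\cdot|k)\ll V(\cdot|0)$ for all $k\in\mathcal{X}\setminus\{0\}$. Let $L_1^*:=L^*(P_{Y_1,Z|X})$ and $L_2^*:=L^*(P_{Y_2,Z|X})$, and assume the following condition: if $L_1^*\ge L_2^*$ then $\max_{P_X} \frac{I(X;Y_1)}{I(X;Y_2)}\le \frac{L_1^*}{L_2^*}$, and otherwise (if $L_2^*\ge L_1^*$) $\max_{P_X}\frac{I(X;Y_2)}{I(X;Y_1)}\le \frac{L_2^*}{L_1^*}$. Assume the secret key may be arbitrarily long. Then for every $\delta>0$ the $\delta$-covert capacity region is $$\mathcal{L}_\delta=\left\{(L_1,L_2)\in\mathbb{R}_+^2:\ \frac{L_1}{L_1^*}+\frac{L_2}{L_2^*}\le 1\right\}.$$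
   Context: A discrete memoryless two-user broadcast channel (BC) with a warden consists of finite alphabets $\mathcal{X},\mathcal{Y}_1,\mathcal{Y}_2,\mathcal{Z}$ and a transition matrix $P_{Y_1,Y_2,Z|X}$, used $n$ times memorylessly; $\mathcal{Y}_1,\mathcal{Y}_2$ are the legitimate receivers and $\mathcal{Z}$ the warden. Symbol $0\in\mathcal{X}$ is the "no-input" symbol; if no communication takes place the warden observes $Z^n\sim Q_0^{\times n}$. An $(n,M_{1n},M_{2n},K_n,\varepsilon,\delta)$-code consists of independent messages $W_j$ uniform on $\{1,\ldots,M_{jn}\}$ ($j=1,2$), a secret key $S$ uniform on $\{1,\ldots,K_n\}$ independent of the messages and shared by the transmitter and both receivers, an encoder $f:\{1..M_{1n}\}\times\{1..M_{2n}\}\times\{1..K_n\}\to\mathcal{X}^n$, and decoders $\varphi_j:\mathcal{Y}_j^n\times\{1..K_n\}\to\{1..M_{jn}\}$, such that $\Pr(\cup_{j=1}^2\{\hat W_j\ne W_j\})\le\varepsilon$ and $D(\hat Q_{Z^n}\|Q_0^{\times n})\le\delta$, where $\hat Q_{Z^n}$ is the warden's output distribution induced by the code and $D$ is relative entropy. With arbitrarily large key sets allowed, $(L_1,L_2)\in\mathbb{R}_+^2$ is $(\varepsilon,\delta)$-achievable if there is a sequence of such codes with error $\varepsilon_n$ and covertness $\delta$ such that $\liminf_{n\to\infty}\frac{1}{\sqrt{n\delta}}\log M_{jn}\ge L_j$ for $j=1,2$ and $\limsup_n\varepsilon_n\le\varepsilon$. $\mathcal{L}_{\varepsilon,\delta}$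 is the closure of the set of $(\varepsilon,\delta)$-achievable pairs, and the $\delta$-covert capacity region is $\mathcal{L}_\delta:=\bigcap_{\varepsilon\in(0,1)}\mathcal{L}_{\varepsilon,\delta}$. For a point-to-point channel with a warden $P_{Y,Z|X}$ with $\mathcal{X}=\{0,\ldots,K\}$, $W':=P_{Y|X}$ and $Q_k:=P_{Z|X}(\cdot|k)$, its covert capacity is $L^*(P_{Y,Z|X}):=\max_{\mathbf p}\sqrt{\frac{2\left(\sum_{k=1}^K p_k D(W'(\cdot|k)\|W'(\cdot|0))\right)^2}{\chi_2\left(\sum_{k=1}^K p_kQ_k\,\middle\|\,Q_0\right)}}$, maximized over probability vectors $\mathbf p=(p_1,\ldots,p_K)$, where $\chi_2(Q_1\|Q_0):=\sum_z (Q_1(z)-Q_0(z))^2/Q_0(z)$. Logarithms are to an arbitrary fixed base. In the condition, the maxima are over input distributions $P_X$ on $\mathcal{X}$, with $(X,Y_1,Y_2)\sim P_X\times P_{Y_1,Y_2|X}$.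
   Formalization: Logarithms are natural (in base b the covert rate scales as 1/√(ln b) but L* as 1/ln b, so the formula fails for b≠e); K≥1; L/0 is read as +∞ for L>0 and as 0 for L=0; the ratio condition on mutual informations is cross-multiplied. *)

theory Defs
  imports "HOL-Analysis.Analysis"
begin

text \<open>Conventions. The input alphabet is {0..K} (natural numbers), the output alphabets
  are finite types. A broadcast channel with a warden is a function
  P x y1 y2 z = P_{Y1,Y2,Z|X}(y1,y2,z|x). All logarithms are natural logarithms.\<close>

definition bc_channel :: "nat \<Rightarrow> (nat \<Rightarrow> 'y1::finite \<Rightarrow> 'y2::finite \<Rightarrow> 'z::finite \<Rightarrow> real) \<Rightarrow> bool" where
  "bc_channel K P \<longleftrightarrow> (\<forall>x\<le>K. (\<forall>y1 y2 z. P x y1 y2 z \<ge> 0) \<and>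
      (\<Sum>y1\<in>UNIV. \<Sum>y2\<in>UNIV. \<Sum>z\<in>UNIV. P x y1 y2 z) = 1)"

definition chanW :: "(nat \<Rightarrow> 'y1::finite \<Rightarrow> 'y2::finite \<Rightarrow> 'z::finite \<Rightarrow> real) \<Rightarrow> nat \<Rightarrow> 'y1 \<Rightarrow> real" where
  "chanW P x y1 = (\<Sum>y2\<in>UNIV. \<Sum>z\<in>UNIV. P x y1 y2 z)"

definition chanV :: "(nat \<Rightarrow> 'y1::finite \<Rightarrow> 'y2::finite \<Rightarrow> 'z::finite \<Rightarrow> real) \<Rightarrow> nat \<Rightarrow> 'y2 \<Rightarrow> real" where
  "chanV P x y2 = (\<Sum>y1\<in>UNIV. \<Sum>z\<in>UNIV. P x y1 y2 z)"

definition chanQ :: "(nat \<Rightarrow> 'y1::finite \<Rightarrow> 'y2::finite \<Rightarrow> 'z::finite \<Rightarrow> real) \<Rightarrow> nat \<Rightarrow> 'z \<Rightarrow> real" where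
  "chanQ P x z = (\<Sum>y1\<in>UNIV. \<Sum>y2\<in>UNIV. P x y1 y2 z)"

definition relent :: "('a \<Rightarrow> real) \<Rightarrow> ('a \<Rightarrow> real) \<Rightarrow> 'a set \<Rightarrow> real" where
  "relent f g A = (\<Sum>a\<in>A. if f a = 0 then 0 else f a * ln (f a / g a))"

definition chi2 :: "('z::finite \<Rightarrow> real) \<Rightarrow> ('z \<Rightarrow> real) \<Rightarrow> real" where
  "chi2 Q1 Q0 = (\<Sum>z\<in>UNIV. (Q1 z - Q0 z)^2 / Q0 z)"

definition abs_cont :: "('a \<Rightarrow> real) \<Rightarrow> ('a \<Rightarrow> real) \<Rightarrow> bool" where
  "abs_cont f g \<longleftrightarrow> (\<forall>a. g a = 0 \<longrightarrow> f a = 0)"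

text \<open>Probability vectors (p_1,...,p_K) (values outside {1..K} irrelevant).\<close>
definition prob_vecs :: "nat \<Rightarrow> (nat \<Rightarrow> real) set" where
  "prob_vecs K = {p. (\<forall>k\<in>{1..K}. 0 \<le> p k) \<and> (\<Sum>k=1..K. p k) = 1}"

text \<open>Covert capacity L^*(P_{Y,Z|X}) of a point-to-point channel with warden,
  given by its main channel W' and warden channel Q (the maximum written as a supremum).\<close>
definition covert_cap :: "nat \<Rightarrow> (nat \<Rightarrow> 'y::finite \<Rightarrow> real) \<Rightarrow> (nat \<Rightarrow> 'z::finite \<Rightarrow> real) \<Rightarrow> real" where
  "covert_cap K W' Q = Sup ((\<lambda>p. sqrt (2 * (\<Sum>k=1..K. p k * relent (W' k) (W' 0) UNIV)^2 /
        chi2 (\<lambda>z. \<Sum>k=1..K. p k * Q k z) (Q 0))) ` prob_vecs K)"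

definition input_dists :: "nat \<Rightarrow> (nat \<Rightarrow> real) set" where
  "input_dists K = {p. (\<forall>x\<in>{0..K}. 0 \<le> p x) \<and> (\<Sum>x=0..K. p x) = 1}"

definition mutual_info :: "nat \<Rightarrow> (nat \<Rightarrow> real) \<Rightarrow> (nat \<Rightarrow> 'y::finite \<Rightarrow> real) \<Rightarrow> real" where
  "mutual_info K p W' = (\<Sum>x=0..K. \<Sum>y\<in>UNIV.
      (if p x * W' x y = 0 then 0
       else p x * W' x y * ln (W' x y / (\<Sum>x'=0..K. p x' * W' x' y))))"

text \<open>Codes. Messages in {1..M1}, {1..M2}, key in {1..Kn}; codewords are lists of
  length n over {0..K}; decoders map an output sequence (list of length n) and a key
  to a message.\<close>
definition is_code :: "nat \<Rightarrow> nat \<Rightarrow> nat \<Rightarrow> nat \<Rightarrow> nat \<Rightarrow>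
    (nat \<Rightarrow> nat \<Rightarrow> nat \<Rightarrow> nat list) \<Rightarrow> ('y1 list \<Rightarrow> nat \<Rightarrow> nat) \<Rightarrow> ('y2 list \<Rightarrow> nat \<Rightarrow> nat) \<Rightarrow> bool" where
  "is_code K n M1 M2 Kn enc dec1 dec2 \<longleftrightarrow> M1 \<ge> 1 \<and> M2 \<ge> 1 \<and> Kn \<ge> 1 \<and>
     (\<forall>w1\<in>{1..M1}. \<forall>w2\<in>{1..M2}. \<forall>s\<in>{1..Kn}.
        length (enc w1 w2 s) = n \<and> set (enc w1 w2 s) \<subseteq> {0..K}) \<and>
     (\<forall>ys s. length ys = n \<and> s \<in> {1..Kn} \<longrightarrow> dec1 ys s \<in> {1..M1}) \<and>
     (\<forall>ys s. length ys = n \<and> s \<in> {1..Kn} \<longrightarrow> dec2 ys s \<in> {1..M2})"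

definition code_error :: "(nat \<Rightarrow> 'y1::finite \<Rightarrow> 'y2::finite \<Rightarrow> 'z::finite \<Rightarrow> real) \<Rightarrow> nat \<Rightarrow> nat \<Rightarrow> nat \<Rightarrow> nat \<Rightarrow>
    (nat \<Rightarrow> nat \<Rightarrow> nat \<Rightarrow> nat list) \<Rightarrow> ('y1 list \<Rightarrow> nat \<Rightarrow> nat) \<Rightarrow> ('y2 list \<Rightarrow> nat \<Rightarrow> nat) \<Rightarrow> real" where
  "code_error P n M1 M2 Kn enc dec1 dec2 =
     (\<Sum>w1=1..M1. \<Sum>w2=1..M2. \<Sum>s=1..Kn.
        \<Sum>y1s\<in>{ys. length ys = n}. \<Sum>y2s\<in>{ys. length ys = n}. \<Sum>zs\<in>{ys. length ys = n}.
          (\<Prod>i<n. P (enc w1 w2 s ! i) (y1s ! i) (y2s ! i) (zs ! i)) *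
          (if dec1 y1s s \<noteq> w1 \<or> dec2 y2s s \<noteq> w2 then 1 else 0)) / (real M1 * real M2 * real Kn)"

definition warden_dist :: "(nat \<Rightarrow> 'y1::finite \<Rightarrow> 'y2::finite \<Rightarrow> 'z::finite \<Rightarrow> real) \<Rightarrow> nat \<Rightarrow> nat \<Rightarrow> nat \<Rightarrow> nat \<Rightarrow>
    (nat \<Rightarrow> nat \<Rightarrow> nat \<Rightarrow> nat list) \<Rightarrow> 'z list \<Rightarrow> real" where
  "warden_dist P n M1 M2 Kn enc zs =
     (\<Sum>w1=1..M1. \<Sum>w2=1..M2. \<Sum>s=1..Kn. \<Prod>i<n. chanQ P (enc w1 w2 s ! i) (zs ! i))
       / (real M1 * real M2 * real Kn)"

definition no_input_dist :: "(nat \<Rightarrow> 'y1::finite \<Rightarrow> 'y2::finite \<Rightarrow> 'z::finite \<Rightarrow> real) \<Rightarrow> nat \<Rightarrow> 'z list \<Rightarrow> real" where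
  "no_input_dist P n zs = (\<Prod>i<n. chanQ P 0 (zs ! i))"

definition covertness :: "(nat \<Rightarrow> 'y1::finite \<Rightarrow> 'y2::finite \<Rightarrow> 'z::finite \<Rightarrow> real) \<Rightarrow> nat \<Rightarrow> nat \<Rightarrow> nat \<Rightarrow> nat \<Rightarrow>
    (nat \<Rightarrow> nat \<Rightarrow> nat \<Rightarrow> nat list) \<Rightarrow> real" where
  "covertness P n M1 M2 Kn enc =
     relent (warden_dist P n M1 M2 Kn enc) (no_input_dist P n) {zs. length zs = n}"

definition achievable :: "nat \<Rightarrow> (nat \<Rightarrow> 'y1::finite \<Rightarrow> 'y2::finite \<Rightarrow> 'z::finite \<Rightarrow> real) \<Rightarrow> real \<Rightarrow> real \<Rightarrow> real \<times> real \<Rightarrow> bool" where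
  "achievable K P \<epsilon> \<delta> L \<longleftrightarrow> fst L \<ge> 0 \<and> snd L \<ge> 0 \<and>
     (\<exists>(M1::nat \<Rightarrow> nat) (M2::nat \<Rightarrow> nat) (Kn::nat \<Rightarrow> nat)
        (enc::nat \<Rightarrow> nat \<Rightarrow> nat \<Rightarrow> nat \<Rightarrow> nat list)
        (dec1::nat \<Rightarrow> 'y1 list \<Rightarrow> nat \<Rightarrow> nat) (dec2::nat \<Rightarrow> 'y2 list \<Rightarrow> nat \<Rightarrow> nat).
        (\<forall>n. is_code K n (M1 n) (M2 n) (Kn n) (enc n) (dec1 n) (dec2 n) \<and>
             covertness P n (M1 n) (M2 n) (Kn n) (enc n) \<le> \<delta>) \<and>
        Liminf sequentially (\<lambda>n. ereal (ln (real (M1 n)) / sqrt (real n * \<delta>))) \<ge> ereal (fst L) \<and>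
        Liminf sequentially (\<lambda>n. ereal (ln (real (M2 n)) / sqrt (real n * \<delta>))) \<ge> ereal (snd L) \<and>
        Limsup sequentially (\<lambda>n. ereal (code_error P n (M1 n) (M2 n) (Kn n) (enc n) (dec1 n) (dec2 n)))
          \<le> ereal \<epsilon>)"

definition region_eps :: "nat \<Rightarrow> (nat \<Rightarrow> 'y1::finite \<Rightarrow> 'y2::finite \<Rightarrow> 'z::finite \<Rightarrow> real) \<Rightarrow> real \<Rightarrow> real \<Rightarrow> (real \<times> real) set" where
  "region_eps K P \<epsilon> \<delta> = closure {L. achievable K P \<epsilon> \<delta> L}"

definition covert_region :: "nat \<Rightarrow> (nat \<Rightarrow> 'y1::finite \<Rightarrow> 'y2::finite \<Rightarrow> 'z::finite \<Rightarrow> real) \<Rightarrow> real \<Rightarrow> (real \<times> real) set" where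
  "covert_region K P \<delta> = (\<Inter>\<epsilon>\<in>{0<..<1}. region_eps K P \<epsilon> \<delta>)"

text \<open>The set {L in R_+^2 : L1/L1* + L2/L2* <= 1}, with L/0 read as +infinity for L > 0
  and as 0 for L = 0.\<close>
definition ratio_term :: "real \<Rightarrow> real \<Rightarrow> ereal" where
  "ratio_term L Ls = (if Ls = 0 then (if L = 0 then 0 else \<infinity>) else ereal (L / Ls))"

end

theory Submission
  imports Defs
begin

text \<open>
  Converse. Suppose $L_2^* \le L_1^*$ and put $c = L_2^*/L_1^* \le 1$. The hypothesis
  $c\, I(X;Y_1) \le I(X;Y_2)$ tensorizes (this is where $c \le 1$ is needed), so Fano's inequality for both
  users and the chain rule give
  $c \log M_1 + \log M_2 \lesssim I(X^n;Y_2^n|S) \le n \sum_k \bar p_k D(V_k\|V_0)$, where $\bar p$ is the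
  average input distribution over positions. The warden's divergence is at least $n D(\bar Q\|Q_0)$, which is
  $n \chi_2(\bar Q\|Q_0)/2$ to first order, and the definition of $L_2^*$ turns this into the bound
  $L_2^* \sqrt{n\delta}$. A weak converse suffices because the region is intersected over all error levels.

  Achievability. Since the key is unlimited, it may select the whole random codebook. The warden then sees
  an exact product distribution and the error is exactly the ensemble average, so no resolvability argument is
  needed. The two users share time: a fraction $\theta$ of the block serves user 1, the rest user 2.
\<close>

section \<open>Product channels and Gibbs' inequality\<close>

text \<open>The boundary is a straight line because of the square-root law: a fraction
  \<open>\<theta>\<close> of the block with a fraction \<open>\<theta>\<close> of the divergence
  budget carries rates of order \<open>sqrt (\<theta> * n * \<theta> * \<delta>) = \<theta> * sqrt
  (n * \<delta>)\<close>. Two obstacles shape the converse. The hypothesis compares single-letter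
  informations, while the chain rule produces conditional ones; with unnormalised input weights,
  conditioning becomes plain summation. And the expansion of the divergence must hold uniformly over
  all average inputs; a divergence of order \<open>1 / n\<close> itself forces every likelihood
  ratio of the warden to within order \<open>1 / sqrt n\<close> of 1. In the achievability part the
  input law varies with \<open>n\<close>: nonzero symbols have total weight of order
  \<open>1 / sqrt n\<close>. A uniform key simulates it exactly if the weights are
  \<open>b k / N\<close> with integers \<open>b k\<close> and \<open>N\<close> close to
  \<open>C * sqrt n\<close>. The same scaling lets the decoder test against the no-input output law
  instead of the true one: the change of measure costs a factor \<open>(1 + const / N^2)^n\<close>,
  which stays bounded.\<close>

definition seqs :: "'a set \<Rightarrow> nat \<Rightarrow> 'a list set" where
  "seqs A n = {ys. set ys \<subseteq> A \<and> length ys = n}"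

lemma seqs_UNIV: "{ys. length ys = n} = seqs UNIV n"
  by (simp add: seqs_def)

lemma finite_seqs [simp]: "finite A \<Longrightarrow> finite (seqs A n)"
  unfolding seqs_def by (rule finite_lists_length_eq)

lemma card_seqs: "finite A \<Longrightarrow> card (seqs A n) = card A ^ n"
  unfolding seqs_def by (rule card_lists_length_eq)

lemma seqs_0 [simp]: "seqs A 0 = {[]}"
  by (auto simp: seqs_def)

lemma length_seqs: "ys \<in> seqs A n \<Longrightarrow> length ys = n"
  by (simp add: seqs_def)

lemma nth_seqs: "ys \<in> seqs A n \<Longrightarrow> i < n \<Longrightarrow> ys ! i \<in> A"
  by (auto simp: seqs_def)

lemma sum_seqs_append:
  fixes f :: "'a list \<Rightarrow> 'b::comm_monoid_add"
  shows "(\<Sum>ys\<in>seqs A (m + k). f ys) = (\<Sum>u\<in>seqs A m. \<Sum>v\<in>seqs A k. f (u @ v))"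
proof -
  have "(\<Sum>u\<in>seqs A m. \<Sum>v\<in>seqs A k. f (u @ v)) = (\<Sum>(u,v)\<in>seqs A m \<times> seqs A k. f (u @ v))"
    by (rule sum.cartesian_product)
  also have "\<dots> = (\<Sum>ys\<in>seqs A (m + k). f ys)"
  proof (rule sum.reindex_bij_witness[where i = "\<lambda>ys. (take m ys, drop m ys)" and j = "\<lambda>(u,v). u @ v"])
    fix ys assume "ys \<in> seqs A (m + k)"
    then show "(take m ys, drop m ys) \<in> seqs A m \<times> seqs A k"
      by (auto simp: seqs_def dest: in_set_takeD in_set_dropD)
  qed (auto simp: seqs_def)
  finally show ?thesis by simp
qed

lemma seqs_1: "seqs A (Suc 0) = (\<lambda>y. [y]) ` A"
  by (auto simp: seqs_def length_Suc_conv)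

lemma sum_seqs_Suc:
  fixes f :: "'a list \<Rightarrow> 'b::comm_monoid_add"
  shows "(\<Sum>ys\<in>seqs A (Suc n). f ys) = (\<Sum>y\<in>A. \<Sum>ys\<in>seqs A n. f (y # ys))"
proof -
  have "(\<Sum>ys\<in>seqs A (Suc 0 + n). f ys) = (\<Sum>u\<in>seqs A (Suc 0). \<Sum>v\<in>seqs A n. f (u @ v))"
    by (rule sum_seqs_append)
  also have "\<dots> = (\<Sum>y\<in>A. \<Sum>ys\<in>seqs A n. f (y # ys))"
    unfolding seqs_1 by (subst sum.reindex) (auto simp: inj_on_def)
  finally show ?thesis by simp
qed

lemma sum_seqs_prod:
  fixes f :: "nat \<Rightarrow> 'a \<Rightarrow> real"
  shows "(\<Sum>ys\<in>seqs A n. \<Prod>i<n. f i (ys ! i)) = (\<Prod>i<n. \<Sum>y\<in>A. f i y)"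
proof (induction n arbitrary: f)
  case (Suc n)
  have "(\<Sum>ys\<in>seqs A (Suc n). \<Prod>i<Suc n. f i (ys ! i))
      = (\<Sum>y\<in>A. f 0 y * (\<Sum>ys\<in>seqs A n. \<Prod>i<n. f (Suc i) (ys ! i)))"
    by (simp add: sum_seqs_Suc prod.lessThan_Suc_shift sum_distrib_left del: prod.lessThan_Suc)
  also have "\<dots> = (\<Prod>i<Suc n. \<Sum>y\<in>A. f i y)"
    by (simp add: Suc.IH[of "\<lambda>i. f (Suc i)"] prod.lessThan_Suc_shift sum_distrib_right
        del: prod.lessThan_Suc)
  finally show ?case .
qed simp

section \<open>Memoryless channels acting on words\<close>

definition stoch :: "nat \<Rightarrow> (nat \<Rightarrow> 'y::finite \<Rightarrow> real) \<Rightarrow> bool" where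
  "stoch K W \<longleftrightarrow> (\<forall>x\<le>K. (\<forall>y. 0 \<le> W x y) \<and> (\<Sum>y\<in>UNIV. W x y) = 1)"

definition chn :: "(nat \<Rightarrow> 'y \<Rightarrow> real) \<Rightarrow> nat list \<Rightarrow> 'y list \<Rightarrow> real" where
  "chn W xs ys = (\<Prod>i<length xs. W (xs ! i) (ys ! i))"

lemma stoch_nonneg: "stoch K W \<Longrightarrow> x \<le> K \<Longrightarrow> 0 \<le> W x y"
  by (simp add: stoch_def)

lemma stoch_sum: "stoch K W \<Longrightarrow> x \<le> K \<Longrightarrow> (\<Sum>y\<in>UNIV. W x y) = 1"
  by (simp add: stoch_def)

lemma stoch_le1: "stoch K W \<Longrightarrow> x \<le> K \<Longrightarrow> W x y \<le> 1"
  using member_le_sum[of y UNIV "W x"] by (simp add: stoch_def)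

lemma chn_Nil [simp]: "chn W [] ys = 1"
  by (simp add: chn_def)

lemma chn_Cons [simp]: "chn W (x # xs) (y # ys) = W x y * chn W xs ys"
  by (simp add: chn_def prod.lessThan_Suc_shift del: prod.lessThan_Suc)

lemma chn_append: "length u = length xs \<Longrightarrow> chn W (xs @ xs') (u @ v) = chn W xs u * chn W xs' v"
proof (induction xs arbitrary: u)
  case (Cons x xs)
  then show ?case by (cases u) auto
qed simp

lemma chn_nonneg: "stoch K W \<Longrightarrow> xs \<in> seqs {0..K} n \<Longrightarrow> 0 \<le> chn W xs ys"
  unfolding chn_def by (intro prod_nonneg) (auto simp: seqs_def subset_iff intro!: stoch_nonneg)

lemma sum_chn: "stoch K W \<Longrightarrow> xs \<in> seqs {0..K} n \<Longrightarrow> (\<Sum>ys\<in>seqs UNIV n. chn W xs ys) = 1"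
  unfolding chn_def
  by (simp add: length_seqs, subst sum_seqs_prod)
     (auto intro!: prod.neutral dest: nth_seqs simp: stoch_sum)

text \<open>Linearity of expectation. Peeling off one letter leaves a factor that sums to 1, so only
  the single-letter expectations survive.\<close>

lemma sum_chn_additive:
  fixes g :: "nat \<Rightarrow> 'y::finite \<Rightarrow> real"
  assumes W: "stoch K W" and "xs \<in> seqs {0..K} n"
  shows "(\<Sum>ys\<in>seqs UNIV n. chn W xs ys * (\<Sum>i<n. g (xs ! i) (ys ! i)))
     = (\<Sum>i<n. \<Sum>y\<in>UNIV. W (xs ! i) y * g (xs ! i) y)"
  using assms(2)
proof (induction n arbitrary: xs)
  case (Suc n)
  then obtain x xs' where xs: "xs = x # xs'" and x: "x \<le> K" and xs': "xs' \<in> seqs {0..K} n"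
    by (cases xs) (auto simp: seqs_def)
  have "(\<Sum>ys\<in>seqs UNIV (Suc n). chn W xs ys * (\<Sum>i<Suc n. g (xs ! i) (ys ! i)))
     = (\<Sum>y\<in>UNIV. \<Sum>ys\<in>seqs UNIV n. W x y * g x y * chn W xs' ys
          + W x y * (chn W xs' ys * (\<Sum>i<n. g (xs' ! i) (ys ! i))))"
    by (simp add: sum_seqs_Suc sum.lessThan_Suc_shift xs algebra_simps del: sum.lessThan_Suc)
  also have "\<dots> = (\<Sum>y\<in>UNIV. W x y * g x y) + (\<Sum>y\<in>UNIV. W x y) *
        (\<Sum>ys\<in>seqs UNIV n. chn W xs' ys * (\<Sum>i<n. g (xs' ! i) (ys ! i)))"
    by (simp add: sum.distrib sum_distrib_left[symmetric] sum_distrib_right[symmetric]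
        sum_chn[OF W xs'])
  also have "\<dots> = (\<Sum>i<Suc n. \<Sum>y\<in>UNIV. W (xs ! i) y * g (xs ! i) y)"
    by (simp add: Suc.IH[OF xs'] stoch_sum[OF W x] xs sum.lessThan_Suc_shift del: sum.lessThan_Suc)
  finally show ?case .
qed simp

section \<open>Gibbs' inequality and the log-sum inequality\<close>

lemma Gibbs_pointwise:
  fixes a b :: real
  assumes "0 \<le> a" "0 \<le> b" "b = 0 \<Longrightarrow> a = 0"
  shows "a * ln b \<le> a * ln a - a + b"
proof (cases "a = 0")
  case False
  then have a: "a > 0" and b: "b > 0" using assms by (auto simp: less_le)
  have "ln (b / a) \<le> b / a - 1" using a b by (intro ln_le_minus_one) simp
  then have "a * ln (b / a) \<le> a * (b / a - 1)" using a by (intro mult_left_mono) auto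
  then show ?thesis using a b by (simp add: ln_div algebra_simps)
qed (use assms in auto)

text \<open>Since \<open>ln 0 = 0\<close> here, zero entries need no case distinction as long as
  \<open>g x = 0\<close> forces \<open>f x = 0\<close>. Only a comparison of total masses is
  required, so the reference weights may be unnormalised.\<close>

lemma Gibbs:
  fixes f g :: "'a \<Rightarrow> real"
  assumes "\<And>x. x \<in> A \<Longrightarrow> 0 \<le> f x" "\<And>x. x \<in> A \<Longrightarrow> 0 \<le> g x" "\<And>x. x \<in> A \<Longrightarrow> g x = 0 \<Longrightarrow> f x = 0"
    and "sum g A \<le> sum f A"
  shows "(\<Sum>x\<in>A. f x * ln (g x)) \<le> (\<Sum>x\<in>A. f x * ln (f x))"
proof -
  have "(\<Sum>x\<in>A. f x * ln (g x)) \<le> (\<Sum>x\<in>A. f x * ln (f x) - f x + g x)"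
    by (intro sum_mono Gibbs_pointwise assms)
  then show ?thesis using assms(4) by (simp add: sum.distrib sum_subtractf)
qed

text \<open>Gibbs' inequality after rescaling \<open>g\<close> by the factor \<open>r\<close> that
  gives it the total mass of \<open>f\<close>.\<close>

lemma log_sum_inequality:
  fixes f g :: "'a \<Rightarrow> real"
  assumes "\<And>x. x \<in> A \<Longrightarrow> 0 \<le> f x" "\<And>x. x \<in> A \<Longrightarrow> 0 \<le> g x" "\<And>x. x \<in> A \<Longrightarrow> g x = 0 \<Longrightarrow> f x = 0"
    and "finite A"
  shows "sum f A * ln (sum f A) - sum f A * ln (sum g A)
     \<le> (\<Sum>x\<in>A. f x * ln (f x) - f x * ln (g x))"
proof (cases "sum f A = 0")
  case True
  then have "\<And>x. x \<in> A \<Longrightarrow> f x = 0" using assms sum_nonneg_eq_0_iff[of A f] by auto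
  then show ?thesis using True by simp
next
  case False
  then have F: "sum f A > 0" using sum_nonneg[of A f] assms(1) by (auto simp: less_le)
  have "\<exists>x\<in>A. g x \<noteq> 0"
  proof (rule ccontr)
    assume "\<not> ?thesis"
    then have "sum f A = 0" using assms(3) by (intro sum.neutral) auto
    then show False using False by simp
  qed
  then have G: "sum g A > 0" using assms sum_nonneg_eq_0_iff[of A g] sum_nonneg[of A g]
    by (auto simp: less_le)
  define r where "r = sum f A / sum g A"
  have r: "r > 0" using F G by (simp add: r_def)
  have "(\<Sum>x\<in>A. f x * ln (r * g x)) \<le> (\<Sum>x\<in>A. f x * ln (f x))"
  proof (intro Gibbs)
    have "(\<Sum>x\<in>A. r * g x) = sum f A" 
      unfolding sum_distrib_left[symmetric] using G by (simp add: r_def)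
    then show "(\<Sum>x\<in>A. r * g x) \<le> sum f A" by simp
  qed (use assms r in auto)
  moreover have "(\<Sum>x\<in>A. f x * ln (r * g x)) = (\<Sum>x\<in>A. f x * ln r + f x * ln (g x))"
  proof (rule sum.cong)
    fix x assume "x \<in> A"
    show "f x * ln (r * g x) = f x * ln r + f x * ln (g x)"
      using r assms(2,3)[OF \<open>x \<in> A\<close>]
      by (cases "g x = 0") (auto simp: ln_mult algebra_simps)
  qed simp
  moreover have "(\<Sum>x\<in>A. f x * ln r) = sum f A * ln (sum f A) - sum f A * ln (sum g A)"
    
    unfolding sum_distrib_right[symmetric] using F G by (simp add: r_def ln_div algebra_simps)
  ultimately show ?thesis by (simp add: sum.distrib sum_subtractf)
qed

section \<open>Tensorization of the mutual information condition\<close>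

abbreviation xlnx :: "real \<Rightarrow> real" where
  "xlnx t \<equiv> t * ln t"

text \<open>Mutual information extended to unnormalised inputs as a function homogeneous of degree 1, so that
  conditional mutual informations become plain sums.\<close>

definition minfo :: "'a set \<Rightarrow> 'b set \<Rightarrow> ('a \<Rightarrow> real) \<Rightarrow> ('a \<Rightarrow> 'b \<Rightarrow> real) \<Rightarrow> real" where
  "minfo X Y \<mu> W = sum \<mu> X * ln (sum \<mu> X)
     - (\<Sum>y\<in>Y. xlnx (\<Sum>x\<in>X. \<mu> x * W x y))
     + (\<Sum>x\<in>X. \<mu> x * (\<Sum>y\<in>Y. W x y * ln (W x y)))"

lemma xlnx_scale: "0 \<le> t \<Longrightarrow> 0 \<le> m \<Longrightarrow> (t * m) * ln (t * m) = t * (m * ln m) + m * (t * ln (t::real))"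
  by (cases "t = 0"; cases "m = 0") (auto simp: ln_mult algebra_simps)

text \<open>The \<open>t * ln t\<close> terms coming from the input mass and from the output masses
  cancel, because the rows of \<open>W\<close> sum to 1 and both masses therefore agree.\<close>

lemma minfo_scale:
  assumes "0 \<le> t" "\<And>x. x \<in> X \<Longrightarrow> 0 \<le> \<mu> x" "\<And>x y. x \<in> X \<Longrightarrow> y \<in> Y \<Longrightarrow> 0 \<le> W x y"
    and "\<And>x. x \<in> X \<Longrightarrow> (\<Sum>y\<in>Y. W x y) = 1"
  shows "minfo X Y (\<lambda>x. t * \<mu> x) W = t * minfo X Y \<mu> W"
proof -
  have tot: "(\<Sum>y\<in>Y. \<Sum>x\<in>X. \<mu> x * W x y) = sum \<mu> X"
    by (subst sum.swap) (simp add: assms(4) flip: sum_distrib_left)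
  have 1: "(\<Sum>x\<in>X. t * \<mu> x) = t * sum \<mu> X" by (simp add: sum_distrib_left)
  have 2: "(\<Sum>x\<in>X. t * \<mu> x * W x y) = t * (\<Sum>x\<in>X. \<mu> x * W x y)" for y
    by (simp add: sum_distrib_left mult.assoc)
  have 3: "(\<Sum>x\<in>X. t * \<mu> x * c x) = t * (\<Sum>x\<in>X. \<mu> x * c x)" for c
    by (simp add: sum_distrib_left mult.assoc)
  have 4: "(\<Sum>y\<in>Y. xlnx (t * (\<Sum>x\<in>X. \<mu> x * W x y)))
     = t * (\<Sum>y\<in>Y. xlnx (\<Sum>x\<in>X. \<mu> x * W x y)) + sum \<mu> X * (t * ln t)"
  proof -
    have "(\<Sum>y\<in>Y. xlnx (t * (\<Sum>x\<in>X. \<mu> x * W x y)))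
      = (\<Sum>y\<in>Y. t * (xlnx (\<Sum>x\<in>X. \<mu> x * W x y)) + (\<Sum>x\<in>X. \<mu> x * W x y) * (t * ln t))"
      by (intro sum.cong xlnx_scale assms sum_nonneg mult_nonneg_nonneg) auto
    also have "\<dots> = t * (\<Sum>y\<in>Y. xlnx (\<Sum>x\<in>X. \<mu> x * W x y))
        + (\<Sum>y\<in>Y. (\<Sum>x\<in>X. \<mu> x * W x y)) * (t * ln t)"
      by (simp only: sum.distrib sum_distrib_left sum_distrib_right)
    finally show ?thesis by (simp add: tot)
  qed
  have 5: "(t * sum \<mu> X) * ln (t * sum \<mu> X) = t * (sum \<mu> X * ln (sum \<mu> X)) + sum \<mu> X * (t * ln t)"
    by (intro xlnx_scale assms sum_nonneg) auto
  show ?thesis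
    unfolding minfo_def 1 2 3 4 5 by (simp only: ring_distribs)
qed

lemma minfo_null:
  assumes "\<And>x. x \<in> X \<Longrightarrow> \<mu> x = 0"
  shows "minfo X Y \<mu> W = 0"
  using assms by (simp add: minfo_def)

lemma minfo_cong:
  assumes "\<And>x. x \<in> X \<Longrightarrow> \<mu> x = \<nu> x"
  shows "minfo X Y \<mu> W = minfo X Y \<nu> W"
  unfolding minfo_def using assms by (simp cong: sum.cong)

lemma mutual_info_eq_minfo:
  assumes p: "p \<in> input_dists K" and W: "stoch K W"
  shows "mutual_info K p W = minfo {0..K} UNIV p W"
proof -
  have p0: "\<And>x. x \<le> K \<Longrightarrow> 0 \<le> p x" and p1: "(\<Sum>x=0..K. p x) = 1"
    using p by (auto simp: input_dists_def)
  define O' where "O' y = (\<Sum>x'=0..K. p x' * W x' y)" for y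
  have "mutual_info K p W = (\<Sum>x=0..K. \<Sum>y\<in>UNIV.
      p x * (W x y * ln (W x y)) - p x * W x y * ln (O' y))"
    unfolding mutual_info_def O'_def[symmetric]
  proof (intro sum.cong refl)
    fix x y assume x: "x \<in> {0..K}"
    show "(if p x * W x y = 0 then 0 else p x * W x y * ln (W x y / O' y))
       = p x * (W x y * ln (W x y)) - p x * W x y * ln (O' y)"
    proof (cases "p x * W x y = 0")
      case False
      have "0 \<le> p x' * W x' y" if "x' \<in> {0..K}" for x'
        using that p0 stoch_nonneg[OF W] by auto
      then have "p x * W x y \<le> O' y"
        unfolding O'_def using x by (intro member_le_sum) auto
      moreover have px: "p x > 0" and Wx: "W x y > 0"
        using False p0[of x] stoch_nonneg[OF W, of x y] x
        by (auto intro!: order.not_eq_order_implies_strict)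
      moreover have "p x * W x y > 0" using px Wx by simp
      ultimately have "O' y > 0" by linarith
      then show ?thesis using px Wx by (simp add: ln_div algebra_simps)
    qed auto
  qed
  also have "\<dots> = (\<Sum>x=0..K. p x * (\<Sum>y\<in>UNIV. W x y * ln (W x y)))
      - (\<Sum>x=0..K. \<Sum>y\<in>UNIV. p x * W x y * ln (O' y))"
    by (simp add: sum_subtractf sum_distrib_left)
  also have "(\<Sum>x=0..K. \<Sum>y\<in>UNIV. p x * W x y * ln (O' y)) = (\<Sum>y\<in>UNIV. O' y * ln (O' y))"
    by (subst sum.swap) (simp add: O'_def sum_distrib_right)
  finally show ?thesis unfolding minfo_def O'_def by (simp add: p1)
qed

text \<open>The joint weights that appear in the chain rule are not normalised; homogeneity carries
  the hypothesis over to them.\<close>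

lemma minfo_condition_homogeneous:
  assumes W: "stoch K W" and V: "stoch K V"
    and cond: "\<And>p. p \<in> input_dists K \<Longrightarrow> c * mutual_info K p W \<le> mutual_info K p V"
    and \<mu>: "\<And>x. x \<in> {0..K} \<Longrightarrow> 0 \<le> \<mu> x"
  shows "c * minfo {0..K} UNIV \<mu> W \<le> minfo {0..K} UNIV \<mu> V"
proof (cases "sum \<mu> {0..K} = 0")
  case True
  then have "\<And>x. x \<in> {0..K} \<Longrightarrow> \<mu> x = 0" using \<mu> sum_nonneg_eq_0_iff[of "{0..K}" \<mu>] by auto
  then have "minfo {0..K} UNIV \<mu> W = 0" "minfo {0..K} UNIV \<mu> V = 0" by (auto intro: minfo_null)
  then show ?thesis by simp
next
  case False
  define t where "t = sum \<mu> {0..K}"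
  have t: "t > 0" using False \<mu> sum_nonneg[of "{0..K}" \<mu>]
    unfolding t_def by (intro order.not_eq_order_implies_strict) auto
  define p where "p = (\<lambda>x. \<mu> x / t)"
  have "(\<Sum>x\<in>{0..K}. \<mu> x / t) = 1" using t by (simp add: t_def flip: sum_divide_distrib)
  then have p: "p \<in> input_dists K" using \<mu> t by (auto simp: input_dists_def p_def)
  have eq: "minfo {0..K} UNIV \<mu> W' = t * mutual_info K p W'" if "stoch K W'" for W' :: "nat \<Rightarrow> 'c::finite \<Rightarrow> real"
  proof -
    have "minfo {0..K} UNIV \<mu> W' = minfo {0..K} UNIV (\<lambda>x. t * p x) W'"
      using t by (intro minfo_cong) (simp add: p_def)
    also have "\<dots> = t * minfo {0..K} UNIV p W'"
      using t p that by (intro minfo_scale) (auto simp: input_dists_def stoch_def)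
    finally show ?thesis by (simp add: mutual_info_eq_minfo[OF p that])
  qed
  have "t * (c * mutual_info K p W) \<le> t * mutual_info K p V"
    using cond[OF p] t by (intro mult_left_mono) auto
  then show ?thesis by (simp add: eq[OF W] eq[OF V] algebra_simps)
qed

text \<open>With \<open>\<kappa>\<close> read as the joint weight of \<open>Z\<close> and
  \<open>X\<close>, this is \<open>I(X;Y|Z) \<le> I(X;Y)\<close> for the Markov chain Z - X - Y. The
  row entropies enter linearly and cancel; for each \<open>z\<close> the rest is the log-sum
  inequality over \<open>Y\<close>.\<close>

lemma minfo_superadditive:
  assumes "\<And>z x. z \<in> Z \<Longrightarrow> x \<in> X \<Longrightarrow> 0 \<le> \<kappa> z x" "\<And>x y. x \<in> X \<Longrightarrow> y \<in> Y \<Longrightarrow> 0 \<le> W x y"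
    and W1: "\<And>x. x \<in> X \<Longrightarrow> (\<Sum>y\<in>Y. W x y) = 1" and fin: "finite Z" "finite X" "finite Y"
  shows "(\<Sum>z\<in>Z. minfo X Y (\<kappa> z) W) \<le> minfo X Y (\<lambda>x. \<Sum>z\<in>Z. \<kappa> z x) W"
proof -
  define o' where "o' z y = (\<Sum>x\<in>X. \<kappa> z x * W x y)" for z y
  define m where "m z = sum (\<kappa> z) X" for z
  have o0: "z \<in> Z \<Longrightarrow> y \<in> Y \<Longrightarrow> 0 \<le> o' z y" for z y
    unfolding o'_def by (intro sum_nonneg mult_nonneg_nonneg assms)
  have om: "(\<Sum>y\<in>Y. o' z y) = m z" for z
    unfolding o'_def m_def by (subst sum.swap) (simp add: W1 flip: sum_distrib_left)
  have M: "(\<Sum>x\<in>X. \<Sum>z\<in>Z. \<kappa> z x) = (\<Sum>z\<in>Z. m z)"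
    unfolding m_def by (rule sum.swap)
  have O: "(\<Sum>x\<in>X. (\<Sum>z\<in>Z. \<kappa> z x) * W x y) = (\<Sum>z\<in>Z. o' z y)" for y
    unfolding o'_def by (subst sum.swap) (simp add: sum_distrib_right)
  have H: "(\<Sum>x\<in>X. (\<Sum>z\<in>Z. \<kappa> z x) * h x) = (\<Sum>z\<in>Z. \<Sum>x\<in>X. \<kappa> z x * h x)" for h :: "'b \<Rightarrow> real"
    by (subst sum.swap) (simp add: sum_distrib_right)
  have key: "m z * ln (m z) - m z * ln (\<Sum>z\<in>Z. m z)
      \<le> (\<Sum>y\<in>Y. o' z y * ln (o' z y) - o' z y * ln (\<Sum>z\<in>Z. o' z y))" if z: "z \<in> Z" for z
  proof -
    have "sum (o' z) Y * ln (sum (o' z) Y) - sum (o' z) Y * ln (\<Sum>y\<in>Y. \<Sum>z\<in>Z. o' z y)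
      \<le> (\<Sum>y\<in>Y. o' z y * ln (o' z y) - o' z y * ln (\<Sum>z\<in>Z. o' z y))"
    proof (rule log_sum_inequality)
      fix y assume y: "y \<in> Y" and "(\<Sum>z\<in>Z. o' z y) = 0"
      then show "o' z y = 0" using o0 fin z by (simp add: sum_nonneg_eq_0_iff)
    qed (use o0 z fin in \<open>auto intro!: sum_nonneg\<close>)
    moreover have "(\<Sum>y\<in>Y. \<Sum>z\<in>Z. o' z y) = (\<Sum>z\<in>Z. m z)"
      by (subst sum.swap) (simp add: om)
    ultimately show ?thesis by (simp add: om)
  qed
  have "(\<Sum>z\<in>Z. m z * ln (m z)) - (\<Sum>z\<in>Z. m z) * ln (\<Sum>z\<in>Z. m z)
      = (\<Sum>z\<in>Z. m z * ln (m z) - m z * ln (\<Sum>z\<in>Z. m z))"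
    by (simp add: sum_subtractf sum_distrib_right)
  also have "\<dots> \<le> (\<Sum>z\<in>Z. \<Sum>y\<in>Y. o' z y * ln (o' z y) - o' z y * ln (\<Sum>z\<in>Z. o' z y))"
    by (intro sum_mono key)
  also have "\<dots> = (\<Sum>z\<in>Z. \<Sum>y\<in>Y. o' z y * ln (o' z y)) - (\<Sum>y\<in>Y. xlnx (\<Sum>z\<in>Z. o' z y))"
    using sum.swap[of "\<lambda>z y. o' z y * ln (\<Sum>z\<in>Z. o' z y)" Y Z]
    by (simp add: sum_subtractf sum_distrib_right)
  finally show ?thesis
    unfolding minfo_def O M H
    by (simp add: sum.distrib sum_subtractf o'_def[symmetric] m_def[symmetric])
qed

text \<open>The mutual information over the product of two possibly different channels, with the
  additivity of the row entropies built in. Two separate factors are needed for the hybrid channel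
  that uses \<open>V\<close> on the first letter and \<open>W\<close> on the remaining ones.\<close>

definition minfo2 :: "'a set \<Rightarrow> 'b set \<Rightarrow> 'c set \<Rightarrow> 'd set \<Rightarrow> ('a \<Rightarrow> 'b \<Rightarrow> real) \<Rightarrow>
    ('a \<Rightarrow> 'c \<Rightarrow> real) \<Rightarrow> ('b \<Rightarrow> 'd \<Rightarrow> real) \<Rightarrow> real" where
  "minfo2 X X' Y Y' \<mu> A B = xlnx (\<Sum>x\<in>X. \<Sum>x'\<in>X'. \<mu> x x')
     - (\<Sum>y\<in>Y. \<Sum>y'\<in>Y'. xlnx (\<Sum>x\<in>X. \<Sum>x'\<in>X'. \<mu> x x' * (A x y * B x' y')))
     + (\<Sum>x\<in>X. \<Sum>x'\<in>X'. \<mu> x x' * ((\<Sum>y\<in>Y. A x y * ln (A x y)) + (\<Sum>y'\<in>Y'. B x' y' * ln (B x' y'))))"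

lemma minfo2_swap: "minfo2 X X' Y Y' \<mu> A B = minfo2 X' X Y' Y (\<lambda>x' x. \<mu> x x') B A"
proof -
  have 1: "(\<Sum>x\<in>X. \<Sum>x'\<in>X'. \<mu> x x') = (\<Sum>x'\<in>X'. \<Sum>x\<in>X. \<mu> x x')" by (rule sum.swap)
  have 2: "(\<Sum>x\<in>X. \<Sum>x'\<in>X'. \<mu> x x' * (A x y * B x' y')) = (\<Sum>x'\<in>X'. \<Sum>x\<in>X. \<mu> x x' * (B x' y' * A x y))" for y y'
    by (subst sum.swap) (simp add: mult.commute)
  have 3: "(\<Sum>x\<in>X. \<Sum>x'\<in>X'. \<mu> x x' * ((\<Sum>y\<in>Y. A x y * ln (A x y)) + (\<Sum>y'\<in>Y'. B x' y' * ln (B x' y'))))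
    = (\<Sum>x'\<in>X'. \<Sum>x\<in>X. \<mu> x x' * ((\<Sum>y'\<in>Y'. B x' y' * ln (B x' y')) + (\<Sum>y\<in>Y. A x y * ln (A x y))))"
    by (subst sum.swap) (simp add: add.commute)
  have 4: "(\<Sum>y\<in>Y. \<Sum>y'\<in>Y'. f y y') = (\<Sum>y'\<in>Y'. \<Sum>y\<in>Y. f y y')" for f :: "'c \<Rightarrow> 'd \<Rightarrow> real"
    by (rule sum.swap)
  show ?thesis unfolding minfo2_def 1 2 3 4 ..
qed

text \<open>The chain rule \<open>I(X X'; Y Y') = I(X'; Y') + I(X; Y | Y')\<close> for a memoryless
  pair. By homogeneity the conditional term is a sum over \<open>y'\<close> of informations of the
  joint weights, with no division by the probability of \<open>y'\<close>.\<close>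

lemma minfo2_chain:
  assumes B1: "\<And>x'. x' \<in> X' \<Longrightarrow> (\<Sum>y'\<in>Y'. B x' y') = 1"
  shows "minfo2 X X' Y Y' \<mu> A B = minfo X' Y' (\<lambda>x'. \<Sum>x\<in>X. \<mu> x x') B
     + (\<Sum>y'\<in>Y'. minfo X Y (\<lambda>x. \<Sum>x'\<in>X'. \<mu> x x' * B x' y') A)"
proof -
  define hA where "hA x = (\<Sum>y\<in>Y. A x y * ln (A x y))" for x
  define hB where "hB x' = (\<Sum>y'\<in>Y'. B x' y' * ln (B x' y'))" for x'
  define m where "m y' = (\<Sum>x\<in>X. \<Sum>x'\<in>X'. \<mu> x x' * B x' y')" for y'
  define o' where "o' y y' = (\<Sum>x\<in>X. \<Sum>x'\<in>X'. \<mu> x x' * (A x y * B x' y'))" for y y'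
  have 1: "(\<Sum>x\<in>X. (\<Sum>x'\<in>X'. \<mu> x x' * B x' y') * A x y) = o' y y'" for y y'
    unfolding o'_def sum_distrib_right by (simp add: mult_ac)
  have 2: "(\<Sum>x'\<in>X'. (\<Sum>x\<in>X. \<mu> x x') * B x' y') = m y'" for y'
    unfolding m_def by (subst sum.swap) (simp add: sum_distrib_right)
  have 3: "(\<Sum>y'\<in>Y'. \<Sum>x\<in>X. (\<Sum>x'\<in>X'. \<mu> x x' * B x' y') * hA x) = (\<Sum>x\<in>X. \<Sum>x'\<in>X'. \<mu> x x' * hA x)"
  proof -
    have "(\<Sum>y'\<in>Y'. \<Sum>x\<in>X. (\<Sum>x'\<in>X'. \<mu> x x' * B x' y') * hA x)
      = (\<Sum>x\<in>X. \<Sum>y'\<in>Y'. \<Sum>x'\<in>X'. \<mu> x x' * hA x * B x' y')"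
      unfolding sum_distrib_right by (subst sum.swap) (simp add: mult_ac)
    also have "\<dots> = (\<Sum>x\<in>X. \<Sum>x'\<in>X'. \<Sum>y'\<in>Y'. \<mu> x x' * hA x * B x' y')"
      by (intro sum.cong refl sum.swap)
    also have "\<dots> = (\<Sum>x\<in>X. \<Sum>x'\<in>X'. \<mu> x x' * hA x)"
      by (simp add: B1 flip: sum_distrib_left)
    finally show ?thesis .
  qed
  have 4: "(\<Sum>x'\<in>X'. (\<Sum>x\<in>X. \<mu> x x') * hB x') = (\<Sum>x\<in>X. \<Sum>x'\<in>X'. \<mu> x x' * hB x')"
    unfolding sum_distrib_right by (rule sum.swap)
  have 5: "(\<Sum>x'\<in>X'. \<Sum>x\<in>X. \<mu> x x') = (\<Sum>x\<in>X. \<Sum>x'\<in>X'. \<mu> x x')" by (rule sum.swap)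
  have 6: "(\<Sum>y'\<in>Y'. \<Sum>y\<in>Y. f y y') = (\<Sum>y\<in>Y. \<Sum>y'\<in>Y'. f y y')" for f :: "_ \<Rightarrow> _ \<Rightarrow> real" by (rule sum.swap)
  show ?thesis
    unfolding minfo_def minfo2_def hA_def[symmetric] hB_def[symmetric] o'_def[symmetric]
    by (simp add: 1 2 3 4 5 6[of "\<lambda>y y'. o' y y' * ln (o' y y')"] sum.distrib sum_subtractf
        m_def[symmetric] distrib_left)
qed

lemma minfo_chn_Suc:
  assumes W: "stoch K W"
  shows "minfo (seqs {0..K} (Suc n)) (seqs UNIV (Suc n)) \<mu> (chn W)
    = minfo2 {0..K} (seqs {0..K} n) UNIV (seqs UNIV n) (\<lambda>x xs. \<mu> (x # xs)) W (chn W)"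
proof -
  have h: "(\<Sum>y\<in>UNIV. \<Sum>ys\<in>seqs UNIV n. xlnx (W x y * chn W xs ys))
     = (\<Sum>y\<in>UNIV. W x y * ln (W x y)) + (\<Sum>ys\<in>seqs UNIV n. chn W xs ys * ln (chn W xs ys))"
    if x: "x \<in> {0..K}" and xs: "xs \<in> seqs {0..K} n" for x xs
  proof -
    have "(\<Sum>y\<in>UNIV. \<Sum>ys\<in>seqs UNIV n. xlnx (W x y * chn W xs ys))
      = (\<Sum>y\<in>UNIV. \<Sum>ys\<in>seqs UNIV n. W x y * (chn W xs ys * ln (chn W xs ys)) + chn W xs ys *
          (W x y * ln (W x y)))"
      using x by (intro sum.cong refl xlnx_scale stoch_nonneg[OF W] chn_nonneg[OF W xs]) auto
    also have "\<dots> = (\<Sum>y\<in>UNIV. W x y) * (\<Sum>ys\<in>seqs UNIV n. chn W xs ys * ln (chn W xs ys))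
      + (\<Sum>ys\<in>seqs UNIV n. chn W xs ys) * (\<Sum>y\<in>UNIV. W x y * ln (W x y))"
      by (simp add: sum.distrib sum_distrib_left[symmetric] sum_distrib_right[symmetric])
    finally show ?thesis using x by (simp add: sum_chn[OF W xs] stoch_sum[OF W])
  qed
  show ?thesis
    unfolding minfo_def minfo2_def sum_seqs_Suc chn_Cons
    by (intro arg_cong2[where f = "(+)"] refl sum.cong) (simp add: h)
qed

lemma minfo_tensorize:
  assumes W: "stoch K W" and V: "stoch K V" and c: "0 \<le> c" "c \<le> 1"
    and cond: "\<And>\<mu>. (\<And>x. x \<in> {0..K} \<Longrightarrow> 0 \<le> \<mu> x) \<Longrightarrow> c * minfo {0..K} UNIV \<mu> W \<le> minfo {0..K} UNIV \<mu> V"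
    and "\<And>xs. xs \<in> seqs {0..K} n \<Longrightarrow> 0 \<le> \<mu> xs"
  shows "c * minfo (seqs {0..K} n) (seqs UNIV n) \<mu> (chn W) \<le> minfo (seqs {0..K} n) (seqs UNIV n) \<mu> (chn V)"
  using assms(6)
proof (induction n arbitrary: \<mu>)
  case 0
  then show ?case by (simp add: minfo_def)
next
  case (Suc n)
  let ?X = "{0..K}" and ?Xs = "seqs {0..K} n"
  let ?G = "\<lambda>\<nu>. minfo ?Xs (seqs UNIV n) \<nu> (chn W)"
  define \<nu> where "\<nu> = (\<lambda>x xs. \<mu> (x # xs))"
  have \<nu>0: "0 \<le> \<nu> x xs" if "x \<in> ?X" "xs \<in> ?Xs" for x xs
    using Suc.prems[of "x # xs"] that by (auto simp: \<nu>_def seqs_def)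
  \<comment> \<open>\<open>\<mu>1\<close> and \<open>\<mu>2\<close> are the marginals of the first
    letter and of the tail. \<open>\<rho> ys\<close> is the joint weight of the first letter with
    the output \<open>ys\<close> of the tail through \<open>W\<close>, and \<open>\<kappa> z\<close>
    that of the tail with the output \<open>z\<close> of the first letter through
    \<open>V\<close>.\<close>
  define \<mu>2 where "\<mu>2 xs = (\<Sum>x\<in>?X. \<nu> x xs)" for xs
  define \<mu>1 where "\<mu>1 x = (\<Sum>xs\<in>?Xs. \<nu> x xs)" for x
  define \<rho> where "\<rho> ys x = (\<Sum>xs\<in>?Xs. \<nu> x xs * chn W xs ys)" for ys x
  define \<kappa> where "\<kappa> z xs = (\<Sum>x\<in>?X. \<nu> x xs * V x z)" for z xs
  have \<kappa>0: "0 \<le> \<kappa> z xs" if "xs \<in> ?Xs" for z xs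
    unfolding \<kappa>_def using that by (intro sum_nonneg mult_nonneg_nonneg \<nu>0 stoch_nonneg[OF V]) auto
  have WW: "minfo2 ?X ?Xs UNIV (seqs UNIV n) \<nu> W (chn W) = ?G \<mu>2 + (\<Sum>ys\<in>seqs UNIV n. minfo ?X UNIV (\<rho> ys) W)"
    unfolding \<mu>2_def \<rho>_def by (intro minfo2_chain sum_chn[OF W])
  have VW: "minfo2 ?X ?Xs UNIV (seqs UNIV n) \<nu> V (chn W) = ?G \<mu>2 + (\<Sum>ys\<in>seqs UNIV n. minfo ?X UNIV (\<rho> ys) V)"
    unfolding \<mu>2_def \<rho>_def by (intro minfo2_chain sum_chn[OF W])
  have VW': "minfo2 ?X ?Xs UNIV (seqs UNIV n) \<nu> V (chn W) = minfo ?X UNIV \<mu>1 V + (\<Sum>z\<in>UNIV. ?G (\<kappa> z))"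
    unfolding \<mu>1_def \<kappa>_def by (subst minfo2_swap, subst minfo2_chain) (auto intro!: stoch_sum[OF V])
  have VV': "minfo2 ?X ?Xs UNIV (seqs UNIV n) \<nu> V (chn V) = minfo ?X UNIV \<mu>1 V
      + (\<Sum>z\<in>UNIV. minfo ?Xs (seqs UNIV n) (\<kappa> z) (chn V))"
    unfolding \<mu>1_def \<kappa>_def by (subst minfo2_swap, subst minfo2_chain) (auto intro!: stoch_sum[OF V])
  have \<mu>2\<kappa>: "\<mu>2 xs = (\<Sum>z\<in>UNIV. \<kappa> z xs)" for xs
    unfolding \<mu>2_def \<kappa>_def by (subst sum.swap) (simp add: stoch_sum[OF V] flip: sum_distrib_left)
  have "(\<Sum>z\<in>UNIV. ?G (\<kappa> z)) \<le> ?G (\<lambda>xs. \<Sum>z\<in>UNIV. \<kappa> z xs)"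
    by (intro minfo_superadditive \<kappa>0 sum_chn[OF W] chn_nonneg[OF W]) auto
  then have sup: "(\<Sum>z\<in>UNIV. ?G (\<kappa> z)) \<le> ?G \<mu>2" unfolding \<mu>2\<kappa>[abs_def] .
  \<comment> \<open>Replace \<open>W\<close> by \<open>V\<close> in the first coordinate, reorder the chain rule, then apply the induction
    hypothesis to the others. The deficit \<open>(1 - c) * ?G \<mu>2\<close> is paid for by superadditivity.\<close>
  have "c * (\<Sum>ys\<in>seqs UNIV n. minfo ?X UNIV (\<rho> ys) W) \<le> (\<Sum>ys\<in>seqs UNIV n. minfo ?X UNIV (\<rho> ys) V)"
    unfolding sum_distrib_left \<rho>_def
    by (intro sum_mono cond sum_nonneg mult_nonneg_nonneg \<nu>0 chn_nonneg[OF W])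
  then have "c * minfo2 ?X ?Xs UNIV (seqs UNIV n) \<nu> W (chn W)
      \<le> minfo ?X UNIV \<mu>1 V + (\<Sum>z\<in>UNIV. ?G (\<kappa> z)) - (1 - c) * ?G \<mu>2"
    using WW VW VW' by (simp add: algebra_simps)
  also have "\<dots> \<le> minfo ?X UNIV \<mu>1 V + c * (\<Sum>z\<in>UNIV. ?G (\<kappa> z))"
    using mult_left_mono[OF sup, of "1 - c"] c by (simp add: algebra_simps)
  also have "\<dots> \<le> minfo ?X UNIV \<mu>1 V + (\<Sum>z\<in>UNIV. minfo ?Xs (seqs UNIV n) (\<kappa> z) (chn V))"
    unfolding sum_distrib_left by (intro add_left_mono sum_mono Suc.IH \<kappa>0)
  finally show ?case
    unfolding minfo_chn_Suc[OF W] minfo_chn_Suc[OF V] using VV' by (simp add: \<nu>_def)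
qed

section \<open>Decoding errors and mutual information\<close>

lemma Fano:
  fixes T :: "nat \<Rightarrow> 'y \<Rightarrow> real"
  assumes M: "1 \<le> M" and Y: "finite Y" and T0: "\<And>w y. w \<in> {1..M} \<Longrightarrow> y \<in> Y \<Longrightarrow> 0 \<le> T w y"
    and T1: "\<And>w. w \<in> {1..M} \<Longrightarrow> (\<Sum>y\<in>Y. T w y) = 1"
    and d: "\<And>y. y \<in> Y \<Longrightarrow> d y \<in> {1..M}"
  defines "e \<equiv> (\<Sum>w=1..M. \<Sum>y\<in>Y. T w y * (if d y \<noteq> w then 1 else 0)) / M"
    and "Tm \<equiv> (\<lambda>y. (\<Sum>w=1..M. T w y) / M)"
  shows "(1 - e) * ln M - ln 2 \<le> (\<Sum>w=1..M. \<Sum>y\<in>Y. T w y * ln (T w y)) / M - (\<Sum>y\<in>Y. Tm y * ln (Tm y))"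
proof -
  \<comment> \<open>Keeps \<open>{1..M}\<close> from being rewritten to
    \<open>{Suc 0..M}\<close>.\<close>
  note One_nat_def [simp del]
  have M0: "real M > 0" using M by simp
  \<comment> \<open>Gibbs' inequality against the posterior guess that puts half of its mass on the decoded message.\<close>
  define r where "r w y = (if d y = w then 1/2 else 0) + 1 / (2 * real M)" for w y
  have rpos: "r w y > 0" for w y using M0 by (auto simp: r_def intro: add_pos_pos)
  have sr: "(\<Sum>w=1..M. r w y) = 1" if "y \<in> Y" for y
    using d[OF that] M0 by (simp add: r_def sum.distrib)
  have Tm0: "0 \<le> Tm y" if "y \<in> Y" for y
    unfolding Tm_def using T0 that by (intro divide_nonneg_nonneg sum_nonneg) auto
  have sTm: "(\<Sum>w=1..M. T w y) = M * Tm y" for y using M0 by (simp add: Tm_def)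
  have key: "(\<Sum>(w,y)\<in>{1..M} \<times> Y. T w y * ln (M * Tm y * r w y)) \<le> (\<Sum>(w,y)\<in>{1..M} \<times> Y. T w y * ln (T w y))"
  proof -
    have "(\<Sum>wy\<in>{1..M} \<times> Y. (case wy of (w,y) \<Rightarrow> T w y) * ln (case wy of (w,y) \<Rightarrow> M * Tm y * r w y))
      \<le> (\<Sum>wy\<in>{1..M} \<times> Y. xlnx (case wy of (w,y) \<Rightarrow> T w y))"
    proof (intro Gibbs)
      fix wy assume wy: "wy \<in> {1..M} \<times> Y"
      obtain w y where [simp]: "wy = (w,y)" and w: "w \<in> {1..M}" and y: "y \<in> Y" using wy by auto
      show "0 \<le> (case wy of (w,y) \<Rightarrow> T w y)" using T0 w y by simp
      show "0 \<le> (case wy of (w,y) \<Rightarrow> M * Tm y * r w y)" using Tm0[OF y] rpos[of w y] by simp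
      assume "(case wy of (w,y) \<Rightarrow> M * Tm y * r w y) = 0"
      then have "(\<Sum>w=1..M. T w y) = 0" unfolding sTm using rpos[of w y] M0 by simp
      then show "(case wy of (w,y) \<Rightarrow> T w y) = 0"
        using w y T0 by (subst (asm) sum_nonneg_eq_0_iff) auto
    next
      have "(\<Sum>(w,y)\<in>{1..M} \<times> Y. M * Tm y * r w y) = (\<Sum>y\<in>Y. \<Sum>w=1..M. M * Tm y * r w y)"
        by (subst sum.swap) (simp add: sum.cartesian_product)
      also have "\<dots> = (\<Sum>y\<in>Y. M * Tm y)" by (simp add: sr flip: sum_distrib_left)
      also have "\<dots> = (\<Sum>w=1..M. \<Sum>y\<in>Y. T w y)" by (subst sum.swap) (simp add: sTm)
      finally show "(\<Sum>(w,y)\<in>{1..M} \<times> Y. M * Tm y * r w y) \<le> (\<Sum>(w,y)\<in>{1..M} \<times> Y. T w y)"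
        by (simp add: sum.cartesian_product)
    qed
    then show ?thesis by (simp add: case_prod_unfold)
  qed
  have "(\<Sum>w=1..M. \<Sum>y\<in>Y. T w y * ln (Tm y) + T w y * ((if d y \<noteq> w then - ln M else 0) + (ln M - ln 2)))
      \<le> (\<Sum>w=1..M. \<Sum>y\<in>Y. T w y * ln (M * Tm y * r w y))"
  proof (intro sum_mono)
    fix w y assume w: "w \<in> {1..M}" and y: "y \<in> Y"
    show "T w y * ln (Tm y) + T w y * ((if d y \<noteq> w then - ln M else 0) + (ln M - ln 2))
      \<le> T w y * ln (M * Tm y * r w y)"
    proof (cases "T w y = 0")
      case False
      have "T w y \<le> (\<Sum>w=1..M. T w y)" using w y T0 by (intro member_le_sum) auto
      then have "Tm y \<noteq> 0" using False T0[OF w y] unfolding sTm by auto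
      then have Tp: "Tm y > 0" using Tm0[OF y] by simp
      have Mr: "M * r w y > 0" using M0 rpos by simp
      \<comment> \<open>\<open>M * r w y\<close> is at least \<open>M / 2\<close> when
        \<open>w\<close> is decoded correctly and exactly \<open>1/2\<close> otherwise. This is the
        source of the penalty \<open>ln M\<close> per error and of the constant
        \<open>ln 2\<close>.\<close>
      have "(if d y \<noteq> w then - ln M else 0) + (ln M - ln 2) \<le> ln (M * r w y)"
      proof (cases "d y = w")
        case True
        have "ln M - ln 2 = ln (real M / 2)" using M0 by (simp add: ln_div)
        also have "\<dots> \<le> ln (M * r w y)" using M0 Mr True
            by (subst ln_le_cancel_iff) (auto simp: r_def field_simps)
        finally show ?thesis using True by simp
      next
        case False
        then show ?thesis using M0 by (simp add: r_def ln_div)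
      qed
      moreover have "ln (M * Tm y * r w y) = ln (Tm y) + ln (M * r w y)"
        using ln_mult_pos[OF Tp Mr] by (simp only: mult_ac)
      ultimately show ?thesis
        using T0[OF w y] by (simp flip: distrib_left add: mult_left_mono)
    qed simp
  qed
  also have "\<dots> \<le> (\<Sum>w=1..M. \<Sum>y\<in>Y. T w y * ln (T w y))"
    using key by (simp add: sum.cartesian_product)
  also have "(\<Sum>w=1..M. \<Sum>y\<in>Y. T w y * ln (Tm y) + T w y * ((if d y \<noteq> w then - ln M else 0) + (ln M - ln 2)))
     = (\<Sum>w=1..M. \<Sum>y\<in>Y. T w y * ln (Tm y)) - ln M * (\<Sum>w=1..M. \<Sum>y\<in>Y. T w y * (if d y \<noteq> w then 1 else 0))
       + (ln M - ln 2) * (\<Sum>w=1..M. \<Sum>y\<in>Y. T w y)"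
    unfolding sum_distrib_left sum_subtractf[symmetric] sum.distrib[symmetric]
    by (intro sum.cong refl) (auto simp: algebra_simps)
  also have "(\<Sum>w=1..M. \<Sum>y\<in>Y. T w y * ln (Tm y)) = M * (\<Sum>y\<in>Y. Tm y * ln (Tm y))"
    by (subst sum.swap) (simp add: sTm sum_distrib_left mult_ac flip: sum_distrib_right)
  also have "(\<Sum>w=1..M. \<Sum>y\<in>Y. T w y) = M" by (simp add: T1)
  also have "(\<Sum>w=1..M. \<Sum>y\<in>Y. T w y * (if d y \<noteq> w then 1 else 0)) = M * e" using M0 by (simp add: e_def)
  finally have "M * ((\<Sum>y\<in>Y. Tm y * ln (Tm y)) - ln M * e + (ln M - ln 2)) \<le> (\<Sum>w=1..M. \<Sum>y\<in>Y. T w y * ln (T w y))"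
    by (simp add: algebra_simps)
  then have "(\<Sum>y\<in>Y. Tm y * ln (Tm y)) - ln M * e + (ln M - ln 2) \<le> (\<Sum>w=1..M. \<Sum>y\<in>Y. T w y * ln (T w y)) / M"
    using M0 by (simp add: pos_le_divide_eq mult.commute)
  then show ?thesis by (simp add: algebra_simps)
qed

section \<open>Finite blocklength converse\<close>

lemma stoch_chanW: "bc_channel K P \<Longrightarrow> stoch K (chanW P)"
  by (auto simp: bc_channel_def stoch_def chanW_def intro!: sum_nonneg)

lemma stoch_chanV: "bc_channel K P \<Longrightarrow> stoch K (chanV P)"
  unfolding bc_channel_def stoch_def chanV_def
  by (auto intro!: sum_nonneg) (subst sum.swap, simp)

lemma stoch_chanQ: 
  fixes P :: "nat \<Rightarrow> 'y1::finite \<Rightarrow> 'y2::finite \<Rightarrow> 'z::finite \<Rightarrow> real"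
  assumes "bc_channel K P" shows "stoch K (chanQ P)"
proof -
  have "(\<Sum>z\<in>UNIV. \<Sum>y1\<in>UNIV. \<Sum>y2\<in>UNIV. P x y1 y2 z) = (\<Sum>y1\<in>UNIV. \<Sum>y2\<in>UNIV. \<Sum>z\<in>UNIV. P x y1 y2 z)" for x
    by (subst sum.swap, intro sum.cong refl, rule sum.swap)
  then show ?thesis using assms by (auto simp: bc_channel_def stoch_def chanQ_def intro!: sum_nonneg)
qed

lemma sum_chn_joint:
  fixes P :: "nat \<Rightarrow> 'y1::finite \<Rightarrow> 'y2::finite \<Rightarrow> 'z::finite \<Rightarrow> real"
  assumes "length xs = n"
  shows "(\<Sum>y2s\<in>seqs UNIV n. \<Sum>zs\<in>seqs UNIV n. \<Prod>i<n. P (xs ! i) (y1s ! i) (y2s ! i) (zs ! i))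
      = chn (chanW P) xs y1s"
    and "(\<Sum>y1s\<in>seqs UNIV n. \<Sum>zs\<in>seqs UNIV n. \<Prod>i<n. P (xs ! i) (y1s ! i) (y2s ! i) (zs ! i))
        = chn (chanV P) xs y2s"
proof -
  have z: "(\<Sum>zs\<in>seqs UNIV n. \<Prod>i<n. P (xs ! i) (y1s ! i) (y2s ! i) (zs ! i))
     = (\<Prod>i<n. \<Sum>z\<in>UNIV. P (xs ! i) (y1s ! i) (y2s ! i) z)" for y1s y2s
    by (rule sum_seqs_prod)
  show "(\<Sum>y2s\<in>seqs UNIV n. \<Sum>zs\<in>seqs UNIV n. \<Prod>i<n. P (xs ! i) (y1s ! i) (y2s ! i) (zs ! i))
      = chn (chanW P) xs y1s"
    unfolding z chn_def chanW_def assms by (rule sum_seqs_prod)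
  show "(\<Sum>y1s\<in>seqs UNIV n. \<Sum>zs\<in>seqs UNIV n. \<Prod>i<n. P (xs ! i) (y1s ! i) (y2s ! i) (zs ! i))
      = chn (chanV P) xs y2s"
    unfolding z chn_def chanV_def assms by (rule sum_seqs_prod)
qed

section \<open>Error probabilities of single codewords, joint and marginal\<close>

definition word_error :: "(nat \<Rightarrow> 'y::finite \<Rightarrow> real) \<Rightarrow> nat \<Rightarrow> nat list \<Rightarrow> ('y list \<Rightarrow> nat) \<Rightarrow> nat \<Rightarrow> real" where
  "word_error W n xs d w = (\<Sum>ys\<in>seqs UNIV n. chn W xs ys * (if d ys \<noteq> w then 1 else 0))"

definition joint_word_error :: "(nat \<Rightarrow> 'y1::finite \<Rightarrow> 'y2::finite \<Rightarrow> 'z::finite \<Rightarrow> real) \<Rightarrow> nat \<Rightarrow> nat list \<Rightarrow>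
    ('y1 list \<Rightarrow> nat) \<Rightarrow> ('y2 list \<Rightarrow> nat) \<Rightarrow> nat \<Rightarrow> nat \<Rightarrow> real" where
  "joint_word_error P n xs d1 d2 w1 w2 =
     (\<Sum>y1s\<in>seqs UNIV n. \<Sum>y2s\<in>seqs UNIV n. \<Sum>zs\<in>seqs UNIV n.
          (\<Prod>i<n. P (xs ! i) (y1s ! i) (y2s ! i) (zs ! i)) *
          (if d1 y1s \<noteq> w1 \<or> d2 y2s \<noteq> w2 then 1 else 0))"

text \<open>Monotonicity and the union bound. From here on the correlation between the two receivers
  is irrelevant and only the marginal channels enter.\<close>

lemma joint_word_error_bounds:
  fixes P :: "nat \<Rightarrow> 'y1::finite \<Rightarrow> 'y2::finite \<Rightarrow> 'z::finite \<Rightarrow> real"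
  assumes P: "bc_channel K P" and xs: "xs \<in> seqs {0..K} n"
  shows "word_error (chanW P) n xs d1 w1 \<le> joint_word_error P n xs d1 d2 w1 w2" (is ?A)
    and "word_error (chanV P) n xs d2 w2 \<le> joint_word_error P n xs d1 d2 w1 w2" (is ?B)
    and "joint_word_error P n xs d1 d2 w1 w2
        \<le> word_error (chanW P) n xs d1 w1 + word_error (chanV P) n xs d2 w2" (is ?C)
proof -
  have len: "length xs = n" using xs by (simp add: seqs_def)
  let ?p = "\<lambda>y1s y2s zs. \<Prod>i<n. P (xs ! i) (y1s ! i) (y2s ! i) (zs ! i)"
  have p0: "0 \<le> ?p y1s y2s zs" for y1s y2s zs
    using P nth_seqs[OF xs] by (intro prod_nonneg) (auto simp: bc_channel_def)
  have 1: "word_error (chanW P) n xs d1 w1 = (\<Sum>y1s\<in>seqs UNIV n. \<Sum>y2s\<in>seqs UNIV n. \<Sum>zs\<in>seqs UNIV n.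
      ?p y1s y2s zs * (if d1 y1s \<noteq> w1 then 1 else 0))"
    unfolding word_error_def sum_chn_joint(1)[OF len, symmetric] by (simp only: sum_distrib_right)
  have 2: "word_error (chanV P) n xs d2 w2 = (\<Sum>y1s\<in>seqs UNIV n. \<Sum>y2s\<in>seqs UNIV n. \<Sum>zs\<in>seqs UNIV n.
      ?p y1s y2s zs * (if d2 y2s \<noteq> w2 then 1 else 0))"
    unfolding word_error_def sum_chn_joint(2)[OF len, symmetric] sum_distrib_right by (rule sum.swap)
  show ?A unfolding 1 joint_word_error_def by (intro sum_mono mult_left_mono p0) auto
  show ?B unfolding 2 joint_word_error_def by (intro sum_mono mult_left_mono p0) auto
  show ?C unfolding 1 2 joint_word_error_def sum.distrib[symmetric] distrib_left[symmetric]
    by (intro sum_mono mult_left_mono p0) auto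
qed

lemma code_error_eq:
  "code_error P n M1 M2 Kn enc dec1 dec2 =
     (\<Sum>w1=1..M1. \<Sum>w2=1..M2. \<Sum>s=1..Kn.
        joint_word_error P n (enc w1 w2 s) (\<lambda>y. dec1 y s) (\<lambda>y. dec2 y s) w1 w2) / (real M1 * real M2 * real Kn)"
  by (simp add: code_error_def joint_word_error_def seqs_UNIV)

lemma chn_pos_nth:
  assumes "chn W xs ys \<noteq> 0" "stoch K W" "xs \<in> seqs {0..K} n" "i < n"
  shows "0 < W (xs ! i) (ys ! i)"
proof -
  have "W (xs ! i) (ys ! i) \<noteq> 0"
    using assms(1,3,4) by (auto simp: chn_def length_seqs)
  moreover have "0 \<le> W (xs ! i) (ys ! i)" using nth_seqs[OF assms(3,4)]
      by (intro stoch_nonneg[OF assms(2)]) auto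
  ultimately show ?thesis by simp
qed

text \<open>The logarithm of the product may be split only where all factors are positive; elsewhere
  the word has probability 0 and the summand vanishes.\<close>

lemma sum_chn_ln_prod:
  fixes F :: "nat \<Rightarrow> 'y::finite \<Rightarrow> real"
  assumes W: "stoch K W" and xs: "xs \<in> seqs {0..K} n"
    and F: "\<And>i y. i < n \<Longrightarrow> 0 < W (xs ! i) y \<Longrightarrow> 0 < F (xs ! i) y"
  shows "(\<Sum>ys\<in>seqs UNIV n. chn W xs ys * ln (\<Prod>i<n. F (xs ! i) (ys ! i)))
     = (\<Sum>i<n. \<Sum>y\<in>UNIV. W (xs ! i) y * ln (F (xs ! i) y))"
proof -
  have "chn W xs ys * ln (\<Prod>i<n. F (xs ! i) (ys ! i)) = chn W xs ys * (\<Sum>i<n. ln (F (xs ! i) (ys ! i)))" for ys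
  proof (cases "chn W xs ys = 0")
    case False
    then have "0 < F (xs ! i) (ys ! i)" if "i < n" for i
      using F that chn_pos_nth[OF False W xs] by blast
    then have "ln (\<Prod>i<n. F (xs ! i) (ys ! i)) = (\<Sum>i<n. ln (F (xs ! i) (ys ! i)))"
      by (intro ln_prod) (auto simp: less_le)
    then show ?thesis by simp
  qed simp
  then show ?thesis by (simp only: sum_chn_additive[OF W xs, of "\<lambda>x y. ln (F x y)"])
qed

section \<open>Relative entropy with respect to the no-input law\<close>

lemma relent_eq:
  assumes "\<And>a. a \<in> A \<Longrightarrow> 0 \<le> f a" "\<And>a. a \<in> A \<Longrightarrow> 0 \<le> g a" "\<And>a. a \<in> A \<Longrightarrow> g a = 0 \<Longrightarrow> f a = 0"
  shows "relent f g A = (\<Sum>a\<in>A. f a * ln (f a)) - (\<Sum>a\<in>A. f a * ln (g a))"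
  unfolding relent_def sum_subtractf[symmetric]
proof (intro sum.cong refl)
  fix a assume a: "a \<in> A"
  show "(if f a = 0 then 0 else f a * ln (f a / g a)) = f a * ln (f a) - f a * ln (g a)"
  proof (cases "f a = 0")
    case False
    then have "f a > 0" "g a > 0" using assms[OF a] by (auto intro!: order.not_eq_order_implies_strict)
    then show ?thesis by (simp add: ln_div algebra_simps)
  qed simp
qed

lemma relent_nonneg:
  assumes "\<And>a. a \<in> A \<Longrightarrow> 0 \<le> f a" "\<And>a. a \<in> A \<Longrightarrow> 0 \<le> g a" "\<And>a. a \<in> A \<Longrightarrow> g a = 0 \<Longrightarrow> f a = 0"
    and "sum g A \<le> sum f A"
  shows "0 \<le> relent f g A"
  using Gibbs[of A f g] relent_eq[of A f g] assms by simp

definition ac_channel :: "nat \<Rightarrow> (nat \<Rightarrow> 'y::finite \<Rightarrow> real) \<Rightarrow> bool" where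
  "ac_channel K W \<longleftrightarrow> stoch K W \<and> (\<forall>k\<le>K. \<forall>y. W 0 y = 0 \<longrightarrow> W k y = 0)"

lemma ac_channelI: "stoch K W \<Longrightarrow> \<forall>k\<in>{1..K}. abs_cont (W k) (W 0) \<Longrightarrow> ac_channel K W"
  unfolding ac_channel_def abs_cont_def
  by (metis atLeastAtMost_iff less_one linorder_not_less)

lemma ac_channel_relent:
  assumes "ac_channel K W" "k \<le> K"
  shows "relent (W k) (W 0) UNIV = (\<Sum>y\<in>UNIV. W k y * ln (W k y)) - (\<Sum>y\<in>UNIV. W k y * ln (W 0 y))"
    and "0 \<le> relent (W k) (W 0) UNIV"
proof -
  have "stoch K W" "\<And>y. W 0 y = 0 \<Longrightarrow> W k y = 0" using assms by (auto simp: ac_channel_def)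
  then show "relent (W k) (W 0) UNIV = (\<Sum>y\<in>UNIV. W k y * ln (W k y)) - (\<Sum>y\<in>UNIV. W k y * ln (W 0 y))"
    and "0 \<le> relent (W k) (W 0) UNIV"
    using assms(2) stoch_nonneg[of K W] by (auto intro!: relent_eq relent_nonneg simp: stoch_sum)
qed

lemma ac_channel_relent_0: "relent (W 0) (W 0) UNIV = 0"
  by (auto simp: relent_def intro!: sum.neutral)

lemma relent_chn:
  assumes V: "ac_channel K V" and xs: "xs \<in> seqs {0..K} n"
  shows "(\<Sum>ys\<in>seqs UNIV n. chn V xs ys * ln (chn V xs ys))
      - (\<Sum>ys\<in>seqs UNIV n. chn V xs ys * ln (\<Prod>i<n. V 0 (ys ! i)))
     = (\<Sum>i<n. relent (V (xs ! i)) (V 0) UNIV)"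
proof -
  have st: "stoch K V" using V by (simp add: ac_channel_def)
  have le: "xs ! i \<le> K" if "i < n" for i using nth_seqs[OF xs that] by simp
  have "(\<Sum>ys\<in>seqs UNIV n. chn V xs ys * ln (chn V xs ys)) = (\<Sum>i<n. \<Sum>y\<in>UNIV. V (xs ! i) y * ln (V (xs ! i) y))"
    using sum_chn_ln_prod[OF st xs, of V] by (simp add: chn_def length_seqs[OF xs])
  moreover have "(\<Sum>ys\<in>seqs UNIV n. chn V xs ys * ln (\<Prod>i<n. V 0 (ys ! i)))
      = (\<Sum>i<n. \<Sum>y\<in>UNIV. V (xs ! i) y * ln (V 0 y))"
  proof (rule sum_chn_ln_prod[OF st xs])
    fix i y assume i: "i < n" and "0 < V (xs ! i) y"
    then have "V 0 y \<noteq> 0" using V le[OF i] by (force simp: ac_channel_def)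
    then show "0 < V 0 y" using stoch_nonneg[OF st, of 0 y] by simp
  qed
  ultimately show ?thesis
    by (simp add: ac_channel_relent(1)[OF V le] flip: sum_subtractf)
qed

text \<open>\<open>enc\<close> need not be injective, so the input law is the push-forward of the
  uniform message, written as a sum over messages, and not a uniform weight on the set of
  codewords.\<close>

lemma minfo_uniform:
  assumes M: "1 \<le> M" and X: "finite X" and enc: "\<And>w. w \<in> {1..M} \<Longrightarrow> enc w \<in> X"
  shows "minfo X Y (\<lambda>x. \<Sum>w=1..M. if enc w = x then 1 / real M else 0) W
     = (\<Sum>w=1..M. \<Sum>y\<in>Y. W (enc w) y * ln (W (enc w) y)) / M
       - (\<Sum>y\<in>Y. xlnx ((\<Sum>w=1..M. W (enc w) y) / M))"
proof -
  have avg: "(\<Sum>x\<in>X. (\<Sum>w=1..M. if enc w = x then 1 / real M else 0) * f x) = (\<Sum>w=1..M. f (enc w)) / M"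
    for f :: "'a \<Rightarrow> real"
  proof -
    have "(\<Sum>x\<in>X. (\<Sum>w=1..M. if enc w = x then 1 / real M else 0) * f x)
      = (\<Sum>w=1..M. \<Sum>x\<in>X. if enc w = x then f x / M else 0)"
      unfolding sum_distrib_right by (subst sum.swap) (auto intro!: sum.cong)
    also have "\<dots> = (\<Sum>w=1..M. f (enc w) / M)"
      using X enc by (intro sum.cong refl) simp
    finally show ?thesis by (simp add: sum_divide_distrib)
  qed
  have "(\<Sum>x\<in>X. (\<Sum>w=1..M. if enc w = x then 1 / real M else 0)) = 1"
    using avg[of "\<lambda>_. 1"] M by simp
  then show ?thesis unfolding minfo_def avg by simp
qed

text \<open>User 1 is treated conditionally on message 2:
  \<open>c * I(X;Y1|W2) \<le> I(X;Y2|W2)\<close> by tensorization. Together with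
  \<open>I(W2;Y2)\<close> from user 2, the chain rule gives \<open>I(X;Y2)\<close>, which is at most
  the mean divergence from the no-input output law.\<close>

lemma converse_fixed_key:
  assumes W: "stoch K W" and V: "ac_channel K V" and c: "0 \<le> c" "c \<le> 1"
    and cond: "\<And>p. p \<in> input_dists K \<Longrightarrow> c * mutual_info K p W \<le> mutual_info K p V"
    and M1: "1 \<le> M1" and M2: "1 \<le> M2"
    and enc: "\<And>w1 w2. w1 \<in> {1..M1} \<Longrightarrow> w2 \<in> {1..M2} \<Longrightarrow> enc w1 w2 \<in> seqs {0..K} n"
    and d1: "\<And>y. y \<in> seqs UNIV n \<Longrightarrow> d1 y \<in> {1..M1}"
    and d2: "\<And>y. y \<in> seqs UNIV n \<Longrightarrow> d2 y \<in> {1..M2}"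
  defines "e1 \<equiv> (\<Sum>w2=1..M2. \<Sum>w1=1..M1. word_error W n (enc w1 w2) d1 w1) / (real M1 * real M2)"
    and "e2 \<equiv> (\<Sum>w2=1..M2. \<Sum>w1=1..M1. word_error V n (enc w1 w2) d2 w2) / (real M1 * real M2)"
  shows "c * ((1 - e1) * ln M1 - ln 2) + ((1 - e2) * ln M2 - ln 2)
     \<le> (\<Sum>w2=1..M2. \<Sum>w1=1..M1. \<Sum>i<n. relent (V (enc w1 w2 ! i)) (V 0) UNIV) / (real M1 * real M2)"
proof -
  have stV: "stoch K V" using V by (simp add: ac_channel_def)
  have m1: "real M1 > 0" and m2: "real M2 > 0" using M1 M2 by auto
  let ?X = "seqs {0..K} n" and ?Y = "seqs UNIV n"
  define h where "h f = (\<Sum>y\<in>?Y. f y * ln (f y))" for f :: "'b list \<Rightarrow> real"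
  define T2 where "T2 w2 y = (\<Sum>w1=1..M1. chn V (enc w1 w2) y) / M1" for w2 y
  define Tm where "Tm y = (\<Sum>w2=1..M2. T2 w2 y) / M2" for y
  define E1 where "E1 w2 = (\<Sum>w1=1..M1. word_error W n (enc w1 w2) d1 w1) / M1" for w2
  have T20: "0 \<le> T2 w2 y" if "w2 \<in> {1..M2}" for w2 y
    unfolding T2_def by (intro divide_nonneg_nonneg sum_nonneg chn_nonneg[OF stV enc] that) auto
  have T21: "(\<Sum>y\<in>?Y. T2 w2 y) = 1" if "w2 \<in> {1..M2}" for w2
  proof -
    have "(\<Sum>y\<in>?Y. T2 w2 y) = (\<Sum>w1=1..M1. \<Sum>y\<in>?Y. chn V (enc w1 w2) y) / M1"
      unfolding T2_def sum_divide_distrib by (rule sum.swap)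
    also have "\<dots> = (\<Sum>w1=1..M1. 1) / M1"
      by (intro arg_cong2[where f="(/)"] sum.cong refl sum_chn[OF stV] enc that)
    finally show ?thesis using m1 by simp
  qed
  \<comment> \<open>\<open>h\<close> is the negative entropy, so the right-hand side is the
    information that the codewords of a fixed \<open>w2\<close> convey through
    \<open>V\<close>.\<close>
  have user1: "c * ((1 - E1 w2) * ln M1 - ln 2) \<le> (\<Sum>w1=1..M1. h (chn V (enc w1 w2))) / M1 - h (T2 w2)"
    if w2: "w2 \<in> {1..M2}" for w2
  proof -
    let ?\<mu> = "\<lambda>x. \<Sum>w=1..M1. if enc w w2 = x then 1 / real M1 else 0"
    have "(1 - E1 w2) * ln M1 - ln 2 \<le> (\<Sum>w=1..M1. \<Sum>y\<in>?Y. chn W (enc w w2) y * ln (chn W (enc w w2) y)) / M1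
       - (\<Sum>y\<in>?Y. xlnx ((\<Sum>w=1..M1. chn W (enc w w2) y) / M1))"
      unfolding E1_def word_error_def
      by (intro Fano[OF M1] d1 chn_nonneg[OF W enc] sum_chn[OF W] enc w2) auto
    also have "\<dots> = minfo ?X ?Y ?\<mu> (chn W)"
      using w2 by (intro minfo_uniform[OF M1, symmetric] enc) auto
    finally have "(1 - E1 w2) * ln M1 - ln 2 \<le> minfo ?X ?Y ?\<mu> (chn W)" .
    then have "c * ((1 - E1 w2) * ln M1 - ln 2) \<le> c * minfo ?X ?Y ?\<mu> (chn W)"
      using c by (intro mult_left_mono)
    also have "\<dots> \<le> minfo ?X ?Y ?\<mu> (chn V)"
      by (intro minfo_tensorize[OF W stV c] minfo_condition_homogeneous[OF W stV cond] sum_nonneg) auto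
    also have "\<dots> = (\<Sum>w1=1..M1. h (chn V (enc w1 w2))) / M1 - h (T2 w2)"
      unfolding h_def T2_def using w2 by (intro minfo_uniform[OF M1] enc) auto
    finally show ?thesis .
  qed
  have e2: "e2 = (\<Sum>w2=1..M2. \<Sum>y\<in>?Y. T2 w2 y * (if d2 y \<noteq> w2 then 1 else 0)) / M2"
  proof -
    have "(\<Sum>w1=1..M1. word_error V n (enc w1 w2) d2 w2) = M1 * (\<Sum>y\<in>?Y. T2 w2 y * (if d2 y \<noteq> w2 then 1 else 0))"
        for w2
    proof -
      have "(\<Sum>w1=1..M1. word_error V n (enc w1 w2) d2 w2)
        = (\<Sum>y\<in>?Y. (\<Sum>w1=1..M1. chn V (enc w1 w2) y) * (if d2 y \<noteq> w2 then 1 else 0))"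
        unfolding word_error_def sum_distrib_right by (rule sum.swap)
      also have "\<dots> = (\<Sum>y\<in>?Y. M1 * (T2 w2 y * (if d2 y \<noteq> w2 then 1 else 0)))"
        using m1 by (intro sum.cong refl) (simp add: T2_def)
      finally show ?thesis by (simp add: sum_distrib_left)
    qed
    then show ?thesis unfolding e2_def using m1 by (simp flip: sum_distrib_left)
  qed
  have user2: "(1 - e2) * ln M2 - ln 2 \<le> (\<Sum>w2=1..M2. h (T2 w2)) / M2 - h Tm"
    using Fano[OF M2, where Y = ?Y and T = T2 and d = d2] d2 T20 T21
    by (simp add: e2 h_def Tm_def[abs_def])
  have e1: "e1 = (\<Sum>w2=1..M2. E1 w2) / M2"
    unfolding e1_def E1_def using m1 m2 by (simp flip: sum_divide_distrib)
  have "c * ((1 - e1) * ln M1 - ln 2) = (\<Sum>w2=1..M2. c * ((1 - E1 w2) * ln M1 - ln 2)) / M2"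
    unfolding e1 using m2
    by (simp add: sum_distrib_left[symmetric] sum_subtractf left_diff_distrib sum_distrib_right[symmetric])
       (simp add: field_simps)
  also have "\<dots> \<le> (\<Sum>w2=1..M2. (\<Sum>w1=1..M1. h (chn V (enc w1 w2))) / M1 - h (T2 w2)) / M2"
    using m2 by (intro divide_right_mono sum_mono user1) auto
  also have "\<dots> = (\<Sum>w2=1..M2. \<Sum>w1=1..M1. h (chn V (enc w1 w2))) / (real M1 * real M2) - (\<Sum>w2=1..M2. h (T2 w2))
      / M2"
    by (simp add: sum_subtractf diff_divide_distrib flip: sum_divide_distrib)
  \<comment> \<open>The averaged \<open>h (T2 w2)\<close> occurs with opposite signs in the two
    bounds and cancels: this is the chain rule
    \<open>I(X;Y2|W2) + I(W2;Y2) = I(X;Y2)\<close>.\<close>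
  finally have sum1: "c * ((1 - e1) * ln M1 - ln 2) + ((1 - e2) * ln M2 - ln 2)
    \<le> (\<Sum>w2=1..M2. \<Sum>w1=1..M1. h (chn V (enc w1 w2))) / (real M1 * real M2) - h Tm"
    using user2 by linarith
  \<comment> \<open>Replacing \<open>Tm\<close> by the no-input law inside the logarithm can only
    increase the bound, by \<open>D(Tm \<parallel> v0)\<close>, and it makes the expression additive
    over letters.\<close>
  define v0 where "v0 y = (\<Prod>i<n. V 0 (y ! i))" for y
  have Tm': "Tm y = (\<Sum>w2=1..M2. \<Sum>w1=1..M1. chn V (enc w1 w2) y) / (real M1 * real M2)" for y
    by (simp add: Tm_def T2_def flip: sum_divide_distrib)
  have g1: "(\<Sum>y\<in>?Y. Tm y * ln (v0 y)) \<le> h Tm"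
    unfolding h_def
  proof (rule Gibbs)
    fix y :: "'b list" assume "y \<in> ?Y"
    show "0 \<le> Tm y" unfolding Tm_def by (intro divide_nonneg_nonneg sum_nonneg T20) auto
    show "0 \<le> v0 y" unfolding v0_def by (intro prod_nonneg) (auto intro: stoch_nonneg[OF stV])
    assume "v0 y = 0"
    then obtain i where i: "i < n" "V 0 (y ! i) = 0" by (auto simp: v0_def)
    have "chn V xs y = 0" if "xs \<in> ?X" for xs
    proof (rule ccontr)
      assume "chn V xs y \<noteq> 0"
      from chn_pos_nth[OF this stV that i(1)] show False
        using V i nth_seqs[OF that i(1)] by (auto simp: ac_channel_def)
    qed
    then show "Tm y = 0" unfolding Tm' using enc by simp
  next
    have "(\<Sum>y\<in>?Y. Tm y) = (\<Sum>w2=1..M2. \<Sum>y\<in>?Y. T2 w2 y) / M2"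
      unfolding Tm_def sum_divide_distrib by (rule sum.swap)
    then have "(\<Sum>y\<in>?Y. Tm y) = 1" using m2 T21 by simp
    moreover have "(\<Sum>y\<in>?Y. v0 y) = 1"
      unfolding v0_def by (subst sum_seqs_prod) (simp add: stoch_sum[OF stV])
    ultimately show "sum v0 ?Y \<le> sum Tm ?Y" by simp
  qed
  have g2: "(\<Sum>y\<in>?Y. Tm y * ln (v0 y))
      = (\<Sum>w2=1..M2. \<Sum>w1=1..M1. \<Sum>y\<in>?Y. chn V (enc w1 w2) y * ln (v0 y)) / (real M1 * real M2)"
    unfolding Tm' times_divide_eq_left sum_distrib_right sum_divide_distrib[symmetric]
    by (subst sum.swap, intro arg_cong2[where f="(/)"] sum.cong refl, rule sum.swap)
  have g3: "(\<Sum>w2=1..M2. \<Sum>w1=1..M1. h (chn V (enc w1 w2)))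
      - (\<Sum>w2=1..M2. \<Sum>w1=1..M1. \<Sum>y\<in>?Y. chn V (enc w1 w2) y * ln (v0 y))
     = (\<Sum>w2=1..M2. \<Sum>w1=1..M1. \<Sum>i<n. relent (V (enc w1 w2 ! i)) (V 0) UNIV)"
  proof -
    have "(\<Sum>w2=1..M2. \<Sum>w1=1..M1. h (chn V (enc w1 w2)) - (\<Sum>y\<in>?Y. chn V (enc w1 w2) y * ln (v0 y)))
      = (\<Sum>w2=1..M2. \<Sum>w1=1..M1. \<Sum>i<n. relent (V (enc w1 w2 ! i)) (V 0) UNIV)"
      unfolding h_def v0_def by (intro sum.cong refl relent_chn[OF V] enc)
    then show ?thesis by (simp add: sum_subtractf)
  qed
  show ?thesis using sum1 g1 unfolding g2 g3[symmetric] diff_divide_distrib by linarith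
qed

lemma sum3_swap:
  fixes f :: "'a \<Rightarrow> 'b \<Rightarrow> 'c \<Rightarrow> real"
  shows "(\<Sum>a\<in>A. \<Sum>b\<in>B. \<Sum>c\<in>C. f a b c) = (\<Sum>c\<in>C. \<Sum>b\<in>B. \<Sum>a\<in>A. f a b c)"
proof -
  have "(\<Sum>a\<in>A. \<Sum>b\<in>B. \<Sum>c\<in>C. f a b c) = (\<Sum>b\<in>B. \<Sum>a\<in>A. \<Sum>c\<in>C. f a b c)" by (rule sum.swap)
  also have "\<dots> = (\<Sum>b\<in>B. \<Sum>c\<in>C. \<Sum>a\<in>A. f a b c)" by (intro sum.cong refl sum.swap)
  also have "\<dots> = (\<Sum>c\<in>C. \<Sum>b\<in>B. \<Sum>a\<in>A. f a b c)" by (rule sum.swap)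
  finally show ?thesis .
qed

abbreviation code_avg :: "nat \<Rightarrow> nat \<Rightarrow> nat \<Rightarrow> (nat \<Rightarrow> nat \<Rightarrow> nat \<Rightarrow> real) \<Rightarrow> real" where
  "code_avg M1 M2 Kn f \<equiv> (\<Sum>w1=1..M1. \<Sum>w2=1..M2. \<Sum>s=1..Kn. f w1 w2 s) / (real M1 * real M2 * real Kn)"

text \<open>The fixed-key bound is linear in its error probabilities, so averaging it over the key
  loses nothing. The two Fano constants sum to \<open>(c + 1) * ln 2\<close>, at most
  \<open>2 * ln 2\<close>.\<close>

lemma converse_code:
  assumes W: "stoch K W" and V: "ac_channel K V" and c: "0 \<le> c" "c \<le> 1"
    and cond: "\<And>p. p \<in> input_dists K \<Longrightarrow> c * mutual_info K p W \<le> mutual_info K p V"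
    and M1: "1 \<le> M1" and M2: "1 \<le> M2" and Kn: "1 \<le> Kn"
    and enc: "\<And>w1 w2 s. w1 \<in> {1..M1} \<Longrightarrow> w2 \<in> {1..M2} \<Longrightarrow> s \<in> {1..Kn} \<Longrightarrow> enc w1 w2 s \<in> seqs {0..K} n"
    and d1: "\<And>y s. y \<in> seqs UNIV n \<Longrightarrow> s \<in> {1..Kn} \<Longrightarrow> d1 y s \<in> {1..M1}"
    and d2: "\<And>y s. y \<in> seqs UNIV n \<Longrightarrow> s \<in> {1..Kn} \<Longrightarrow> d2 y s \<in> {1..M2}"
    and e1: "code_avg M1 M2 Kn (\<lambda>w1 w2 s. word_error W n (enc w1 w2 s) (\<lambda>y. d1 y s) w1) \<le> e"
    and e2: "code_avg M1 M2 Kn (\<lambda>w1 w2 s. word_error V n (enc w1 w2 s) (\<lambda>y. d2 y s) w2) \<le> e"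
  shows "(1 - e) * (c * ln M1 + ln M2) - 2 * ln 2
     \<le> code_avg M1 M2 Kn (\<lambda>w1 w2 s. \<Sum>i<n. relent (V (enc w1 w2 s ! i)) (V 0) UNIV)"
proof -
  have k: "real Kn > 0" and l1: "ln (real M1) \<ge> 0" and l2: "ln (real M2) \<ge> 0" using Kn M1 M2 by auto
  define E1 where "E1 s = (\<Sum>w2=1..M2. \<Sum>w1=1..M1. word_error W n (enc w1 w2 s) (\<lambda>y. d1 y s) w1)
      / (real M1 * real M2)" for s
  define E2 where "E2 s = (\<Sum>w2=1..M2. \<Sum>w1=1..M1. word_error V n (enc w1 w2 s) (\<lambda>y. d2 y s) w2)
      / (real M1 * real M2)" for s
  define R where "R s = (\<Sum>w2=1..M2. \<Sum>w1=1..M1. \<Sum>i<n. relent (V (enc w1 w2 s ! i)) (V 0) UNIV)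
      / (real M1 * real M2)" for s
  have E1e: "(\<Sum>s=1..Kn. E1 s) / Kn \<le> e"
    using e1 unfolding E1_def by (subst (asm) sum3_swap) (simp flip: sum_divide_distrib)
  have E2e: "(\<Sum>s=1..Kn. E2 s) / Kn \<le> e"
    using e2 unfolding E2_def by (subst (asm) sum3_swap) (simp flip: sum_divide_distrib)
  have Rs: "code_avg M1 M2 Kn (\<lambda>w1 w2 s. \<Sum>i<n. relent (V (enc w1 w2 s ! i)) (V 0) UNIV) = (\<Sum>s=1..Kn. R s) / Kn"
    unfolding R_def by (subst sum3_swap) (simp flip: sum_divide_distrib)
  have fk: "c * ((1 - E1 s) * ln M1 - ln 2) + ((1 - E2 s) * ln M2 - ln 2) \<le> R s" if "s \<in> {1..Kn}" for s
    unfolding E1_def E2_def R_def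
    by (intro converse_fixed_key[OF W V c cond M1 M2] enc d1 d2 that)
  have "(1 - e) * (c * ln M1 + ln M2) - 2 * ln 2 \<le>
     c * ((1 - (\<Sum>s=1..Kn. E1 s) / Kn) * ln M1 - ln 2) + ((1 - (\<Sum>s=1..Kn. E2 s) / Kn) * ln M2 - ln 2)"
  proof -
    have "c * ((1 - e) * ln M1) \<le> c * ((1 - (\<Sum>s=1..Kn. E1 s) / Kn) * ln M1)"
      using E1e l1 c by (intro mult_left_mono mult_right_mono) auto
    moreover have "(1 - e) * ln M2 \<le> (1 - (\<Sum>s=1..Kn. E2 s) / Kn) * ln M2"
      using E2e l2 by (intro mult_right_mono) auto
    moreover have "c * ln 2 \<le> ln 2" using c by (intro mult_left_le_one_le) auto
    moreover have "(1 - e) * (c * ln M1 + ln M2) = c * ((1 - e) * ln M1) + (1 - e) * ln M2"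
      by (simp add: algebra_simps)
    moreover have "c * (a - ln 2) = c * a - c * ln 2" for a by (rule right_diff_distrib)
    ultimately show ?thesis by (simp only:)
  qed
  also have "\<dots> = (\<Sum>s=1..Kn. c * ((1 - E1 s) * ln M1 - ln 2) + ((1 - E2 s) * ln M2 - ln 2)) / Kn"
    using k by (simp add: sum.distrib sum_subtractf left_diff_distrib sum_distrib_left[symmetric]
        sum_distrib_right[symmetric])
       (simp add: field_simps)
  also have "\<dots> \<le> (\<Sum>s=1..Kn. R s) / Kn"
    using k by (intro divide_right_mono sum_mono fk) auto
  finally show ?thesis using Rs by simp
qed

section \<open>The average input distribution of a code\<close>

abbreviation input_relent :: "nat \<Rightarrow> (nat \<Rightarrow> real) \<Rightarrow> (nat \<Rightarrow> 'z::finite \<Rightarrow> real) \<Rightarrow> real" where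
  "input_relent K p Q \<equiv> relent (\<lambda>z. \<Sum>k=0..K. p k * Q k z) (Q 0) UNIV"

text \<open>\<open>p\<close> is the relative frequency of each symbol over all codewords and
  positions. The log-likelihood ratio of two product laws is additive, so its mean under the induced
  law depends on \<open>p\<close> alone; hence the two divergences differ by the divergence of the
  induced law from the product law with marginal \<open>R\<close>, which is nonnegative.\<close>

lemma empirical_dist:
  fixes enc :: "'w \<Rightarrow> nat list" and Q :: "nat \<Rightarrow> 'z::finite \<Rightarrow> real"
  assumes fin: "finite \<Omega>" "\<Omega> \<noteq> {}" and enc: "\<And>w. w \<in> \<Omega> \<Longrightarrow> enc w \<in> seqs {0..K} n" and n: "1 \<le> n"
    and Q: "stoch K Q" and Q0: "\<And>z. 0 < Q 0 z"
  obtains p where "p \<in> input_dists K"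
    and "\<And>f :: nat \<Rightarrow> real. (\<Sum>w\<in>\<Omega>. \<Sum>i<n. f (enc w ! i)) / card \<Omega> = n * (\<Sum>k=0..K. p k * f k)"
    and "n * input_relent K p Q
       \<le> relent (\<lambda>zs. (\<Sum>w\<in>\<Omega>. chn Q (enc w) zs) / card \<Omega>) (\<lambda>zs. \<Prod>i<n. Q 0 (zs ! i)) (seqs UNIV n)"
proof -
  have C: "real (card \<Omega>) > 0" using fin by (simp add: card_gt_0_iff)
  have N: "real n > 0" using n by simp
  define p where "p k = (\<Sum>w\<in>\<Omega>. \<Sum>i<n. if enc w ! i = k then 1 else 0) / (card \<Omega> * real n)" for k
  have le: "enc w ! i \<in> {0..K}" if "w \<in> \<Omega>" "i < n" for w i using nth_seqs[OF enc] that by blast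
  have avg: "(\<Sum>w\<in>\<Omega>. \<Sum>i<n. f (enc w ! i)) / card \<Omega> = n * (\<Sum>k=0..K. p k * f k)" for f :: "nat \<Rightarrow> real"
  proof -
    have "(\<Sum>w\<in>\<Omega>. \<Sum>i<n. f (enc w ! i)) = (\<Sum>w\<in>\<Omega>. \<Sum>i<n. \<Sum>k=0..K. if enc w ! i = k then f k else 0)"
      using le by (intro sum.cong refl) simp
    also have "\<dots> = (\<Sum>k=0..K. \<Sum>i<n. \<Sum>w\<in>\<Omega>. if enc w ! i = k then f k else 0)"
      by (rule sum3_swap)
    also have "\<dots> = (\<Sum>k=0..K. \<Sum>w\<in>\<Omega>. \<Sum>i<n. if enc w ! i = k then f k else 0)"
      by (intro sum.cong refl sum.swap)
    also have "\<dots> = (\<Sum>k=0..K. (card \<Omega> * real n) * (p k * f k))"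
    proof (intro sum.cong refl)
      fix k
      have "(\<Sum>w\<in>\<Omega>. \<Sum>i<n. if enc w ! i = k then f k else 0) = (\<Sum>w\<in>\<Omega>. \<Sum>i<n. if enc w ! i = k then 1 else 0) * f k"
        unfolding sum_distrib_right by (intro sum.cong refl) auto
      then show "(\<Sum>w\<in>\<Omega>. \<Sum>i<n. if enc w ! i = k then f k else 0) = (card \<Omega> * real n) * (p k * f k)"
        using C N by (simp add: p_def)
    qed
    finally show ?thesis using C by (simp flip: sum_distrib_left)
  qed
  have p: "p \<in> input_dists K"
    using avg[of "\<lambda>_. 1"] C N by (auto simp: input_dists_def p_def intro!: divide_nonneg_nonneg sum_nonneg)
  define R where "R z = (\<Sum>k=0..K. p k * Q k z)" for z
  define Qh where "Qh zs = (\<Sum>w\<in>\<Omega>. chn Q (enc w) zs) / card \<Omega>" for zs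
  have R0: "0 \<le> R z" for z
    unfolding R_def using p stoch_nonneg[OF Q]
        by (intro sum_nonneg mult_nonneg_nonneg) (auto simp: input_dists_def)
  \<comment> \<open>A symbol that occurs in some codeword has positive frequency, so
    \<open>R\<close> is positive on its whole output support. Without this the logarithm of the
    product of \<open>R\<close> could not be split.\<close>
  have Rpos: "0 < R z" if "w \<in> \<Omega>" "i < n" "0 < Q (enc w ! i) z" for w i z
  proof -
    let ?k = "enc w ! i"
    have "1 \<le> (\<Sum>j<n. if enc w ! j = ?k then 1 else 0::real)"
      using member_le_sum[of i "{..<n}" "\<lambda>j. if enc w ! j = ?k then 1 else 0::real"] that by simp
    also have "\<dots> \<le> (\<Sum>w\<in>\<Omega>. \<Sum>i<n. if enc w ! i = ?k then 1 else 0)"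
      using that fin by (intro member_le_sum sum_nonneg) auto
    finally have "0 < p ?k" using C N unfolding p_def by simp
    then have "0 < p ?k * Q ?k z" using that by simp
    also have "\<dots> \<le> R z" unfolding R_def
      using p stoch_nonneg[OF Q] le that
          by (intro member_le_sum mult_nonneg_nonneg) (auto simp: input_dists_def)
    finally show ?thesis .
  qed
  have Qh0: "0 \<le> Qh zs" for zs
    unfolding Qh_def by (intro divide_nonneg_nonneg sum_nonneg chn_nonneg[OF Q enc]) auto
  have Qh_lin: "(\<Sum>zs\<in>seqs UNIV n. Qh zs * ln (\<Prod>i<n. F (zs ! i)))
      = n * (\<Sum>k=0..K. p k * (\<Sum>z\<in>UNIV. Q k z * ln (F z)))"
    if F: "\<And>w i z. w \<in> \<Omega> \<Longrightarrow> i < n \<Longrightarrow> 0 < Q (enc w ! i) z \<Longrightarrow> 0 < F z" for F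
  proof -
    have "(\<Sum>zs\<in>seqs UNIV n. Qh zs * ln (\<Prod>i<n. F (zs ! i)))
      = (\<Sum>w\<in>\<Omega>. \<Sum>zs\<in>seqs UNIV n. chn Q (enc w) zs * ln (\<Prod>i<n. F (zs ! i))) / card \<Omega>"
      unfolding Qh_def times_divide_eq_left sum_distrib_right sum_divide_distrib[symmetric]
      by (subst sum.swap) simp
    also have "\<dots> = (\<Sum>w\<in>\<Omega>. \<Sum>i<n. \<Sum>z\<in>UNIV. Q (enc w ! i) z * ln (F z)) / card \<Omega>"
      by (intro arg_cong2[where f = "(/)"] sum.cong refl sum_chn_ln_prod[OF Q enc] F)
    also have "\<dots> = n * (\<Sum>k=0..K. p k * (\<Sum>z\<in>UNIV. Q k z * ln (F z)))" by (rule avg)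
    finally show ?thesis .
  qed
  have mix: "(\<Sum>k=0..K. p k * (\<Sum>z\<in>UNIV. Q k z * g z)) = (\<Sum>z\<in>UNIV. R z * g z)" for g
    unfolding R_def sum_distrib_left sum_distrib_right by (subst sum.swap) (simp add: mult.assoc)
  have "n * relent R (Q 0) UNIV = n * (\<Sum>z\<in>UNIV. R z * ln (R z)) - n * (\<Sum>z\<in>UNIV. R z * ln (Q 0 z))"
    using R0 Q0 less_imp_neq[OF Q0] by (subst relent_eq) (auto simp: less_imp_le algebra_simps)
  also have "\<dots> = (\<Sum>zs\<in>seqs UNIV n. Qh zs * ln (\<Prod>i<n. R (zs ! i)))
      - (\<Sum>zs\<in>seqs UNIV n. Qh zs * ln (\<Prod>i<n. Q 0 (zs ! i)))"
    using Qh_lin[of R] Qh_lin[of "Q 0"] Rpos Q0 by (simp add: mix)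
  finally have g1: "n * relent R (Q 0) UNIV = (\<Sum>zs\<in>seqs UNIV n. Qh zs * ln (\<Prod>i<n. R (zs ! i)))
      - (\<Sum>zs\<in>seqs UNIV n. Qh zs * ln (\<Prod>i<n. Q 0 (zs ! i)))" .
  \<comment> \<open>Nonnegativity of the divergence between the induced law \<open>Qh\<close> and
    the product law with marginal \<open>R\<close>.\<close>
  have g2: "(\<Sum>zs\<in>seqs UNIV n. Qh zs * ln (\<Prod>i<n. R (zs ! i))) \<le> (\<Sum>zs\<in>seqs UNIV n. Qh zs * ln (Qh zs))"
  proof (rule Gibbs)
    fix zs :: "'z list"
    show "0 \<le> (\<Prod>i<n. R (zs ! i))" by (intro prod_nonneg R0)
    assume "(\<Prod>i<n. R (zs ! i)) = 0"
    then obtain i where i: "i < n" "R (zs ! i) = 0" by auto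
    have "chn Q (enc w) zs = 0" if "w \<in> \<Omega>" for w
      using chn_pos_nth[OF _ Q enc[OF that] i(1)] Rpos[OF that i(1)] i(2) by fastforce
    then show "Qh zs = 0" by (simp add: Qh_def)
  next
    have "(\<Sum>zs\<in>seqs UNIV n. Qh zs) = (\<Sum>w\<in>\<Omega>. \<Sum>zs\<in>seqs UNIV n. chn Q (enc w) zs) / card \<Omega>"
      unfolding Qh_def sum_divide_distrib by (rule sum.swap)
    also have "\<dots> = (\<Sum>w\<in>\<Omega>. 1) / card \<Omega>" by (intro arg_cong2[where f = "(/)"] sum.cong refl sum_chn[OF Q enc])
    also have "\<dots> = 1" using C by simp
    finally have "(\<Sum>zs\<in>seqs UNIV n. Qh zs) = 1" .
    moreover have "(\<Sum>zs\<in>seqs UNIV n. \<Prod>i<n. R (zs ! i)) = 1"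
    proof -
      have "(\<Sum>z\<in>UNIV. R z) = 1"
        using mix[of "\<lambda>_. 1"] p by (simp add: stoch_sum[OF Q] input_dists_def)
      then show ?thesis by (subst sum_seqs_prod) simp
    qed
    ultimately show "(\<Sum>zs\<in>seqs UNIV n. \<Prod>i<n. R (zs ! i)) \<le> (\<Sum>zs\<in>seqs UNIV n. Qh zs)" by simp
  qed (rule Qh0)
  have g3: "(\<Sum>zs\<in>seqs UNIV n. Qh zs * ln (Qh zs)) - (\<Sum>zs\<in>seqs UNIV n. Qh zs * ln (\<Prod>i<n. Q 0 (zs ! i)))
     = relent Qh (\<lambda>zs. \<Prod>i<n. Q 0 (zs ! i)) (seqs UNIV n)"
  proof -
    have "0 < (\<Prod>i<n. Q 0 (zs ! i))" for zs by (intro prod_pos) (use Q0 in auto)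
    then have "0 \<le> (\<Prod>i<n. Q 0 (zs ! i))" "(\<Prod>i<n. Q 0 (zs ! i)) \<noteq> 0" for zs
      by (simp_all only: less_imp_le less_imp_neq[symmetric] not_False_eq_True)
    then show ?thesis using Qh0 by (subst relent_eq) auto
  qed
  have "n * relent R (Q 0) UNIV \<le> relent Qh (\<lambda>zs. \<Prod>i<n. Q 0 (zs ! i)) (seqs UNIV n)"
    using g1 g2 g3 by linarith
  then show thesis using that[OF p avg] unfolding R_def[abs_def] Qh_def[abs_def] by blast
qed

section \<open>Second-order expansion of relative entropy\<close>

text \<open>The difference of the two sides has derivative \<open>x^3 / (1 + x)\<close>, so it
  attains its minimum 0 at \<open>x = 0\<close>.\<close>

lemma ln_one_plus_le_cubic:
  fixes u :: real
  assumes "-1 < u"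
  shows "ln (1 + u) \<le> u - u^2 / 2 + u^3 / 3"
proof -
  define f where "f = (\<lambda>u::real. u - u^2 / 2 + u^3 / 3 - ln (1 + u))"
  have d: "(f has_real_derivative x^3 / (1 + x)) (at x)" if "-1 < x" for x
    unfolding f_def using that
    by (auto intro!: derivative_eq_intros simp: field_simps power2_eq_square power3_eq_cube)
  have "f 0 \<le> f u"
  proof (cases "0 \<le> u")
    case True
    show ?thesis
      by (rule DERIV_nonneg_imp_nondecreasing[OF True]) (use d in \<open>force intro!: exI\<close>)
  next
    case False
    have "x^3 / (1 + x) \<le> 0" if "u \<le> x" "x \<le> 0" for x
      using that assms by (intro divide_nonpos_nonneg) (auto simp: power_le_zero_eq)
    then show ?thesis
      by (intro DERIV_nonpos_imp_nonincreasing[of u 0]) (use d assms False in \<open>force intro!: exI\<close>)+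
  qed
  then show ?thesis by (simp add: f_def)
qed

lemma xlnx_upper:
  fixes u :: real
  assumes "\<bar>u\<bar> \<le> 1/2"
  shows "(1 + u) * ln (1 + u) \<le> u + u^2 / 2 * (1 + \<bar>u\<bar>)"
proof -
  have "(1 + u) * ln (1 + u) \<le> (1 + u) * (u - u^2 / 2 + u^3 / 3)"
    using assms by (intro mult_left_mono ln_one_plus_le_cubic) auto
  also have "\<dots> = u + u^2 / 2 * (1 + (- u / 3 + 2 * u^2 / 3))"
    by (simp add: field_simps power2_eq_square power3_eq_cube)
  also have "\<dots> \<le> u + u^2 / 2 * (1 + \<bar>u\<bar>)"
  proof -
    have "u^2 = \<bar>u\<bar> * \<bar>u\<bar>" by (simp add: power2_eq_square)
    also have "\<dots> \<le> \<bar>u\<bar> * (1/2)" using assms by (intro mult_left_mono) auto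
    finally show ?thesis by (intro add_left_mono mult_left_mono) auto
  qed
  finally show ?thesis .
qed

lemma xlnx_lower:
  fixes u :: real
  assumes "\<bar>u\<bar> \<le> 1/2"
  shows "u + u^2 / 2 * (1 - \<bar>u\<bar>) \<le> (1 + u) * ln (1 + u)"
proof -
  have pos: "1 + u > 0" using assms by simp
  \<comment> \<open>\<open>1 + v\<close> is the reciprocal of \<open>1 + u\<close>, so the upper
    bound on \<open>ln (1 + v)\<close> is a lower bound on \<open>ln (1 + u)\<close>.\<close>
  define v where "v = - u / (1 + u)"
  have v1: "1 + v = 1 / (1 + u)" using pos by (simp add: v_def field_simps)
  then have "-1 < v" using pos by (metis add_minus_cancel less_add_same_cancel1 zero_less_divide_1_iff)
  from ln_one_plus_le_cubic[OF this] have "- ln (1 + u) \<le> v - v^2 / 2 + v^3 / 3"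
    using pos by (simp add: v1 ln_div)
  then have "(1 + u) * (- v + v^2 / 2 - v^3 / 3) \<le> (1 + u) * ln (1 + u)"
    using pos by (intro mult_left_mono) auto
  moreover have "(1 + u) * (- v + v^2 / 2 - v^3 / 3) = u + u^2 / 2 * ((3 + 5 * u) / (3 * (1 + u)^2))"
  proof -
    have vu: "(1 + u) * v = - u" using pos by (simp add: v_def)
    have "(1 + u)^2 * ((1 + u) * (- v + v^2 / 2 - v^3 / 3))
        = (1 + u)^2 * (- ((1 + u) * v)) + (1 + u) * ((1 + u) * v)^2 / 2 - ((1 + u) * v)^3 / 3"
      by (simp add: algebra_simps power2_eq_square power3_eq_cube)
    also have "\<dots> = (1 + u)^2 * u + u^2 / 2 * (3 + 5 * u) / 3"
      unfolding vu by (simp add: field_simps power2_eq_square power3_eq_cube)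
    also have "\<dots> = (1 + u)^2 * (u + u^2 / 2 * ((3 + 5 * u) / (3 * (1 + u)^2)))"
      using pos by (simp add: field_simps)
    finally show ?thesis using pos by simp
  qed
  moreover have "1 - \<bar>u\<bar> \<le> (3 + 5 * u) / (3 * (1 + u)^2)"
  proof -
    have "(1 - \<bar>u\<bar>) * (3 * (1 + u)^2) \<le> 3 + 5 * u"
    proof (cases "0 \<le> u")
      case True
      then have "0 \<le> 2 * u + 3 * u^2 + 3 * u^3" by simp
      then show ?thesis using True by (simp add: algebra_simps power2_eq_square power3_eq_cube)
    next
      case False
      then have u: "u < 0" "-1/2 \<le> u" using assms by auto
      \<comment> \<open>Expansion of \<open>4 + 9 * u + 3 * u^2\<close> around the endpoint
        \<open>-1/2\<close>, where all coefficients are visibly nonnegative.\<close>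
      have "0 \<le> 1/4 + 6 * (u + 1/2) + 3 * (u + 1/2)^2" using u by simp
      then have "0 \<le> 4 + 9 * u + 3 * u^2" by (simp add: algebra_simps power2_eq_square)
      then have "u * (4 + 9 * u + 3 * u^2) \<le> 0" using u by (intro mult_nonpos_nonneg) auto
      then show ?thesis using False by (simp add: algebra_simps power2_eq_square power3_eq_cube)
    qed
    then show ?thesis using pos by (simp add: pos_le_divide_eq)
  qed
  then have "u^2 / 2 * (1 - \<bar>u\<bar>) \<le> u^2 / 2 * ((3 + 5 * u) / (3 * (1 + u)^2))"
    by (intro mult_left_mono) auto
  ultimately show ?thesis by linarith
qed

text \<open>From \<open>ln (1 / sqrt x) \<le> 1 / sqrt x - 1\<close>. Applied to likelihood ratios
  and summed against the reference law, it bounds the squared Hellinger distance by the relative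
  entropy.\<close>

lemma xlnx_ge_sqrt:
  fixes x :: real
  assumes "0 \<le> x"
  shows "x - 1 + (sqrt x - 1)^2 \<le> x * ln x"
proof (cases "x = 0")
  case False
  then have x: "x > 0" using assms by simp
  have "ln (1 / sqrt x) \<le> 1 / sqrt x - 1" using x by (intro ln_le_minus_one) simp
  then have "- (ln x / 2) \<le> 1 / sqrt x - 1" using x by (simp add: ln_div ln_sqrt)
  then have "(2 * x) * (- (ln x / 2)) \<le> (2 * x) * (1 / sqrt x - 1)" using x by (intro mult_left_mono) auto
  moreover have "(2 * x) * (1 / sqrt x - 1) = 2 * sqrt x - 2 * x"
  proof -
    have "(2 * x) * (1 / sqrt x - 1) = 2 * (x / sqrt x) - 2 * x" by (simp add: algebra_simps)
    then show ?thesis using x by (simp add: real_div_sqrt)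
  qed
  ultimately show ?thesis using x by (simp add: power2_diff)
qed simp

lemma relent_ratio:
  fixes R q :: "'z::finite \<Rightarrow> real"
  assumes "\<And>z. 0 < q z"
  shows "relent R q UNIV = (\<Sum>z\<in>UNIV. q z * (xlnx (1 + (R z / q z - 1))))"
    and "chi2 R q = (\<Sum>z\<in>UNIV. q z * (R z / q z - 1)^2)"
proof -
  have q: "q z \<noteq> 0" for z using assms[of z] by simp
  show "relent R q UNIV = (\<Sum>z\<in>UNIV. q z * (xlnx (1 + (R z / q z - 1))))"
    unfolding relent_def using q by (intro sum.cong) auto
  show "chi2 R q = (\<Sum>z\<in>UNIV. q z * (R z / q z - 1)^2)"
    unfolding chi2_def using q by (intro sum.cong refl) (simp add: field_simps power2_eq_square)
qed

lemma sum_ratio_zero: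
  fixes R q :: "'z::finite \<Rightarrow> real"
  assumes "\<And>z. 0 < q z" "(\<Sum>z\<in>UNIV. q z) = 1" "(\<Sum>z\<in>UNIV. R z) = 1"
  shows "(\<Sum>z\<in>UNIV. q z * (R z / q z - 1)) = 0"
proof -
  have "q z * (R z / q z - 1) = R z - q z" for z using assms(1)[of z] by (simp add: field_simps)
  then show ?thesis using assms by (simp add: sum_subtractf)
qed

text \<open>With \<open>u\<close> the deviation of the likelihood ratio from 1, the first-order term
  has mean 0 under \<open>q\<close>. The quadratic term is half the chi-squared distance, and the
  cubic remainder is absorbed by \<open>\<eta>\<close>.\<close>

lemma relent_chi2_bounds:
  fixes R q :: "'z::finite \<Rightarrow> real"
  assumes q: "\<And>z. 0 < q z" "(\<Sum>z\<in>UNIV. q z) = 1" and R: "(\<Sum>z\<in>UNIV. R z) = 1"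
    and u: "\<And>z. \<bar>R z / q z - 1\<bar> \<le> \<eta>" and \<eta>: "\<eta> \<le> 1/2"
  shows "chi2 R q / 2 * (1 - \<eta>) \<le> relent R q UNIV" "relent R q UNIV \<le> chi2 R q / 2 * (1 + \<eta>)"
proof -
  let ?u = "\<lambda>z. R z / q z - 1"
  note z = sum_ratio_zero[OF q R]
  have c: "chi2 R q / 2 * t = (\<Sum>z\<in>UNIV. q z * (?u z + (?u z)^2 / 2 * t))" for t
    unfolding relent_ratio(2)[OF q(1)] distrib_left sum.distrib z
    by (simp add: sum_distrib_right sum_divide_distrib mult.assoc)
  have "q z * (?u z + (?u z)^2 / 2 * (1 - \<eta>)) \<le> q z * ((1 + ?u z) * ln (1 + ?u z))" for z
  proof -
    have "(?u z)^2 / 2 * (1 - \<eta>) \<le> (?u z)^2 / 2 * (1 - \<bar>?u z\<bar>)" using u[of z] by (intro mult_left_mono) auto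
    then show ?thesis
      using xlnx_lower[of "?u z"] u[of z] \<eta> q(1)[of z] by (intro mult_left_mono) auto
  qed
  then show "chi2 R q / 2 * (1 - \<eta>) \<le> relent R q UNIV"
    unfolding c relent_ratio(1)[OF q(1)] by (intro sum_mono)
  have "q z * ((1 + ?u z) * ln (1 + ?u z)) \<le> q z * (?u z + (?u z)^2 / 2 * (1 + \<eta>))" for z
  proof -
    have "(?u z)^2 / 2 * (1 + \<bar>?u z\<bar>) \<le> (?u z)^2 / 2 * (1 + \<eta>)" using u[of z] by (intro mult_left_mono) auto
    then show ?thesis
      using xlnx_upper[of "?u z"] u[of z] \<eta> q(1)[of z] by (intro mult_left_mono) auto
  qed
  then show "relent R q UNIV \<le> chi2 R q / 2 * (1 + \<eta>)"
    unfolding c relent_ratio(1)[OF q(1)] by (intro sum_mono)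
qed

text \<open>The constant depends on \<open>q\<close> only, which makes the asymptotic converse
  uniform over input laws. The Hellinger bound controls \<open>(sqrt x - 1)^2\<close> for each
  likelihood ratio \<open>x\<close>, and \<open>x \<le> 1 / m\<close> bounds the other factor of
  \<open>(x - 1)^2 = (sqrt x - 1)^2 * (sqrt x + 1)^2\<close>.\<close>

lemma relent_controls_ratio:
  fixes q :: "'z::finite \<Rightarrow> real"
  assumes q: "\<And>z. 0 < q z" "(\<Sum>z\<in>UNIV. q z) = 1"
  obtains C where "0 < C" "\<And>R z. (\<And>z. 0 \<le> R z) \<Longrightarrow> (\<Sum>z\<in>UNIV. R z) = 1 \<Longrightarrow> \<bar>R z / q z - 1\<bar>
      \<le> C * sqrt (relent R q UNIV)"
proof -
  define m where "m = Min (range q)"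
  have m: "0 < m" and mq: "m \<le> q z" for z using q by (auto simp: m_def)
  define B where "B = (sqrt (1 / m) + 1)^2 / m"
  have B: "0 < B" unfolding B_def using m by (intro divide_pos_pos zero_less_power add_nonneg_pos) auto
  have "\<bar>R z / q z - 1\<bar> \<le> sqrt B * sqrt (relent R q UNIV)"
    if R0: "\<And>z. 0 \<le> R z" and R1: "(\<Sum>z\<in>UNIV. R z) = 1" for R z
  proof -
    let ?x = "\<lambda>z. R z / q z"
    have x0: "0 \<le> ?x z" for z using R0[of z] q(1)[of z] by simp
    have "m * (sqrt (?x z) - 1)^2 \<le> q z * (sqrt (?x z) - 1)^2" by (intro mult_right_mono mq) auto
    also have "\<dots> \<le> (\<Sum>z\<in>UNIV. q z * (sqrt (?x z) - 1)^2)"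
      using q(1) by (intro member_le_sum) (auto simp: less_imp_le)
    also have "\<dots> \<le> (\<Sum>z\<in>UNIV. q z * (?x z * ln (?x z)) - q z * (?x z - 1))"
    proof (intro sum_mono)
      fix z
      have "q z * (?x z - 1 + (sqrt (?x z) - 1)^2) \<le> q z * (?x z * ln (?x z))"
        using xlnx_ge_sqrt[OF x0[of z]] q(1)[of z] by (intro mult_left_mono) auto
      then show "q z * (sqrt (?x z) - 1)^2 \<le> q z * (?x z * ln (?x z)) - q z * (?x z - 1)"
        by (simp only: distrib_left)
    qed
    also have "\<dots> = relent R q UNIV"
      using relent_ratio(1)[OF q(1), of R] by (simp add: sum_subtractf sum_ratio_zero[OF q R1])
    finally have 1: "m * (sqrt (?x z) - 1)^2 \<le> relent R q UNIV" .
    have "R z \<le> 1" using R1 R0 member_le_sum[of z UNIV R] by auto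
    then have "?x z \<le> 1 / m" using mq[of z] m R0[of z] q(1)[of z] by (intro frac_le) auto
    then have 2: "(sqrt (?x z) + 1)^2 \<le> (sqrt (1 / m) + 1)^2"
      using x0[of z] by (intro power_mono add_right_mono) (auto simp: real_sqrt_le_iff)
    have "(a - 1)^2 = (sqrt a - 1)^2 * (sqrt a + 1)^2" if "0 \<le> a" for a :: real
      using that by (simp add: power_mult_distrib[symmetric] algebra_simps)
    from this[OF x0[of z]] have "(?x z - 1)^2 = (sqrt (?x z) - 1)^2 * (sqrt (?x z) + 1)^2" .
    also have "\<dots> \<le> (relent R q UNIV / m) * (sqrt (1 / m) + 1)^2"
    proof (intro mult_mono)
      show "(sqrt (?x z) - 1)^2 \<le> relent R q UNIV / m" using 1 m by (simp add: field_simps)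
      then show "0 \<le> relent R q UNIV / m" using order_trans[OF zero_le_power2] by blast
    qed (use 2 in auto)
    also have "\<dots> = B * relent R q UNIV" by (simp add: B_def)
    finally have "sqrt ((?x z - 1)^2) \<le> sqrt (B * relent R q UNIV)" by (rule real_sqrt_le_mono)
    then show ?thesis by (simp add: real_sqrt_mult)
  qed
  then show thesis using B by (intro that[of "sqrt B"]) auto
qed

section \<open>The covert capacity\<close>

text \<open>The chi-squared distance as a quadratic form in the weights of the nonzero symbols; the
  weight of symbol 0 is implicit. Unnormalised \<open>b\<close> is allowed, which serves both sparse
  input laws and integer weights.\<close>

definition chi_form :: "nat \<Rightarrow> (nat \<Rightarrow> 'z::finite \<Rightarrow> real) \<Rightarrow> (nat \<Rightarrow> real) \<Rightarrow> real" where
  "chi_form K Q b = (\<Sum>z\<in>UNIV. (\<Sum>k=1..K. b k * (Q k z - Q 0 z))^2 / Q 0 z)"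

definition warden_ok :: "nat \<Rightarrow> (nat \<Rightarrow> 'z::finite \<Rightarrow> real) \<Rightarrow> bool" where
  "warden_ok K Q \<longleftrightarrow> 1 \<le> K \<and> stoch K Q \<and> (\<forall>z. 0 < Q 0 z) \<and>
     \<not> (\<exists>p\<in>prob_vecs K. \<forall>z. Q 0 z = (\<Sum>k=1..K. p k * Q k z))"

lemma chi_form_scale: "chi_form K Q (\<lambda>k. t * b k) = t^2 * chi_form K Q b"
  unfolding chi_form_def
  by (simp add: mult.assoc power_mult_distrib sum_distrib_left[symmetric])
     (simp add: sum_distrib_left mult.assoc flip: times_divide_eq_right)

lemma chi_form_nonneg: "warden_ok K Q \<Longrightarrow> 0 \<le> chi_form K Q b"
  unfolding chi_form_def warden_ok_def by (intro sum_nonneg divide_nonneg_nonneg) (auto simp: less_imp_le)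

lemma sum_0_to_K: "(\<Sum>k=0..K. f k) = f 0 + (\<Sum>k=1..K. f k)" for f :: "nat \<Rightarrow> real"
  by (simp add: sum.atLeast_Suc_atMost)

lemma chi2_prob_vecs: "p \<in> prob_vecs K \<Longrightarrow> chi2 (\<lambda>z. \<Sum>k=1..K. p k * Q k z) (Q 0) = chi_form K Q p"
  unfolding chi2_def chi_form_def prob_vecs_def
  by (simp add: right_diff_distrib sum_subtractf flip: sum_distrib_right)

lemma chi2_input_dists:
  assumes "p \<in> input_dists K" shows "chi2 (\<lambda>z. \<Sum>k=0..K. p k * Q k z) (Q 0) = chi_form K Q p"
proof -
  have p0: "p 0 = 1 - (\<Sum>k=1..K. p k)" using assms sum_0_to_K[of p K] by (simp add: input_dists_def)
  have "(\<Sum>k=0..K. p k * Q k z) - Q 0 z = (\<Sum>k=1..K. p k * (Q k z - Q 0 z))" for z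
    unfolding sum_0_to_K[of "\<lambda>k. p k * Q k z"] p0
    by (simp add: algebra_simps sum_subtractf sum_distrib_left)
  then show ?thesis by (simp add: chi2_def chi_form_def)
qed

text \<open>Non-redundancy of symbol 0 says that \<open>Q 0\<close> lies outside the convex hull of
  the other rows. As the hull of finitely many points of a Euclidean space it is compact, so
  \<open>Q 0\<close> is at positive distance \<open>d\<close> from it. Dividing each square by
  \<open>Q 0 z \<le> 1\<close> can only enlarge the sum, so \<open>d^2\<close> is a valid
  bound.\<close>

lemma chi_form_lower_bound:
  fixes Q :: "nat \<Rightarrow> 'z::finite \<Rightarrow> real"
  assumes "warden_ok K Q"
  obtains m where "0 < m" "\<And>p. p \<in> prob_vecs K \<Longrightarrow> m \<le> chi_form K Q p"
proof -
  have st: "stoch K Q" and Q0: "\<And>z. 0 < Q 0 z"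
    and nr: "\<not> (\<exists>p\<in>prob_vecs K. \<forall>z. Q 0 z = (\<Sum>k=1..K. p k * Q k z))"
    using assms by (auto simp: warden_ok_def)
  define v where "v k = (\<chi> z. Q k z)" for k
  define T where "T = (\<lambda>p. \<Sum>k=1..K. p k *\<^sub>R v k) ` prob_vecs K"
  have "convex T"
  proof (rule convexI)
    fix x y and s t :: real assume x: "x \<in> T" and y: "y \<in> T" and st: "0 \<le> s" "0 \<le> t" "s + t = 1"
    obtain p q where p: "p \<in> prob_vecs K" "x = (\<Sum>k=1..K. p k *\<^sub>R v k)"
      and q: "q \<in> prob_vecs K" "y = (\<Sum>k=1..K. q k *\<^sub>R v k)" using x y by (auto simp: T_def)
    let ?r = "\<lambda>k. s * p k + t * q k"
    have "?r \<in> prob_vecs K" using p q st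
      by (auto simp: prob_vecs_def sum.distrib simp flip: sum_distrib_left)
    moreover have "s *\<^sub>R x + t *\<^sub>R y = (\<Sum>k=1..K. ?r k *\<^sub>R v k)"
      by (simp add: p q scaleR_left_distrib sum.distrib scaleR_right.sum)
    ultimately show "s *\<^sub>R x + t *\<^sub>R y \<in> T" unfolding T_def by (intro image_eqI[where x = ?r]) simp_all
  qed
  moreover have "v k \<in> T" if "k \<in> {1..K}" for k
  proof -
    have "(\<lambda>j. if j = k then 1 else 0) \<in> prob_vecs K" using that by (simp add: prob_vecs_def)
    moreover have "v k = (\<Sum>j=1..K. (if j = k then 1 else 0) *\<^sub>R v j)"
      using that by (simp add: if_distrib[where f = "\<lambda>c. c *\<^sub>R _"] cong: if_cong)
    ultimately show ?thesis unfolding T_def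
      by (intro image_eqI[where x = "\<lambda>j. if j = k then 1 else 0"])
  qed
  ultimately have "convex hull (v ` {1..K}) \<subseteq> T" by (intro hull_minimal) auto
  moreover have "T \<subseteq> convex hull (v ` {1..K})"
  proof
    fix x assume "x \<in> T"
    then obtain p where p: "p \<in> prob_vecs K" "x = (\<Sum>k=1..K. p k *\<^sub>R v k)" by (auto simp: T_def)
    show "x \<in> convex hull (v ` {1..K})"
      unfolding p(2)
    proof (rule convex_sum[OF _ convex_convex_hull])
      show "v k \<in> convex hull (v ` {1..K})" if "k \<in> {1..K}" for k
        using that by (intro hull_inc imageI)
    qed (use p(1) in \<open>simp_all add: prob_vecs_def\<close>)
  qed
  ultimately have "T = convex hull (v ` {1..K})" by blast
  then have "closed T" by (simp add: finite_imp_compact_convex_hull compact_imp_closed)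
  moreover have "v 0 \<notin> T"
  proof
    assume "v 0 \<in> T"
    then obtain p where p: "p \<in> prob_vecs K" "v 0 = (\<Sum>k=1..K. p k *\<^sub>R v k)" by (auto simp: T_def)
    have "Q 0 z = (\<Sum>k=1..K. p k * Q k z)" for z
      using arg_cong[OF p(2), of "\<lambda>x. x $ z"] by (simp add: v_def)
    then show False using nr p(1) by blast
  qed
  ultimately have "\<exists>d>0. \<forall>x\<in>T. d \<le> dist (v 0) x" by (rule separate_point_closed)
  then obtain d where d: "0 < d" "\<And>x. x \<in> T \<Longrightarrow> d \<le> dist (v 0) x" by blast
  have "d^2 \<le> chi_form K Q p" if p: "p \<in> prob_vecs K" for p
  proof -
    let ?x = "\<Sum>k=1..K. p k *\<^sub>R v k"
    have "d \<le> dist (v 0) ?x" using p by (intro d) (auto simp: T_def)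
    then have "d^2 \<le> (norm (?x - v 0))^2" using d(1) unfolding dist_commute[of "v 0"]
      by (intro power_mono) (simp_all add: dist_norm)
    also have "\<dots> = (\<Sum>z\<in>UNIV. ((?x - v 0) $ z)^2)"
      by (simp add: norm_vec_def L2_set_def sum_nonneg)
    also have "\<dots> = (\<Sum>z\<in>UNIV. ((\<Sum>k=1..K. p k * Q k z) - Q 0 z)^2)" by (simp add: v_def)
    also have "\<dots> \<le> chi2 (\<lambda>z. \<Sum>k=1..K. p k * Q k z) (Q 0)"
      unfolding chi2_def
    proof (intro sum_mono)
      fix z show "((\<Sum>k=1..K. p k * Q k z) - Q 0 z)^2 \<le> ((\<Sum>k=1..K. p k * Q k z) - Q 0 z)^2 / Q 0 z"
        using Q0[of z] stoch_le1[OF st, of 0 z] by (simp add: pos_le_divide_eq mult_left_le)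
    qed
    finally show ?thesis unfolding chi2_prob_vecs[OF p] .
  qed
  then show thesis using d(1) by (intro that[of "d^2"]) auto
qed

definition weighted_relent :: "nat \<Rightarrow> (nat \<Rightarrow> 'y::finite \<Rightarrow> real) \<Rightarrow> (nat \<Rightarrow> real) \<Rightarrow> real" where
  "weighted_relent K W b = (\<Sum>k=1..K. b k * relent (W k) (W 0) UNIV)"

lemma covert_cap_alt:
  "covert_cap K W Q = (SUP p\<in>prob_vecs K. sqrt (2 * (weighted_relent K W p)^2 / chi_form K Q p))"
  unfolding covert_cap_def weighted_relent_def
  by (intro arg_cong[where f = Sup] image_cong refl) (simp only: chi2_prob_vecs)

lemma prob_vecs_nonempty: "1 \<le> K \<Longrightarrow> prob_vecs K \<noteq> {}"
proof -
  assume "1 \<le> K"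
  then have "(\<lambda>k. if k = 1 then 1 else 0) \<in> prob_vecs K" by (simp add: prob_vecs_def)
  then show ?thesis by blast
qed

lemma prob_vecs_le1: "p \<in> prob_vecs K \<Longrightarrow> k \<in> {1..K} \<Longrightarrow> p k \<le> 1"
  using member_le_sum[of k "{1..K}" p] by (auto simp: prob_vecs_def)

text \<open>A real \<open>Sup\<close> is meaningful only for sets bounded above. The denominator
  stays away from 0 by non-redundancy, the numerator is bounded because each \<open>p k\<close> is
  at most 1.\<close>

lemma covert_cap_bdd:
  fixes W :: "nat \<Rightarrow> 'y::finite \<Rightarrow> real"
  assumes Q: "warden_ok K Q" and W: "ac_channel K W"
  shows "bdd_above ((\<lambda>p. sqrt (2 * (weighted_relent K W p)^2 / chi_form K Q p)) ` prob_vecs K)"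
proof -
  obtain m where m: "0 < m" "\<And>p. p \<in> prob_vecs K \<Longrightarrow> m \<le> chi_form K Q p"
    using chi_form_lower_bound[OF Q] by blast
  define D where "D = (\<Sum>k=1..K. relent (W k) (W 0) UNIV)"
  have "sqrt (2 * (weighted_relent K W p)^2 / chi_form K Q p) \<le> sqrt (2 * D^2 / m)" if p: "p \<in> prob_vecs K"
      for p
  proof -
    have "0 \<le> weighted_relent K W p"
      unfolding weighted_relent_def using p
      by (intro sum_nonneg mult_nonneg_nonneg ac_channel_relent(2)[OF W]) (auto simp: prob_vecs_def)
    moreover have "weighted_relent K W p \<le> D"
      unfolding weighted_relent_def D_def using p prob_vecs_le1[OF p]
      by (intro sum_mono mult_left_le_one_le ac_channel_relent(2)[OF W]) (auto simp: prob_vecs_def)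
    ultimately show ?thesis using m(1) m(2)[OF p]
      by (intro real_sqrt_le_mono frac_le mult_left_mono power_mono) auto
  qed
  then show ?thesis by (intro bdd_aboveI2)
qed

lemma covert_cap_nonneg:
  fixes W :: "nat \<Rightarrow> 'y::finite \<Rightarrow> real"
  assumes Q: "warden_ok K Q" and W: "ac_channel K W"
  shows "0 \<le> covert_cap K W Q"
proof -
  obtain p where p: "p \<in> prob_vecs K" using prob_vecs_nonempty[of K] Q by (auto simp: warden_ok_def)
  have "0 \<le> sqrt (2 * (weighted_relent K W p)^2 / chi_form K Q p)" by (simp add: chi_form_nonneg[OF Q])
  also have "\<dots> \<le> covert_cap K W Q"
    unfolding covert_cap_alt by (rule cSUP_upper[OF p covert_cap_bdd[OF Q W]])
  finally show ?thesis .
qed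

text \<open>Both sides are homogeneous of degree 1 in \<open>b\<close>, so the definition of the
  capacity, which ranges over probability vectors, extends to all nonnegative weights; zero weights
  are treated apart.\<close>

lemma weighted_relent_le_covert_cap:
  fixes W :: "nat \<Rightarrow> 'y::finite \<Rightarrow> real"
  assumes Q: "warden_ok K Q" and W: "ac_channel K W" and b: "\<And>k. k \<in> {1..K} \<Longrightarrow> 0 \<le> b k"
  shows "weighted_relent K W b \<le> covert_cap K W Q * sqrt (chi_form K Q b / 2)"
proof (cases "sum b {1..K} = 0")
  case True
  then have "\<And>k. k \<in> {1..K} \<Longrightarrow> b k = 0" using b sum_nonneg_eq_0_iff[of "{1..K}" b] by auto
  then have "weighted_relent K W b = 0" by (simp add: weighted_relent_def)
  then show ?thesis using covert_cap_nonneg[OF Q W] chi_form_nonneg[OF Q, of b] by simp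
next
  case False
  define a where "a = sum b {1..K}"
  have a: "0 < a" using False b sum_nonneg[of "{1..K}" b]
    unfolding a_def by (intro order.not_eq_order_implies_strict) auto
  define p where "p k = b k / a" for k
  have p: "p \<in> prob_vecs K"
    using a b by (auto simp: prob_vecs_def p_def a_def simp flip: sum_divide_distrib)
  obtain m where m: "0 < m" "\<And>p. p \<in> prob_vecs K \<Longrightarrow> m \<le> chi_form K Q p"
    using chi_form_lower_bound[OF Q] by blast
  have c: "0 < chi_form K Q p" using m(1) m(2)[OF p] by simp
  have "weighted_relent K W p \<le> \<bar>weighted_relent K W p\<bar>" by simp
  also have "\<dots> = sqrt (2 * (weighted_relent K W p)^2 / chi_form K Q p * (chi_form K Q p / 2))"
    using c by simp
  also have "\<dots> = sqrt (2 * (weighted_relent K W p)^2 / chi_form K Q p) * sqrt (chi_form K Q p / 2)"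
    by (rule real_sqrt_mult)
  also have "\<dots> \<le> covert_cap K W Q * sqrt (chi_form K Q p / 2)"
    unfolding covert_cap_alt using c by (intro mult_right_mono cSUP_upper[OF p covert_cap_bdd[OF Q W]]) auto
  finally have "a * weighted_relent K W p \<le> a * (covert_cap K W Q * sqrt (chi_form K Q p / 2))"
    using a by (intro mult_left_mono) auto
  moreover have "a * weighted_relent K W p = weighted_relent K W b"
    using a by (simp add: weighted_relent_def p_def sum_distrib_left)
  moreover have "a * sqrt (chi_form K Q p / 2) = sqrt (chi_form K Q b / 2)"
  proof -
    have "chi_form K Q b = a^2 * chi_form K Q p"
      using a chi_form_scale[of K Q a p] by (simp add: p_def)
    then show ?thesis using a by (simp add: real_sqrt_mult real_sqrt_divide)
  qed
  ultimately show ?thesis by (simp only: mult.left_commute[of a])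
qed

lemma covert_cap_approx:
  fixes W :: "nat \<Rightarrow> 'y::finite \<Rightarrow> real"
  assumes Q: "warden_ok K Q" and W: "ac_channel K W" and L: "L < covert_cap K W Q"
  obtains p where "p \<in> prob_vecs K" "L < sqrt (2 * (weighted_relent K W p)^2 / chi_form K Q p)"
  using L Q less_cSUP_iff[OF prob_vecs_nonempty covert_cap_bdd[OF Q W], of L]
  unfolding covert_cap_alt warden_ok_def by blast

text \<open>The quantifier order matters: the threshold on \<open>n\<close> must not depend on
  \<open>p\<close>, since every blocklength comes with its own code and its own average
  input.\<close>

lemma covert_converse_asymp:
  fixes W :: "nat \<Rightarrow> 'y::finite \<Rightarrow> real" and Q :: "nat \<Rightarrow> 'z::finite \<Rightarrow> real"
  assumes Q: "warden_ok K Q" and W: "ac_channel K W" and \<delta>: "0 < \<delta>" and \<tau>: "0 < \<tau>"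
  shows "\<forall>\<^sub>F n in sequentially. \<forall>p\<in>input_dists K. real n * input_relent K p Q \<le> \<delta>
     \<longrightarrow> real n * weighted_relent K W p \<le> covert_cap K W Q * (1 + \<tau>) * sqrt (real n * \<delta>)"
proof -
  have st: "stoch K Q" and Q0: "\<And>z. 0 < Q 0 z" using Q by (auto simp: warden_ok_def)
  obtain C where C: "0 < C" "\<And>R z. (\<And>z. 0 \<le> R z) \<Longrightarrow> (\<Sum>z\<in>UNIV. R z) = 1 \<Longrightarrow> \<bar>R z / Q 0 z - 1\<bar>
      \<le> C * sqrt (relent R (Q 0) UNIV)"
    using relent_controls_ratio[OF Q0 stoch_sum[OF st]] by auto
  \<comment> \<open>The bound on the deviation of the likelihood ratios that follows from a
    divergence of at most \<open>\<delta> / n\<close>.\<close>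
  define \<eta> where "\<eta> n = C * sqrt (\<delta> / real n)" for n
  have "\<eta> \<longlonglongrightarrow> C * sqrt 0"
    unfolding \<eta>_def by (intro tendsto_mult tendsto_const tendsto_real_sqrt tendsto_divide_0[OF tendsto_const]
        filterlim_real_sequentially filterlim_at_top_imp_at_infinity)
  then have \<eta>0: "\<eta> \<longlonglongrightarrow> 0" by simp
  have "(\<lambda>n. (1 + \<tau>)^2 * (1 - \<eta> n)) \<longlonglongrightarrow> (1 + \<tau>)^2 * (1 - 0)" by (intro tendsto_intros \<eta>0)
  moreover have "1 < (1 + \<tau>)^2 * (1 - 0)" using \<tau> by (simp add: power2_eq_square algebra_simps add_pos_pos)
  ultimately have ev1: "\<forall>\<^sub>F n in sequentially. 1 < (1 + \<tau>)^2 * (1 - \<eta> n)" by (rule order_tendstoD(1))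
  have ev2: "\<forall>\<^sub>F n in sequentially. \<eta> n < 1/2" using \<eta>0 by (rule order_tendstoD(2)) simp
  show ?thesis
    using ev1 ev2 eventually_gt_at_top[of 0]
  proof eventually_elim
    case (elim n)
    show ?case
    proof (intro ballI impI)
      fix p assume p: "p \<in> input_dists K" and D: "real n * input_relent K p Q \<le> \<delta>"
      define R where "R z = (\<Sum>k=0..K. p k * Q k z)" for z
      have R0: "0 \<le> R z" for z
        unfolding R_def using p stoch_nonneg[OF st]
            by (intro sum_nonneg mult_nonneg_nonneg) (auto simp: input_dists_def)
      have R1: "(\<Sum>z\<in>UNIV. R z) = 1"
        unfolding R_def using p by (subst sum.swap) (simp add: stoch_sum[OF st] input_dists_def flip:
            sum_distrib_left)
      have Dn: "relent R (Q 0) UNIV \<le> \<delta> / real n"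
        using D elim unfolding R_def by (simp add: pos_le_divide_eq mult.commute)
      have u: "\<bar>R z / Q 0 z - 1\<bar> \<le> \<eta> n" for z
      proof -
        have "C * sqrt (relent R (Q 0) UNIV) \<le> \<eta> n"
          unfolding \<eta>_def using C(1) Dn by (intro mult_left_mono real_sqrt_le_mono) auto
        then show ?thesis using C(2)[OF R0 R1, of z] by linarith
      qed
      have "chi2 R (Q 0) / 2 * (1 - \<eta> n) \<le> \<delta> / real n"
        using relent_chi2_bounds(1)[OF Q0 stoch_sum[OF st] R1 u] elim Dn by linarith
      then have chi: "chi_form K Q p / 2 * (1 - \<eta> n) \<le> \<delta> / real n"
        unfolding R_def[abs_def] chi2_input_dists[OF p] .
      have "chi_form K Q p / 2 \<le> chi_form K Q p / 2 * ((1 + \<tau>)^2 * (1 - \<eta> n))"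
        using elim chi_form_nonneg[OF Q, of p] by (simp add: mult_le_cancel_left1)
      also have "\<dots> \<le> (1 + \<tau>)^2 * (\<delta> / real n)"
        using mult_left_mono[OF chi, of "(1 + \<tau>)^2"] by (simp add: mult_ac)
      finally have "sqrt (chi_form K Q p / 2) \<le> sqrt ((1 + \<tau>)^2 * (\<delta> / real n))" by (rule real_sqrt_le_mono)
      moreover have "sqrt ((1 + \<tau>)^2 * (\<delta> / real n)) = (1 + \<tau>) * sqrt (\<delta> / real n)"
        unfolding real_sqrt_mult using \<tau> by simp
      ultimately have s: "sqrt (chi_form K Q p / 2) \<le> (1 + \<tau>) * sqrt (\<delta> / real n)" by linarith
      have "weighted_relent K W p \<le> covert_cap K W Q * sqrt (chi_form K Q p / 2)"
        using p by (intro weighted_relent_le_covert_cap[OF Q W]) (auto simp: input_dists_def)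
      also have "\<dots> \<le> covert_cap K W Q * ((1 + \<tau>) * sqrt (\<delta> / real n))"
        using s by (intro mult_left_mono covert_cap_nonneg[OF Q W])
      finally have "real n * weighted_relent K W p
          \<le> real n * (covert_cap K W Q * ((1 + \<tau>) * sqrt (\<delta> / real n)))"
        by (intro mult_left_mono) auto
      moreover have "real n * sqrt (\<delta> / real n) = sqrt (real n * \<delta>)"
        using elim by (simp add: real_sqrt_divide real_sqrt_mult field_simps)
      moreover have "real n * (covert_cap K W Q * ((1 + \<tau>) * sqrt (\<delta> / real n)))
          = covert_cap K W Q * (1 + \<tau>) * (real n * sqrt (\<delta> / real n))"
        by (simp only: mult_ac)
      ultimately show "real n * weighted_relent K W p \<le> covert_cap K W Q * (1 + \<tau>) * sqrt (real n * \<delta>)"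
        by simp
    qed
  qed
qed

section \<open>Asymptotic converse\<close>

lemma converse_single_code:
  fixes V :: "nat \<Rightarrow> 'y::finite \<Rightarrow> real" and Q :: "nat \<Rightarrow> 'z::finite \<Rightarrow> real"
  assumes W: "stoch K W" and V: "ac_channel K V" and Q: "warden_ok K Q" and c: "0 \<le> c" "c \<le> 1"
    and cond: "\<And>p. p \<in> input_dists K \<Longrightarrow> c * mutual_info K p W \<le> mutual_info K p V"
    and M1: "1 \<le> M1" and M2: "1 \<le> M2" and Kn: "1 \<le> Kn" and n: "1 \<le> n"
    and enc: "\<And>w1 w2 s. w1 \<in> {1..M1} \<Longrightarrow> w2 \<in> {1..M2} \<Longrightarrow> s \<in> {1..Kn} \<Longrightarrow> enc w1 w2 s \<in> seqs {0..K} n"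
    and d1: "\<And>y s. y \<in> seqs UNIV n \<Longrightarrow> s \<in> {1..Kn} \<Longrightarrow> d1 y s \<in> {1..M1}"
    and d2: "\<And>y s. y \<in> seqs UNIV n \<Longrightarrow> s \<in> {1..Kn} \<Longrightarrow> d2 y s \<in> {1..M2}"
    and e1: "code_avg M1 M2 Kn (\<lambda>w1 w2 s. word_error W n (enc w1 w2 s) (\<lambda>y. d1 y s) w1) \<le> e"
    and e2: "code_avg M1 M2 Kn (\<lambda>w1 w2 s. word_error V n (enc w1 w2 s) (\<lambda>y. d2 y s) w2) \<le> e"
    and cov: "relent (\<lambda>zs. code_avg M1 M2 Kn (\<lambda>w1 w2 s. chn Q (enc w1 w2 s) zs)) (\<lambda>zs. \<Prod>i<n. Q 0 (zs !
        i)) (seqs UNIV n) \<le> \<delta>"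
  obtains p where "p \<in> input_dists K"
    "real n * input_relent K p Q \<le> \<delta>"
    "(1 - e) * (c * ln M1 + ln M2) - 2 * ln 2 \<le> real n * weighted_relent K V p"
proof -
  let ?\<Omega> = "{1..M1} \<times> {1..M2} \<times> {1..Kn}"
  let ?enc = "\<lambda>(w1, w2, s). enc w1 w2 s"
  have card: "real (card ?\<Omega>) = real M1 * real M2 * real Kn" by (simp add: mult.assoc)
  have sum: "(\<Sum>w\<in>?\<Omega>. f (?enc w)) = (\<Sum>w1=1..M1. \<Sum>w2=1..M2. \<Sum>s=1..Kn. f (enc w1 w2 s))" for f :: "nat list \<Rightarrow> real"
    by (simp add: sum.cartesian_product case_prod_unfold)
  have fin: "finite ?\<Omega>" "?\<Omega> \<noteq> {}" using M1 M2 Kn by auto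
  have enc': "?enc w \<in> seqs {0..K} n" if "w \<in> ?\<Omega>" for w using that enc by auto
  have st: "stoch K Q" and Q0: "\<And>z. 0 < Q 0 z" using Q by (auto simp: warden_ok_def)
  obtain p where p: "p \<in> input_dists K"
    and avg: "\<And>f :: nat \<Rightarrow> real. (\<Sum>w\<in>?\<Omega>. \<Sum>i<n. f (?enc w ! i)) / card ?\<Omega> = n * (\<Sum>k=0..K. p k * f k)"
    and rel: "n * input_relent K p Q
       \<le> relent (\<lambda>zs. (\<Sum>w\<in>?\<Omega>. chn Q (?enc w) zs) / card ?\<Omega>) (\<lambda>zs. \<Prod>i<n. Q 0 (zs ! i)) (seqs UNIV n)"
    by (rule empirical_dist[where enc = ?enc, OF fin _ n st Q0]) (use enc' in blast)+
  have "(\<Sum>k=0..K. p k * relent (V k) (V 0) UNIV) = weighted_relent K V p"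
    \<comment> \<open>The term of symbol 0 is the divergence of \<open>V 0\<close> from itself,
      hence 0.\<close>
    unfolding weighted_relent_def sum_0_to_K[of "\<lambda>k. p k * relent (V k) (V 0) UNIV"]
        by (simp add: ac_channel_relent_0)
  then have "code_avg M1 M2 Kn (\<lambda>w1 w2 s. \<Sum>i<n. relent (V (enc w1 w2 s ! i)) (V 0) UNIV)
      = n * weighted_relent K V p"
    using avg[of "\<lambda>k. relent (V k) (V 0) UNIV"]
    unfolding card sum[of "\<lambda>xs. \<Sum>i<n. relent (V (xs ! i)) (V 0) UNIV"] by simp
  moreover have "n * input_relent K p Q \<le> \<delta>"
    using rel cov unfolding card sum[of "\<lambda>xs. chn Q xs zs" for zs] by linarith
  ultimately show thesis
    using that[OF p] converse_code[OF W V c cond M1 M2 Kn enc d1 d2 e1 e2] by simp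
qed

lemma is_code_estimates:
  fixes P :: "nat \<Rightarrow> 'y1::finite \<Rightarrow> 'y2::finite \<Rightarrow> 'z::finite \<Rightarrow> real"
  assumes P: "bc_channel K P" and code: "is_code K n M1 M2 Kn enc dec1 dec2"
  shows "\<And>w1 w2 s. w1 \<in> {1..M1} \<Longrightarrow> w2 \<in> {1..M2} \<Longrightarrow> s \<in> {1..Kn} \<Longrightarrow> enc w1 w2 s \<in> seqs {0..K} n"
    and "code_avg M1 M2 Kn (\<lambda>w1 w2 s. word_error (chanW P) n (enc w1 w2 s) (\<lambda>y. dec1 y s) w1)
        \<le> code_error P n M1 M2 Kn enc dec1 dec2"
    and "code_avg M1 M2 Kn (\<lambda>w1 w2 s. word_error (chanV P) n (enc w1 w2 s) (\<lambda>y. dec2 y s) w2)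
        \<le> code_error P n M1 M2 Kn enc dec1 dec2"
    and "code_error P n M1 M2 Kn enc dec1 dec2 \<le>
       code_avg M1 M2 Kn (\<lambda>w1 w2 s. word_error (chanW P) n (enc w1 w2 s) (\<lambda>y. dec1 y s) w1)
     + code_avg M1 M2 Kn (\<lambda>w1 w2 s. word_error (chanV P) n (enc w1 w2 s) (\<lambda>y. dec2 y s) w2)"
    and "covertness P n M1 M2 Kn enc
        = relent (\<lambda>zs. code_avg M1 M2 Kn (\<lambda>w1 w2 s. chn (chanQ P) (enc w1 w2 s) zs)) (\<lambda>zs. \<Prod>i<n. chanQ P 0
        (zs ! i)) (seqs UNIV n)"
proof -
  show enc: "enc w1 w2 s \<in> seqs {0..K} n" if "w1 \<in> {1..M1}" "w2 \<in> {1..M2}" "s \<in> {1..Kn}" for w1 w2 s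
    using code that by (auto simp: is_code_def seqs_def)
  show "code_avg M1 M2 Kn (\<lambda>w1 w2 s. word_error (chanW P) n (enc w1 w2 s) (\<lambda>y. dec1 y s) w1)
      \<le> code_error P n M1 M2 Kn enc dec1 dec2"
    unfolding code_error_eq by (intro divide_right_mono sum_mono joint_word_error_bounds(1)[OF P enc]) auto
  show "code_avg M1 M2 Kn (\<lambda>w1 w2 s. word_error (chanV P) n (enc w1 w2 s) (\<lambda>y. dec2 y s) w2)
      \<le> code_error P n M1 M2 Kn enc dec1 dec2"
    unfolding code_error_eq by (intro divide_right_mono sum_mono joint_word_error_bounds(2)[OF P enc]) auto
  show "code_error P n M1 M2 Kn enc dec1 dec2 \<le>
       code_avg M1 M2 Kn (\<lambda>w1 w2 s. word_error (chanW P) n (enc w1 w2 s) (\<lambda>y. dec1 y s) w1)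
     + code_avg M1 M2 Kn (\<lambda>w1 w2 s. word_error (chanV P) n (enc w1 w2 s) (\<lambda>y. dec2 y s) w2)"
    unfolding code_error_eq add_divide_distrib[symmetric] sum.distrib[symmetric]
    by (intro divide_right_mono sum_mono joint_word_error_bounds(3)[OF P enc]) auto
  have "chn (chanQ P) (enc w1 w2 s) zs = (\<Prod>i<n. chanQ P (enc w1 w2 s ! i) (zs ! i))"
    if "w1 \<in> {1..M1}" "w2 \<in> {1..M2}" "s \<in> {1..Kn}" for w1 w2 s zs
    using enc[OF that] by (simp add: chn_def seqs_def)
  then have "warden_dist P n M1 M2 Kn enc = (\<lambda>zs. code_avg M1 M2 Kn (\<lambda>w1 w2 s. chn (chanQ P) (enc w1 w2 s) zs))"
    unfolding warden_dist_def by (intro ext arg_cong2[where f = "(/)"] sum.cong refl) simp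
  then show "covertness P n M1 M2 Kn enc
      = relent (\<lambda>zs. code_avg M1 M2 Kn (\<lambda>w1 w2 s. chn (chanQ P) (enc w1 w2 s) zs)) (\<lambda>zs. \<Prod>i<n. chanQ P 0
      (zs ! i)) (seqs UNIV n)"
    unfolding covertness_def no_input_dist_def[abs_def] seqs_UNIV by simp
qed

lemma Liminf_gt_eventually:
  fixes f :: "nat \<Rightarrow> real"
  assumes "ereal l \<le> Liminf sequentially (\<lambda>n. ereal (f n))" "x < l"
  shows "\<forall>\<^sub>F n in sequentially. x < f n"
proof -
  have "ereal x < Liminf sequentially (\<lambda>n. ereal (f n))" using assms
      by (meson ereal_less(2) less_ereal.simps(1) order_less_le_trans)
  then show ?thesis using less_LiminfD[of "ereal x" sequentially "\<lambda>n. ereal (f n)"] by simp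
qed

lemma Limsup_less_eventually:
  fixes f :: "nat \<Rightarrow> real"
  assumes "Limsup sequentially (\<lambda>n. ereal (f n)) \<le> ereal l" "l < x"
  shows "\<forall>\<^sub>F n in sequentially. f n < x"
proof -
  have "Limsup sequentially (\<lambda>n. ereal (f n)) < ereal x" using assms
      by (meson less_ereal.simps(1) order_le_less_trans)
  then show ?thesis using Limsup_lessD[of sequentially "\<lambda>n. ereal (f n)" "ereal x"] by simp
qed

lemma sqrt_mult_at_top:
  assumes "0 < \<delta>" shows "filterlim (\<lambda>n. sqrt (real n * \<delta>)) at_top sequentially"
  using filterlim_compose[OF sqrt_at_top
      filterlim_tendsto_pos_mult_at_top[OF tendsto_const assms filterlim_real_sequentially]]
  by (simp add: mult.commute)

text \<open>All limits are replaced by a common slack \<open>\<tau>\<close>. For each admissible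
  \<open>\<tau>\<close> a single large \<open>n\<close> yields an inequality free of
  \<open>n\<close>, and then \<open>\<tau>\<close> tends to 0 from the right.\<close>

lemma converse_asymptotic:
  fixes V :: "nat \<Rightarrow> 'y::finite \<Rightarrow> real" and Q :: "nat \<Rightarrow> 'z::finite \<Rightarrow> real" and M1 M2 :: "nat \<Rightarrow> nat"
  assumes Q: "warden_ok K Q" and V: "ac_channel K V" and c: "0 \<le> c" and \<delta>: "0 < \<delta>" and \<epsilon>: "\<epsilon> < 1"
    and rate: "\<And>n. 1 \<le> n \<Longrightarrow> \<exists>p\<in>input_dists K.
        real n * input_relent K p Q \<le> \<delta> \<and>
        (1 - e n) * (c * ln (M1 n) + ln (M2 n)) - 2 * ln 2 \<le> real n * weighted_relent K V p"
    and M: "\<And>n. 1 \<le> M1 n" "\<And>n. 1 \<le> M2 n"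
    and L1: "ereal L1 \<le> Liminf sequentially (\<lambda>n. ereal (ln (real (M1 n)) / sqrt (real n * \<delta>)))"
    and L2: "ereal L2 \<le> Liminf sequentially (\<lambda>n. ereal (ln (real (M2 n)) / sqrt (real n * \<delta>)))"
    and err: "Limsup sequentially (\<lambda>n. ereal (e n)) \<le> ereal \<epsilon>"
  shows "(1 - \<epsilon>) * (c * L1 + L2) \<le> covert_cap K V Q"
proof -
  let ?B = "covert_cap K V Q"
  have key: "(1 - \<epsilon> - \<tau>) * (c * (L1 - \<tau>) + (L2 - \<tau>)) \<le> \<tau> + ?B * (1 + \<tau>)" if \<tau>: "0 < \<tau>" "\<tau> < 1 - \<epsilon>" for \<tau>
  proof -
    have "(\<lambda>n. 2 * ln 2 / sqrt (real n * \<delta>)) \<longlonglongrightarrow> 0"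
      by (intro tendsto_divide_0[OF tendsto_const] filterlim_at_top_imp_at_infinity sqrt_mult_at_top \<delta>)
    then have "\<forall>\<^sub>F n in sequentially. 2 * ln 2 / sqrt (real n * \<delta>) < \<tau>" using \<tau>(1) by (rule order_tendstoD(2))
    moreover have "\<forall>\<^sub>F n in sequentially. L1 - \<tau> < ln (real (M1 n)) / sqrt (real n * \<delta>)"
      using \<tau> by (intro Liminf_gt_eventually[OF L1]) simp
    moreover have "\<forall>\<^sub>F n in sequentially. L2 - \<tau> < ln (real (M2 n)) / sqrt (real n * \<delta>)"
      using \<tau> by (intro Liminf_gt_eventually[OF L2]) simp
    moreover have "\<forall>\<^sub>F n in sequentially. e n < \<epsilon> + \<tau>" using \<tau> by (intro Limsup_less_eventually[OF err]) simp
    ultimately have "\<forall>\<^sub>F n in sequentially. (1 - \<epsilon> - \<tau>) * (c * (L1 - \<tau>) + (L2 - \<tau>)) \<le> \<tau> + ?B * (1 + \<tau>)"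
      using covert_converse_asymp[OF Q V \<delta> \<tau>(1)] eventually_ge_at_top[of 1]
    proof eventually_elim
      case (elim n)
      define s where "s = sqrt (real n * \<delta>)"
      have s: "0 < s" using elim \<delta> by (simp add: s_def)
      have l: "0 \<le> ln (real (M1 n))" "0 \<le> ln (real (M2 n))" using M[of n] by auto
      have "c * (L1 - \<tau>) + (L2 - \<tau>) \<le> c * (ln (real (M1 n)) / s) + ln (real (M2 n)) / s"
        using elim c by (intro add_mono mult_left_mono) (auto simp: s_def)
      then have "(1 - \<epsilon> - \<tau>) * (c * (L1 - \<tau>) + (L2 - \<tau>))
          \<le> (1 - \<epsilon> - \<tau>) * (c * (ln (real (M1 n)) / s) + ln (real (M2 n)) / s)"
        using \<tau> by (intro mult_left_mono) auto
      also have "\<dots> \<le> (1 - e n) * (c * (ln (real (M1 n)) / s) + ln (real (M2 n)) / s)"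
        using elim l c s by (intro mult_right_mono) auto
      also have "\<dots> = ((1 - e n) * (c * ln (M1 n) + ln (M2 n))) / s"
          by (simp add: add_divide_distrib distrib_left)
      also have "\<dots> \<le> (2 * ln 2 + ?B * (1 + \<tau>) * s) / s"
      proof -
        obtain p where p: "p \<in> input_dists K" "real n * input_relent K p Q \<le> \<delta>"
          "(1 - e n) * (c * ln (M1 n) + ln (M2 n)) - 2 * ln 2 \<le> real n * weighted_relent K V p"
          using rate[of n] elim by blast
        have "real n * weighted_relent K V p \<le> ?B * (1 + \<tau>) * s"
          using elim p(1,2) by (simp add: s_def)
        then show ?thesis using p(3) s by (intro divide_right_mono) auto
      qed
      also have "\<dots> = 2 * ln 2 / s + ?B * (1 + \<tau>)" using s by (simp add: add_divide_distrib)
      also have "\<dots> \<le> \<tau> + ?B * (1 + \<tau>)" using elim by (simp add: s_def)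
      finally show ?case .
    qed
    then show ?thesis using eventually_happens'[OF sequentially_bot] by blast
  qed
  have "((\<lambda>\<tau>. (1 - \<epsilon> - \<tau>) * (c * (L1 - \<tau>) + (L2 - \<tau>))) \<longlongrightarrow> (1 - \<epsilon> - 0) * (c * (L1 - 0) + (L2 - 0))) (at_right 0)"
    by (intro tendsto_intros)
  moreover have "((\<lambda>\<tau>. \<tau> + ?B * (1 + \<tau>)) \<longlongrightarrow> 0 + ?B * (1 + 0)) (at_right 0)"
    by (intro tendsto_intros)
  moreover have "\<forall>\<^sub>F \<tau> in at_right 0. (1 - \<epsilon> - \<tau>) * (c * (L1 - \<tau>) + (L2 - \<tau>)) \<le> \<tau> + ?B * (1 + \<tau>)"
    unfolding eventually_at_right_field using \<epsilon> key by (intro exI[of _ "1 - \<epsilon>"]) auto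
  ultimately have "(1 - \<epsilon> - 0) * (c * (L1 - 0) + (L2 - 0)) \<le> 0 + ?B * (1 + 0)"
    by (intro tendsto_le[OF trivial_limit_at_right_real])
  then show ?thesis by simp
qed

lemma mutual_info_nonneg:
  assumes p: "p \<in> input_dists K" and W: "stoch K W"
  shows "0 \<le> mutual_info K p W"
  unfolding mutual_info_def
proof (rule sum_nonneg)
  fix x assume x: "x \<in> {0..K}"
  define O' where "O' y = (\<Sum>x'=0..K. p x' * W x' y)" for y
  have p0: "\<And>x. x \<in> {0..K} \<Longrightarrow> 0 \<le> p x" and p1: "(\<Sum>x=0..K. p x) = 1"
    using p by (auto simp: input_dists_def)
  have t0: "0 \<le> p x' * W x' y" if "x' \<in> {0..K}" for x' y
    using that p0 stoch_nonneg[OF W] by (intro mult_nonneg_nonneg) auto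
  show "0 \<le> (\<Sum>y\<in>UNIV. if p x * W x y = 0 then 0 else p x * W x y * ln (W x y / (\<Sum>x'=0..K. p x' * W x' y)))"
    unfolding O'_def[symmetric]
  proof (cases "p x = 0")
    case False
    have "0 \<le> relent (W x) O' UNIV"
    proof (rule relent_nonneg)
      fix y assume "O' y = 0"
      then have "p x * W x y = 0" using t0 x unfolding O'_def by (subst (asm) sum_nonneg_eq_0_iff) auto
      then show "W x y = 0" using False by simp
    next
      have "(\<Sum>y\<in>UNIV. O' y) = 1"
        unfolding O'_def by (subst sum.swap) (simp add: stoch_sum[OF W] p1 flip: sum_distrib_left)
      then show "sum O' UNIV \<le> sum (W x) UNIV" using x by (simp add: stoch_sum[OF W])
    qed (use x stoch_nonneg[OF W] t0 in \<open>auto simp: O'_def intro!: sum_nonneg\<close>)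
    moreover have "(\<Sum>y\<in>UNIV. if p x * W x y = 0 then 0 else p x * W x y * ln (W x y / O' y))
        = p x * relent (W x) O' UNIV"
      unfolding relent_def sum_distrib_left using False by (intro sum.cong) auto
    ultimately show "0 \<le> (\<Sum>y\<in>UNIV. if p x * W x y = 0 then 0 else p x * W x y * ln (W x y / O' y))"
      using p0[OF x] by simp
  qed simp
qed

lemma achievable_converse:
  fixes P :: "nat \<Rightarrow> 'y1::finite \<Rightarrow> 'y2::finite \<Rightarrow> 'z::finite \<Rightarrow> real"
  assumes P: "bc_channel K P" and Q: "warden_ok K (chanQ P)"
    and W: "ac_channel K (chanW P)" and V: "ac_channel K (chanV P)"
    and c: "0 \<le> c" "c \<le> 1" and \<delta>: "0 < \<delta>" and \<epsilon>: "\<epsilon> < 1" and ach: "achievable K P \<epsilon> \<delta> L"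
  shows "(\<And>p. p \<in> input_dists K \<Longrightarrow> c * mutual_info K p (chanW P) \<le> mutual_info K p (chanV P))
      \<Longrightarrow> (1 - \<epsilon>) * (c * fst L + snd L) \<le> covert_cap K (chanV P) (chanQ P)"
    and "(\<And>p. p \<in> input_dists K \<Longrightarrow> c * mutual_info K p (chanV P) \<le> mutual_info K p (chanW P))
      \<Longrightarrow> (1 - \<epsilon>) * (c * snd L + fst L) \<le> covert_cap K (chanW P) (chanQ P)"
proof -
  obtain M1 M2 Kn enc dec1 dec2 where
    code: "\<And>n. is_code K n (M1 n) (M2 n) (Kn n) (enc n) (dec1 n) (dec2 n)"
    and cov: "\<And>n. covertness P n (M1 n) (M2 n) (Kn n) (enc n) \<le> \<delta>"
    and L1: "ereal (fst L) \<le> Liminf sequentially (\<lambda>n. ereal (ln (real (M1 n)) / sqrt (real n * \<delta>)))"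
    and L2: "ereal (snd L) \<le> Liminf sequentially (\<lambda>n. ereal (ln (real (M2 n)) / sqrt (real n * \<delta>)))"
    and err: "Limsup sequentially (\<lambda>n. ereal (code_error P n (M1 n) (M2 n) (Kn n) (enc n) (dec1 n) (dec2 n)))
        \<le> ereal \<epsilon>"
    using ach unfolding achievable_def by blast
  define e where "e n = code_error P n (M1 n) (M2 n) (Kn n) (enc n) (dec1 n) (dec2 n)" for n
  have M: "1 \<le> M1 n" "1 \<le> M2 n" "1 \<le> Kn n" for n using code[of n] by (auto simp: is_code_def)
  have d1: "dec1 n y s \<in> {1..M1 n}" if "y \<in> seqs UNIV n" "s \<in> {1..Kn n}" for n y s
    using code[of n] that by (auto simp: is_code_def seqs_def)
  have d2: "dec2 n y s \<in> {1..M2 n}" if "y \<in> seqs UNIV n" "s \<in> {1..Kn n}" for n y s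
    using code[of n] that by (auto simp: is_code_def seqs_def)
  note ac = is_code_estimates[OF P code]
  have stW: "stoch K (chanW P)" and stV: "stoch K (chanV P)" using W V by (auto simp: ac_channel_def)
  {
    assume cond: "\<And>p. p \<in> input_dists K \<Longrightarrow> c * mutual_info K p (chanW P) \<le> mutual_info K p (chanV P)"
    have "\<exists>p\<in>input_dists K. real n * input_relent K p (chanQ P) \<le> \<delta> \<and>
      (1 - e n) * (c * ln (M1 n) + ln (M2 n)) - 2 * ln 2 \<le> real n * weighted_relent K (chanV P) p" if n: "1 \<le>
          n" for n
      unfolding e_def
      by (rule converse_single_code[OF stW V Q c cond M[of n] n ac(1) d1 d2 ac(2,3) cov[of n, unfolded ac(5)]])
          blast+
    then show "(1 - \<epsilon>) * (c * fst L + snd L) \<le> covert_cap K (chanV P) (chanQ P)"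
      by (intro converse_asymptotic[OF Q V c(1) \<delta> \<epsilon>, of e M1 M2] M L1 L2 err[folded e_def]) auto
  next
    assume cond: "\<And>p. p \<in> input_dists K \<Longrightarrow> c * mutual_info K p (chanV P) \<le> mutual_info K p (chanW P)"
    \<comment> \<open>The users exchange roles in the second case; the averages over messages and
      key are symmetric under this exchange.\<close>
    have sw: "(\<Sum>w1=1..M1 n. \<Sum>w2=1..M2 n. \<Sum>s=1..Kn n. f w1 w2 s) / (real (M1 n) * real (M2 n) * real (Kn n))
      = (\<Sum>w2=1..M2 n. \<Sum>w1=1..M1 n. \<Sum>s=1..Kn n. f w1 w2 s) / (real (M2 n) * real (M1 n) * real (Kn n))"
      for f :: "nat \<Rightarrow> nat \<Rightarrow> nat \<Rightarrow> real" and n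
      by (simp only: sum.swap[of _ "{1..M1 n}"] mult.commute[of "real (M1 n)"])
    have "\<exists>p\<in>input_dists K. real n * input_relent K p (chanQ P) \<le> \<delta> \<and>
      (1 - e n) * (c * ln (M2 n) + ln (M1 n)) - 2 * ln 2 \<le> real n * weighted_relent K (chanW P) p" if n: "1 \<le>
          n" for n
      unfolding e_def
      by (rule converse_single_code[where enc = "\<lambda>w2 w1 s. enc n w1 w2 s",
            OF stV W Q c cond M(2)[of n] M(1)[of n] M(3)[of n] n ac(1) d2 d1 ac(3)[unfolded sw] ac(2)[unfolded
                sw] cov[of n, unfolded ac(5) sw]]) blast+
    then show "(1 - \<epsilon>) * (c * snd L + fst L) \<le> covert_cap K (chanW P) (chanQ P)"
      by (intro converse_asymptotic[OF Q W c(1) \<delta> \<epsilon>, of e M2 M1] M L1 L2 err[folded e_def]) auto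
  }
qed

text \<open>The half-planes are closed, so each bound passes to the closure; letting
  \<open>\<epsilon>\<close> tend to 0 then removes the factor \<open>1 - \<epsilon>\<close>.\<close>

lemma covert_region_bound:
  assumes "\<And>\<epsilon> L. 0 < \<epsilon> \<Longrightarrow> \<epsilon> < 1 \<Longrightarrow> achievable K P \<epsilon> \<delta> L \<Longrightarrow> (1 - \<epsilon>) * (a * fst L + b * snd L) \<le> B"
    and L: "L \<in> covert_region K P \<delta>"
  shows "a * fst L + b * snd L \<le> B"
proof -
  have "(1 - \<epsilon>) * (a * fst L + b * snd L) \<le> B" if \<epsilon>: "0 < \<epsilon>" "\<epsilon> < 1" for \<epsilon>
  proof -
    have "closed {L :: real \<times> real. (1 - \<epsilon>) * (a * fst L + b * snd L) \<le> B}"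
      by (intro closed_Collect_le continuous_intros)
    moreover have "{L. achievable K P \<epsilon> \<delta> L} \<subseteq> {L. (1 - \<epsilon>) * (a * fst L + b * snd L) \<le> B}"
      using assms(1)[OF \<epsilon>] by blast
    ultimately have "region_eps K P \<epsilon> \<delta> \<subseteq> {L. (1 - \<epsilon>) * (a * fst L + b * snd L) \<le> B}"
      unfolding region_eps_def by (intro closure_minimal)
    then show ?thesis using L \<epsilon> by (auto simp: covert_region_def)
  qed
  then have "\<forall>\<^sub>F \<epsilon> in at_right 0. (1 - \<epsilon>) * (a * fst L + b * snd L) \<le> B"
    unfolding eventually_at_right_field by (intro exI[of _ 1]) auto
  moreover have "((\<lambda>\<epsilon>. (1 - \<epsilon>) * (a * fst L + b * snd L)) \<longlongrightarrow> (1 - 0) * (a * fst L + b * snd L)) (at_right 0)"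
    by (intro tendsto_intros)
  ultimately have "(1 - 0) * (a * fst L + b * snd L) \<le> B"
    by (intro tendsto_upperbound[OF _ _ trivial_limit_at_right_real])
  then show ?thesis by simp
qed

lemma covert_region_nonneg:
  assumes "L \<in> covert_region K P \<delta>"
  shows "0 \<le> fst L" "0 \<le> snd L"
proof -
  have "(1/2::real) \<in> {0<..<1}" by simp
  then have "L \<in> closure {L. achievable K P (1/2) \<delta> L}"
    using assms unfolding covert_region_def region_eps_def by blast
  moreover have "closure {L. achievable K P (1/2) \<delta> L} \<subseteq> {L. 0 \<le> fst L \<and> 0 \<le> snd L}"
    by (intro closure_minimal closed_Collect_conj closed_Collect_le continuous_intros) (auto simp:
        achievable_def)
  ultimately show "0 \<le> fst L" "0 \<le> snd L" by auto
qed

lemma covert_region_converse: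
  fixes P :: "nat \<Rightarrow> 'y1::finite \<Rightarrow> 'y2::finite \<Rightarrow> 'z::finite \<Rightarrow> real"
  assumes P: "bc_channel K P" and Q: "warden_ok K (chanQ P)"
    and W: "ac_channel K (chanW P)" and V: "ac_channel K (chanV P)" and \<delta>: "0 < \<delta>"
  defines "A \<equiv> covert_cap K (chanW P) (chanQ P)" and "B \<equiv> covert_cap K (chanV P) (chanQ P)"
  assumes cond1: "B \<le> A \<longrightarrow> (\<forall>p\<in>input_dists K. mutual_info K p (chanW P) * B \<le> A * mutual_info K p (chanV P))"
    and cond2: "A < B \<longrightarrow> (\<forall>p\<in>input_dists K. mutual_info K p (chanV P) * A \<le> B * mutual_info K p (chanW P))"
    and L: "L \<in> covert_region K P \<delta>"
  shows "ratio_term (fst L) A + ratio_term (snd L) B \<le> 1"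
proof -
  have A0: "0 \<le> A" and B0: "0 \<le> B" unfolding A_def B_def by (intro covert_cap_nonneg Q W V)+
  have L0: "0 \<le> fst L" "0 \<le> snd L" using covert_region_nonneg[OF L] .
  have stW: "stoch K (chanW P)" and stV: "stoch K (chanV P)" using W V by (auto simp: ac_channel_def)
  have b2: "c * fst L + snd L \<le> B"
    if "0 \<le> c" "c \<le> 1" "\<And>p. p \<in> input_dists K \<Longrightarrow> c * mutual_info K p (chanW P) \<le> mutual_info K p (chanV P)" for c
    using covert_region_bound[where a = c and b = 1
        and B = B, OF _ L] achievable_converse(1)[OF P Q W V that(1,2) \<delta> _ _ that(3)]
    unfolding B_def by simp
  have b1: "fst L + c * snd L \<le> A"
    if "0 \<le> c" "c \<le> 1" "\<And>p. p \<in> input_dists K \<Longrightarrow> c * mutual_info K p (chanV P) \<le> mutual_info K p (chanW P)" for c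
    using covert_region_bound[where a = 1 and b = c
        and B = A, OF _ L] achievable_converse(2)[OF P Q W V that(1,2) \<delta> _ _ that(3)]
    unfolding A_def by (simp add: add.commute)
  \<comment> \<open>For \<open>c = 0\<close> the comparison of mutual informations reduces to their
    nonnegativity, so the single-user bounds hold in either case. They settle the degenerate
    situation in which a capacity is 0 and no ratio can be formed.\<close>
  have LA: "fst L \<le> A" using b1[of 0] mutual_info_nonneg[OF _ stW] by simp
  have LB: "snd L \<le> B" using b2[of 0] mutual_info_nonneg[OF _ stV] by simp
  have done_pos: "ratio_term (fst L) A + ratio_term (snd L) B \<le> 1"
      if "0 < A" "0 < B" "fst L / A + snd L / B \<le> 1"
    using that by (simp add: ratio_term_def)
  show ?thesis
  proof (cases "A = 0 \<or> B = 0")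
    case True
    have 1: "ratio_term (fst L) A \<le> 1" "A = 0 \<Longrightarrow> ratio_term (fst L) A = 0"
      using LA L0 A0 by (auto simp: ratio_term_def one_ereal_def)
    have 2: "ratio_term (snd L) B \<le> 1" "B = 0 \<Longrightarrow> ratio_term (snd L) B = 0"
      using LB L0 B0 by (auto simp: ratio_term_def one_ereal_def)
    show ?thesis using True 1 2 by auto
  next
    case False
    then have pos: "0 < A" "0 < B" using A0 B0 by auto
    show ?thesis
    proof (cases "B \<le> A")
      case True
      have "B / A * fst L + snd L \<le> B"
      proof (rule b2)
        fix p assume "p \<in> input_dists K"
        then have "mutual_info K p (chanW P) * B \<le> A * mutual_info K p (chanV P)" using cond1 True by blast
        then show "B / A * mutual_info K p (chanW P) \<le> mutual_info K p (chanV P)"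
          using pos by (simp add: field_simps)
      qed (use pos True in auto)
      then show ?thesis using pos by (intro done_pos) (auto simp: field_simps)
    next
      case False
      have "fst L + A / B * snd L \<le> A"
      proof (rule b1)
        fix p assume "p \<in> input_dists K"
        then have "mutual_info K p (chanV P) * A \<le> B * mutual_info K p (chanW P)" using cond2 False by auto
        then show "A / B * mutual_info K p (chanV P) \<le> mutual_info K p (chanW P)"
          using pos by (simp add: field_simps)
      qed (use pos False in auto)
      then show ?thesis using pos by (intro done_pos) (auto simp: field_simps)
    qed
  qed
qed

section \<open>Random codes selected by the key\<close>

lemma PiE_avg:
  fixes f :: "'a \<Rightarrow> real"
  assumes I: "finite I" "w \<in> I" and A: "finite A" "A \<noteq> {}"
  shows "(\<Sum>\<kappa>\<in>I \<rightarrow>\<^sub>E A. f (\<kappa> w)) / card (I \<rightarrow>\<^sub>E A) = (\<Sum>a\<in>A. f a) / card A"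
proof -
  have a: "real (card A) > 0" using A by (simp add: card_gt_0_iff)
  have "(\<Sum>\<kappa>\<in>I \<rightarrow>\<^sub>E A. \<Prod>i\<in>I. (if i = w then f (\<kappa> i) else 1) / card A)
      = (\<Prod>i\<in>I. \<Sum>a\<in>A. (if i = w then f a else 1) / card A)"
    using I A by (intro prod_sum_PiE[symmetric]) auto
  also have "\<dots> = (\<Prod>i\<in>I. if i = w then (\<Sum>a\<in>A. f a) / card A else 1)"
    using a by (intro prod.cong refl) (simp flip: sum_divide_distrib)
  also have "\<dots> = (\<Sum>a\<in>A. f a) / card A" using I by simp
  also have "(\<Sum>\<kappa>\<in>I \<rightarrow>\<^sub>E A. \<Prod>i\<in>I. (if i = w then f (\<kappa> i) else 1) / card A)
      = (\<Sum>\<kappa>\<in>I \<rightarrow>\<^sub>E A. f (\<kappa> w)) / card (I \<rightarrow>\<^sub>E A)"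
    using I by (simp add: prod_dividef sum_divide_distrib card_PiE cong: if_cong)
  finally show ?thesis .
qed

text \<open>Two different codewords of a uniform random codebook are independent. Pairwise
  independence is all that the union bound over wrong messages uses.\<close>

lemma PiE_avg2:
  fixes f h :: "'a \<Rightarrow> real"
  assumes I: "finite I" "w \<in> I" "w' \<in> I" "w \<noteq> w'" and A: "finite A" "A \<noteq> {}"
  shows "(\<Sum>\<kappa>\<in>I \<rightarrow>\<^sub>E A. f (\<kappa> w) * h (\<kappa> w')) / card (I \<rightarrow>\<^sub>E A)
    = (\<Sum>a\<in>A. f a) / card A * ((\<Sum>a\<in>A. h a) / card A)"
proof -
  have a: "real (card A) > 0" using A by (simp add: card_gt_0_iff)
  let ?F = "\<lambda>i a. (if i = w then f a else 1) * (if i = w' then h a else 1)"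
  have "(\<Sum>\<kappa>\<in>I \<rightarrow>\<^sub>E A. \<Prod>i\<in>I. ?F i (\<kappa> i) / card A) = (\<Prod>i\<in>I. \<Sum>a\<in>A. ?F i a / card A)"
    using I A by (intro prod_sum_PiE[symmetric]) auto
  also have "\<dots> = (\<Prod>i\<in>I. (if i = w then (\<Sum>a\<in>A. f a) / card A else 1) * (if i
      = w' then (\<Sum>a\<in>A. h a) / card A else 1))"
    using a I by (intro prod.cong refl) (auto simp flip: sum_divide_distrib)
  also have "\<dots> = (\<Sum>a\<in>A. f a) / card A * ((\<Sum>a\<in>A. h a) / card A)" using I by (simp add: prod.distrib)
  also have "(\<Sum>\<kappa>\<in>I \<rightarrow>\<^sub>E A. \<Prod>i\<in>I. ?F i (\<kappa> i) / card A)
      = (\<Sum>\<kappa>\<in>I \<rightarrow>\<^sub>E A. f (\<kappa> w) * h (\<kappa> w')) / card (I \<rightarrow>\<^sub>E A)"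
    using I by (simp add: prod_dividef sum_divide_distrib card_PiE prod.distrib cong: if_cong)
  finally show ?thesis .
qed

text \<open>The output law when the input is \<open>g t\<close> for a uniform index
  \<open>t\<close>. Uniform index words pushed through \<open>g\<close> thus realise product inputs
  with rational letter weights.\<close>

definition mix :: "(nat \<Rightarrow> 'y \<Rightarrow> real) \<Rightarrow> nat \<Rightarrow> (nat \<Rightarrow> nat) \<Rightarrow> 'y \<Rightarrow> real" where
  "mix W N g y = (\<Sum>t<N. W (g t) y) / N"

text \<open>The second moment of the likelihood ratio of the mixture against the no-input output
  law, under the latter.\<close>

abbreviation mix_moment :: "(nat \<Rightarrow> 'y::finite \<Rightarrow> real) \<Rightarrow> nat \<Rightarrow> (nat \<Rightarrow> nat) \<Rightarrow> real" where
  "mix_moment W N g \<equiv> (\<Sum>y\<in>UNIV. (mix W N g y)^2 / W 0 y)"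

lemma chn_map: "length a = m \<Longrightarrow> chn W (map g a) ys = (\<Prod>i<m. W (g (a ! i)) (ys ! i))"
  by (simp add: chn_def)

lemma avg_prod_seqs:
  fixes F :: "nat \<Rightarrow> nat \<Rightarrow> real"
  assumes N: "1 \<le> N"
  shows "(\<Sum>a\<in>seqs {..<N} m. \<Prod>i<m. F i (a ! i)) / card (seqs {..<N} m) = (\<Prod>i<m. (\<Sum>t<N. F i t) / N)"
  by (simp add: sum_seqs_prod card_seqs prod_dividef)

lemma avg_chn:
  assumes N: "1 \<le> N"
  shows "(\<Sum>a\<in>seqs {..<N} m. chn W (map g a) ys) / card (seqs {..<N} m) = (\<Prod>i<m. mix W N g (ys ! i))"
proof -
  have "(\<Sum>a\<in>seqs {..<N} m. chn W (map g a) ys) = (\<Sum>a\<in>seqs {..<N} m. \<Prod>i<m. W (g (a ! i)) (ys ! i))"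
    by (intro sum.cong refl chn_map length_seqs)
  then show ?thesis using avg_prod_seqs[OF N, of "\<lambda>i t. W (g t) (ys ! i)" m] by (simp add: mix_def)
qed

text \<open>Moment generating function of the information density (relative to \<open>W 0\<close>) at \<open>- t\<close>.\<close>

definition tilt :: "(nat \<Rightarrow> 'y::finite \<Rightarrow> real) \<Rightarrow> real \<Rightarrow> nat \<Rightarrow> real" where
  "tilt W t x = (\<Sum>y\<in>UNIV. W x y * exp (- t * ln (W x y / W 0 y)))"

lemma map_seqs:
  fixes g :: "nat \<Rightarrow> nat"
  shows "(\<And>t. t < N \<Longrightarrow> g t \<le> K) \<Longrightarrow> a \<in> seqs {..<N} m \<Longrightarrow> map g a \<in> seqs {0..K} m"
  by (auto simp: seqs_def subset_iff)

text \<open>Chernoff's bound: on the event that the information density is at most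
  \<open>\<gamma>\<close>, the factor \<open>exp (t * \<gamma>)\<close> times the density raised to
  \<open>- t\<close> is at least 1. The tilted weights then factor over letters.\<close>

lemma missed_word_bound:
  fixes W :: "nat \<Rightarrow> 'y::finite \<Rightarrow> real"
  assumes W: "ac_channel K W" and xs: "xs \<in> seqs {0..K} m" and t: "0 \<le> t"
  shows "(\<Sum>y\<in>seqs UNIV m. chn W xs y * (if \<not> exp \<gamma> * (\<Prod>i<m. W 0 (y ! i)) < chn W xs y then 1 else 0))
    \<le> exp (t * \<gamma>) * (\<Prod>i<m. tilt W t (xs ! i))"
proof -
  have st: "stoch K W" using W by (simp add: ac_channel_def)
  have "chn W xs y * (if \<not> exp \<gamma> * (\<Prod>i<m. W 0 (y ! i)) < chn W xs y then 1 else 0)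
    \<le> exp (t * \<gamma>) * (\<Prod>i<m. W (xs ! i) (y ! i) * exp (- t * ln (W (xs ! i) (y ! i) / W 0 (y ! i))))" for y
  proof (cases "chn W xs y \<noteq> 0 \<and> \<not> exp \<gamma> * (\<Prod>i<m. W 0 (y ! i)) < chn W xs y")
    case True
    have W1: "0 < W (xs ! i) (y ! i)" if "i < m" for i using chn_pos_nth[OF _ st xs that] True by blast
    have W0: "0 < W 0 (y ! i)" if "i < m" for i
    proof -
      have "W 0 (y ! i) \<noteq> 0" using W W1[OF that] nth_seqs[OF xs that] unfolding ac_channel_def by force
      then show ?thesis using stoch_nonneg[OF st, of 0 "y ! i"] by simp
    qed
    have v: "0 < (\<Prod>i<m. W 0 (y ! i))" using W0 by (intro prod_pos) auto
    have c: "chn W xs y = (\<Prod>i<m. W (xs ! i) (y ! i))" by (simp add: chn_def length_seqs[OF xs])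
    have c0: "0 < chn W xs y" unfolding c using W1 by (intro prod_pos) auto
    have "(\<Sum>i<m. ln (W (xs ! i) (y ! i) / W 0 (y ! i))) = ln (\<Prod>i<m. W (xs ! i) (y ! i) / W 0 (y ! i))"
      using W0 W1 by (intro ln_prod[symmetric]) (auto simp: less_imp_neq[symmetric])
    also have "\<dots> = ln (chn W xs y / (\<Prod>i<m. W 0 (y ! i)))" unfolding c by (simp add: prod_dividef)
    also have "\<dots> \<le> ln (exp \<gamma>)"
      using True c0 v by (subst ln_le_cancel_iff) (auto simp: pos_divide_le_eq)
    finally have "t * (\<Sum>i<m. ln (W (xs ! i) (y ! i) / W 0 (y ! i))) \<le> t * \<gamma>" using t
        by (simp add: mult_left_mono)
    then have "1 \<le> exp (t * \<gamma>) * exp (\<Sum>i<m. - t * ln (W (xs ! i) (y ! i) / W 0 (y ! i)))"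
      by (simp flip: exp_add sum_distrib_left add: sum_negf)
    then have "chn W xs y * 1 \<le> chn W xs y
        * (exp (t * \<gamma>) * exp (\<Sum>i<m. - t * ln (W (xs ! i) (y ! i) / W 0 (y ! i))))"
      using c0 by (intro mult_left_mono) auto
    then show ?thesis using True by (simp add: c prod.distrib exp_sum mult_ac)
  next
    case False
    have "0 \<le> exp (t * \<gamma>) * (\<Prod>i<m. W (xs ! i) (y ! i) * exp (- t * ln (W (xs ! i) (y ! i) / W 0 (y ! i))))"
      using nth_seqs[OF xs] by (intro mult_nonneg_nonneg prod_nonneg) (auto intro: stoch_nonneg[OF st])
    then show ?thesis using False by auto
  qed
  then have "(\<Sum>y\<in>seqs UNIV m. chn W xs y * (if \<not> exp \<gamma> * (\<Prod>i<m. W 0 (y ! i)) < chn W xs y then 1 else 0))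
    \<le> (\<Sum>y\<in>seqs UNIV m. exp (t * \<gamma>) *
        (\<Prod>i<m. W (xs ! i) (y ! i) * exp (- t * ln (W (xs ! i) (y ! i) / W 0 (y ! i)))))"
    by (rule sum_mono)
  also have "\<dots> = exp (t * \<gamma>) * (\<Prod>i<m. tilt W t (xs ! i))"
    unfolding tilt_def sum_distrib_left[symmetric]
    by (subst sum_seqs_prod[of "\<lambda>i y. W (xs ! i) y * exp (- t * ln (W (xs ! i) y / W 0 y))"]) simp
  finally show ?thesis .
qed

text \<open>The words consist of indices below \<open>N\<close>, not of channel symbols, so that the
  uniform law on this finite set is the desired ensemble and can be indexed by a uniform
  key.\<close>

definition codebooks :: "nat \<Rightarrow> nat \<Rightarrow> nat \<Rightarrow> (nat \<Rightarrow> nat list) set" where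
  "codebooks M N m = {1..M} \<rightarrow>\<^sub>E seqs {..<N} m"

abbreviation codebook_avg :: "nat \<Rightarrow> nat \<Rightarrow> nat \<Rightarrow> ((nat \<Rightarrow> nat list) \<Rightarrow> real) \<Rightarrow> real" where
  "codebook_avg M N m f \<equiv> (\<Sum>\<kappa>\<in>codebooks M N m. f \<kappa>) / card (codebooks M N m)"

text \<open>The reference is the no-input output law and not the output law of the ensemble.
  Additivity of the statistic then involves only divergences from \<open>W 0\<close>, at the price
  of a power of \<open>mix_moment\<close>.\<close>

definition accepts :: "(nat \<Rightarrow> 'y \<Rightarrow> real) \<Rightarrow> nat \<Rightarrow> real \<Rightarrow> nat list \<Rightarrow> 'y list \<Rightarrow> bool" where
  "accepts W m \<gamma> xs y \<longleftrightarrow> exp \<gamma> * (\<Prod>i<m. W 0 (y ! i)) < chn W xs y"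

text \<open>Which accepted message is chosen does not affect the error bound, since an ambiguous
  output is already counted as an error. The default 1 keeps the value in range.\<close>

definition threshold_dec ::
    "(nat \<Rightarrow> 'y \<Rightarrow> real) \<Rightarrow> nat \<Rightarrow> real \<Rightarrow> nat \<Rightarrow> (nat \<Rightarrow> nat) \<Rightarrow> (nat \<Rightarrow> nat list) \<Rightarrow> 'y list \<Rightarrow> nat" where
  "threshold_dec W m \<gamma> M g \<kappa> y =
     (if \<exists>w\<in>{1..M}. accepts W m \<gamma> (map g (\<kappa> w)) y
      then SOME w. w \<in> {1..M} \<and> accepts W m \<gamma> (map g (\<kappa> w)) y else 1)"

lemma threshold_dec_range: "1 \<le> M \<Longrightarrow> threshold_dec W m \<gamma> M g \<kappa> y \<in> {1..M}"
proof (cases "\<exists>w\<in>{1..M}. accepts W m \<gamma> (map g (\<kappa> w)) y")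
  case True
  then have "\<exists>w. w \<in> {1..M} \<and> accepts W m \<gamma> (map g (\<kappa> w)) y" by blast
  from someI_ex[OF this] show ?thesis using True unfolding threshold_dec_def by simp
qed (auto simp: threshold_dec_def)

lemma threshold_dec_correct:
  assumes "w \<in> {1..M}" "accepts W m \<gamma> (map g (\<kappa> w)) y"
    and "\<And>w'. w' \<in> {1..M} \<Longrightarrow> w' \<noteq> w \<Longrightarrow> \<not> accepts W m \<gamma> (map g (\<kappa> w')) y"
  shows "threshold_dec W m \<gamma> M g \<kappa> y = w"
proof -
  have "(SOME w. w \<in> {1..M} \<and> accepts W m \<gamma> (map g (\<kappa> w)) y) = w"
    using assms by (intro some_equality) blast+
  then show ?thesis using assms unfolding threshold_dec_def by auto
qed

lemma finite_codebooks: "finite (codebooks M N m)"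
  unfolding codebooks_def by (intro finite_PiE) auto

lemma codebooks_nonempty: "1 \<le> N \<Longrightarrow> codebooks M N m \<noteq> {}"
proof -
  assume "1 \<le> N"
  then have "replicate m 0 \<in> seqs {..<N} m" by (auto simp: seqs_def)
  then show ?thesis unfolding codebooks_def by (auto simp: PiE_eq_empty_iff)
qed

text \<open>An error requires that the sent word is missed or that another word is accepted. The
  first event is handled by Chernoff's bound. For the second, Markov's inequality replaces
  acceptance by a likelihood ratio, and independence of the two words turns its average into a
  second moment.\<close>

lemma ensemble_error:
  fixes W :: "nat \<Rightarrow> 'y::finite \<Rightarrow> real"
  assumes W: "ac_channel K W" and t: "0 \<le> t" and N: "1 \<le> N" and g: "\<And>s. s < N \<Longrightarrow> g s \<le> K"
    and w: "w \<in> {1..M}"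
  shows "codebook_avg M N m (\<lambda>\<kappa>. word_error W m (map g (\<kappa> w)) (threshold_dec W m \<gamma> M g \<kappa>) w)
    \<le> exp (t * \<gamma>) * ((\<Sum>s<N. tilt W t (g s)) / N)^m
      + real M * (exp (- \<gamma>) * (mix_moment W N g)^m)"
proof -
  have st: "stoch K W" using W by (simp add: ac_channel_def)
  let ?A = "seqs {..<N} m" and ?C = "codebooks M N m" and ?Y = "seqs (UNIV::'y set) m"
  define v0 where "v0 y = (\<Prod>i<m. W 0 (y ! i))" for y
  define X where "X \<kappa> w y = chn W (map g (\<kappa> w)) y" for \<kappa> :: "nat \<Rightarrow> nat list" and w y
  define miss where "miss a = (\<Sum>y\<in>?Y. chn W (map g a) y * (if \<not> accepts W m \<gamma> (map g a) y then 1 else 0))" for a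
  have A: "finite ?A" "?A \<noteq> {}" using codebooks_nonempty[OF N, of 1 m] unfolding codebooks_def by auto
  have C: "real (card ?C) > 0" using finite_codebooks codebooks_nonempty[OF N] by (simp add: card_gt_0_iff)
  have memA: "\<kappa> v \<in> ?A" if "\<kappa> \<in> ?C" "v \<in> {1..M}" for \<kappa> v using that unfolding codebooks_def by auto
  have mem: "map g (\<kappa> v) \<in> seqs {0..K} m" if "\<kappa> \<in> ?C" "v \<in> {1..M}" for \<kappa> v
    using map_seqs[OF g memA[OF that]] by auto
  have X0: "0 \<le> X \<kappa> v y" if "\<kappa> \<in> ?C" "v \<in> {1..M}" for \<kappa> v y
    unfolding X_def by (rule chn_nonneg[OF st mem[OF that]])
  have v00: "0 \<le> v0 y" for y unfolding v0_def by (intro prod_nonneg) (auto intro: stoch_nonneg[OF st])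
  \<comment> \<open>Where \<open>v0 y = 0\<close> the right-hand side is 0 by convention, but
    absolute continuity excludes acceptance there.\<close>
  have acc_bound: "(if accepts W m \<gamma> (map g (\<kappa> v)) y then 1 else 0) \<le> exp (- \<gamma>) * (X \<kappa> v y / v0 y)"
    if "\<kappa> \<in> ?C" "v \<in> {1..M}" for \<kappa> v y
  proof (cases "accepts W m \<gamma> (map g (\<kappa> v)) y")
    case True
    then have gt: "exp \<gamma> * v0 y < X \<kappa> v y" by (simp add: accepts_def v0_def X_def)
    have "v0 y \<noteq> 0"
    proof
      assume "v0 y = 0"
      then obtain i where i: "i < m" "W 0 (y ! i) = 0" by (auto simp: v0_def)
      have "X \<kappa> v y \<noteq> 0" using gt \<open>v0 y = 0\<close> by simp
      then have "0 < W (map g (\<kappa> v) ! i) (y ! i)" unfolding X_def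
          by (rule chn_pos_nth[OF _ st mem[OF that] i(1)])
      then show False using W i nth_seqs[OF mem[OF that] i(1)] unfolding ac_channel_def by force
    qed
    then have "0 < v0 y" using v00[of y] by simp
    then show ?thesis using gt True by (simp add: exp_minus field_simps)
  qed (use X0[OF that] v00 in auto)
  have err: "word_error W m (map g (\<kappa> w)) (threshold_dec W m \<gamma> M g \<kappa>) w
     \<le> miss (\<kappa> w) + (\<Sum>w'\<in>{1..M} - {w}. \<Sum>y\<in>?Y. exp (- \<gamma>) * (X \<kappa> w y * (X \<kappa> w' y / v0 y)))" if \<kappa>: "\<kappa> \<in> ?C" for \<kappa>
  proof -
    have "word_error W m (map g (\<kappa> w)) (threshold_dec W m \<gamma> M g \<kappa>) w
      \<le> (\<Sum>y\<in>?Y. X \<kappa> w y * ((if \<not> accepts W m \<gamma> (map g (\<kappa> w)) y then 1 else 0)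
           + (\<Sum>w'\<in>{1..M} - {w}. if accepts W m \<gamma> (map g (\<kappa> w')) y then 1 else 0)))"
      unfolding word_error_def X_def[symmetric]
    proof (intro sum_mono mult_left_mono X0[OF \<kappa> w])
      fix y
      show "(if threshold_dec W m \<gamma> M g \<kappa> y \<noteq> w then 1 else 0 :: real)
        \<le> (if \<not> accepts W m \<gamma> (map g (\<kappa> w)) y then 1 else 0)
           + (\<Sum>w'\<in>{1..M} - {w}. if accepts W m \<gamma> (map g (\<kappa> w')) y then 1 else 0)"
      proof (cases "accepts W m \<gamma> (map g (\<kappa> w)) y \<and> threshold_dec W m \<gamma> M g \<kappa> y \<noteq> w")
        case True
        then obtain w' where w': "w' \<in> {1..M} - {w}" "accepts W m \<gamma> (map g (\<kappa> w')) y"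
          using threshold_dec_correct[OF w, of W m \<gamma> g \<kappa> y] by blast
        then have "1 \<le> (\<Sum>w'\<in>{1..M} - {w}. if accepts W m \<gamma> (map g (\<kappa> w')) y then 1 else 0 :: real)"
          using member_le_sum[of w' "{1..M}
              - {w}" "\<lambda>w'. if accepts W m \<gamma> (map g (\<kappa> w')) y then 1 else 0 :: real"] by simp
        then show ?thesis using True by simp
      next
        case False
        have "0 \<le> (\<Sum>w'\<in>{1..M} - {w}. if accepts W m \<gamma> (map g (\<kappa> w')) y then 1 else 0 :: real)"
          by (intro sum_nonneg) simp
        then show ?thesis using False by auto
      qed
    qed
    also have "\<dots> = miss (\<kappa> w) + (\<Sum>w'\<in>{1..M}
        - {w}. \<Sum>y\<in>?Y. X \<kappa> w y * (if accepts W m \<gamma> (map g (\<kappa> w')) y then 1 else 0))"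
      unfolding distrib_left sum.distrib miss_def X_def[symmetric] sum_distrib_left
      by (subst (2) sum.swap) simp
    also have "\<dots> \<le> miss (\<kappa> w) + (\<Sum>w'\<in>{1..M} - {w}. \<Sum>y\<in>?Y. X \<kappa> w y * (exp (- \<gamma>) * (X \<kappa> w' y / v0 y)))"
      using \<kappa> w by (intro add_left_mono sum_mono mult_left_mono X0 acc_bound) auto
    finally show ?thesis by (simp add: mult.left_commute[of _ "exp (- \<gamma>)"])
  qed
  have miss_avg: "(\<Sum>\<kappa>\<in>?C. miss (\<kappa> w)) / card ?C \<le> exp (t * \<gamma>) * ((\<Sum>s<N. tilt W t (g s)) / N)^m"
  proof -
    have "(\<Sum>\<kappa>\<in>?C. miss (\<kappa> w)) / card ?C = (\<Sum>a\<in>?A. miss a) / card ?A"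
      unfolding codebooks_def by (rule PiE_avg[OF _ w A]) simp
    also have "\<dots> \<le> (\<Sum>a\<in>?A. exp (t * \<gamma>) * (\<Prod>i<m. tilt W t (g (a ! i)))) / card ?A"
    proof (intro divide_right_mono sum_mono)
      fix a assume a: "a \<in> ?A"
      show "miss a \<le> exp (t * \<gamma>) * (\<Prod>i<m. tilt W t (g (a ! i)))"
        using missed_word_bound[OF W map_seqs[where g = g, OF g a] t, where \<gamma> = \<gamma>] length_seqs[OF a]
        by (simp add: miss_def accepts_def)
    qed simp
    also have "\<dots> = exp (t * \<gamma>) * ((\<Sum>a\<in>?A. (\<Prod>i<m. tilt W t (g (a ! i)))) / card ?A)"
      by (simp add: sum_distrib_left)
    also have "\<dots> = exp (t * \<gamma>) * ((\<Sum>s<N. tilt W t (g s)) / N)^m"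
      by (subst avg_prod_seqs[OF N, of "\<lambda>_ s. tilt W t (g s)" m]) simp
    finally show ?thesis .
  qed
  have cross_avg: "(\<Sum>\<kappa>\<in>?C. \<Sum>y\<in>?Y. X \<kappa> w y * (X \<kappa> w' y / v0 y)) / card ?C = (mix_moment W N g)^m"
    if w': "w' \<in> {1..M}" "w' \<noteq> w" for w'
  proof -
    have "(\<Sum>\<kappa>\<in>?C. \<Sum>y\<in>?Y. X \<kappa> w y * (X \<kappa> w' y / v0 y)) / card ?C
      = (\<Sum>y\<in>?Y. (\<Sum>\<kappa>\<in>?C. X \<kappa> w y * X \<kappa> w' y) / card ?C / v0 y)"
      by (subst sum.swap) (simp add: sum_divide_distrib mult.commute)
    also have "\<dots> = (\<Sum>y\<in>?Y. (\<Prod>i<m. mix W N g (y ! i)) * (\<Prod>i<m. mix W N g (y ! i)) / v0 y)"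
      unfolding X_def codebooks_def
      using PiE_avg2[of "{1..M}" w w' ?A "\<lambda>a. chn W (map g a) y" "\<lambda>a. chn W (map g a) y" for y] w w' A
      by (simp add: avg_chn[OF N])
    also have "\<dots> = (\<Sum>y\<in>?Y. \<Prod>i<m. (mix W N g (y ! i))^2 / W 0 (y ! i))"
      by (simp add: v0_def prod_dividef prod.distrib power2_eq_square)
    also have "\<dots> = (mix_moment W N g)^m"
      by (subst sum_seqs_prod) simp
    finally show ?thesis .
  qed
  have cross0: "0 \<le> (mix_moment W N g)^m"
    by (intro zero_le_power[of "sum _ _"] sum_nonneg divide_nonneg_nonneg zero_le_power2 stoch_nonneg[OF st])
        simp
  have "(\<Sum>\<kappa>\<in>?C. word_error W m (map g (\<kappa> w)) (threshold_dec W m \<gamma> M g \<kappa>) w) / card ?C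
    \<le> (\<Sum>\<kappa>\<in>?C. miss (\<kappa> w) + (\<Sum>w'\<in>{1..M} - {w}. \<Sum>y\<in>?Y. exp (- \<gamma>) * (X \<kappa> w y * (X \<kappa> w' y / v0 y)))) / card ?C"
    using err by (intro divide_right_mono sum_mono) auto
  also have "\<dots> = (\<Sum>\<kappa>\<in>?C. miss (\<kappa> w)) / card ?C
     + (\<Sum>w'\<in>{1..M} - {w}. exp (- \<gamma>) * ((\<Sum>\<kappa>\<in>?C. \<Sum>y\<in>?Y. X \<kappa> w y * (X \<kappa> w' y / v0 y)) / card ?C))"
  proof -
    have "(\<Sum>\<kappa>\<in>?C. \<Sum>w'\<in>{1..M} - {w}. \<Sum>y\<in>?Y. exp (- \<gamma>) * (X \<kappa> w y * (X \<kappa> w' y / v0 y)))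
       = (\<Sum>w'\<in>{1..M} - {w}. exp (- \<gamma>) * (\<Sum>\<kappa>\<in>?C. \<Sum>y\<in>?Y. X \<kappa> w y * (X \<kappa> w' y / v0 y)))"
      by (subst sum.swap) (simp add: sum_distrib_left)
    then show ?thesis
      by (simp only: sum.distrib add_divide_distrib sum_divide_distrib[of _ "{1..M}
          - {w}"] times_divide_eq_right)
  qed
  also have "(\<Sum>w'\<in>{1..M} - {w}. exp (- \<gamma>) * ((\<Sum>\<kappa>\<in>?C. \<Sum>y\<in>?Y. X \<kappa> w y * (X \<kappa> w' y / v0 y)) / card ?C))
     = (\<Sum>w'\<in>{1..M} - {w}. exp (- \<gamma>) * (mix_moment W N g)^m)"
    by (intro sum.cong refl arg_cong2[where f = "(*)"] cross_avg) auto
  also have "\<dots> = real (card ({1..M} - {w})) * (exp (- \<gamma>) * (mix_moment W N g)^m)"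
    by simp
  finally have "(\<Sum>\<kappa>\<in>?C. word_error W m (map g (\<kappa> w)) (threshold_dec W m \<gamma> M g \<kappa>) w) / card ?C
    \<le> (\<Sum>\<kappa>\<in>?C. miss (\<kappa> w)) / card ?C + real (card ({1..M} - {w})) * (exp (- \<gamma>) * (mix_moment W N g)^m)" .
  moreover have "real (card ({1..M} - {w})) \<le> real M" using w by simp
  then have "real (card ({1..M} - {w})) * (exp (- \<gamma>) * (mix_moment W N g)^m)
     \<le> real M * (exp (- \<gamma>) * (mix_moment W N g)^m)"
    using cross0 by (intro mult_right_mono mult_nonneg_nonneg) auto
  ultimately show ?thesis using miss_avg by linarith
qed

section \<open>Code parameters\<close>

lemma symbol_map_exists:
  fixes b :: "nat \<Rightarrow> nat"
  assumes "(\<Sum>k=1..K. b k) \<le> N"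
  obtains g :: "nat \<Rightarrow> nat" where "\<And>t. t < N \<Longrightarrow> g t \<le> K"
    and "\<And>f :: nat \<Rightarrow> real. (\<Sum>t<N. f (g t)) = real N * f 0 + (\<Sum>k=1..K. real (b k) * (f k - f 0))"
proof -
  \<comment> \<open>\<open>b k\<close> copies of each nonzero symbol, padded with zeros to length
    \<open>N\<close>; the map \<open>g\<close> is lookup in this list.\<close>
  define xs where "xs = concat (map (\<lambda>k. replicate (b k) k) [1..<Suc K]) @ replicate (N - (\<Sum>k=1..K. b k)) 0"
  have s: "sum_list (map h [1..<Suc K]) = (\<Sum>k=1..K. h k)" for h :: "nat \<Rightarrow> 'a::comm_monoid_add"
    by (simp add: interv_sum_list_conv_sum_set_nat atLeastLessThanSuc_atLeastAtMost del: upt_Suc)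
  have len: "length xs = N"
    using assms s[of b] by (simp add: xs_def length_concat comp_def del: upt_Suc)
  have fs: "sum_list (map f (concat (map (\<lambda>k. replicate (b k) k) ks)))
      = sum_list (map (\<lambda>k. real (b k) * f k) ks)"
    for f :: "nat \<Rightarrow> real" and ks
    by (induction ks) (simp_all add: sum_list_replicate)
  have "(\<Sum>t<N. f (xs ! t)) = real N * f 0 + (\<Sum>k=1..K. real (b k) * (f k - f 0))" for f :: "nat \<Rightarrow> real"
  proof -
    have "(\<Sum>t<N. f (xs ! t)) = sum_list (map f xs)"
      by (simp add: sum_list_sum_nth len atLeast0LessThan)
    also have "\<dots> = (\<Sum>k=1..K. real (b k) * f k) + real (N - (\<Sum>k=1..K. b k)) * f 0"
      unfolding xs_def map_append sum_list_append fs s by (simp add: sum_list_replicate)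
    also have "real (N - (\<Sum>k=1..K. b k)) = real N - (\<Sum>k=1..K. real (b k))" using assms
        by (simp add: of_nat_diff)
    finally show ?thesis by (simp add: algebra_simps sum_subtractf sum_distrib_left)
  qed
  moreover have "xs ! t \<le> K" if "t < N" for t
  proof -
    have "xs ! t \<in> set xs" using that len by simp
    then show ?thesis by (auto simp: xs_def split: if_splits)
  qed
  ultimately show thesis by (intro that[of "\<lambda>t. xs ! t"]) auto
qed

text \<open>The capacity ratio is homogeneous of degree 0 in the input direction, so integer weights suffice; the
  input distributions built from them are exactly simulable by a uniform key.\<close>

lemma covert_cap_integer_approx:
  fixes W :: "nat \<Rightarrow> 'y::finite \<Rightarrow> real"
  assumes Q: "warden_ok K Q" and W: "ac_channel K W" and L: "0 \<le> L" "L < covert_cap K W Q"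
  obtains b :: "nat \<Rightarrow> nat" where "0 < chi_form K Q (\<lambda>k. real (b k))" "0 < weighted_relent K W (\<lambda>k. real (b k))"
    "L * sqrt (chi_form K Q (\<lambda>k. real (b k)) / 2) < weighted_relent K W (\<lambda>k. real (b k))"
proof -
  obtain p where p: "p \<in> prob_vecs K" "L < sqrt (2 * (weighted_relent K W p)^2 / chi_form K Q p)"
    using covert_cap_approx[OF Q W L(2)] by blast
  have p0: "\<And>k. k \<in> {1..K} \<Longrightarrow> 0 \<le> p k" using p by (auto simp: prob_vecs_def)
  obtain m where m: "0 < m" "\<And>p. p \<in> prob_vecs K \<Longrightarrow> m \<le> chi_form K Q p"
    using chi_form_lower_bound[OF Q] by blast
  have c: "0 < chi_form K Q p" using m(1) m(2)[OF p(1)] by simp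
  have D0: "0 \<le> weighted_relent K W p"
    unfolding weighted_relent_def using p0
        by (intro sum_nonneg mult_nonneg_nonneg ac_channel_relent(2)[OF W]) auto
  have "L * sqrt (chi_form K Q p / 2)
      < sqrt (2 * (weighted_relent K W p)^2 / chi_form K Q p) * sqrt (chi_form K Q p / 2)"
    using p(2) c by (intro mult_strict_right_mono) auto
  also have "\<dots> = weighted_relent K W p"
    unfolding real_sqrt_mult[symmetric] using c D0 by simp
  finally have lt: "L * sqrt (chi_form K Q p / 2) < weighted_relent K W p" .
  \<comment> \<open>\<open>j * p k\<close> rounded down to an integer, then divided by
    \<open>j\<close> again. Both functionals are continuous, so the strict inequality survives for
    some large \<open>j\<close>, and the numerators are the integer weights.\<close>
  define q where "q j k = real (nat \<lfloor>real j * p k\<rfloor>) / real j" for j k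
  have q: "(\<lambda>j. q j k) \<longlonglongrightarrow> p k" if "k \<in> {1..K}" for k
  proof (rule tendsto_sandwich)
    show "\<forall>\<^sub>F j in sequentially. p k - 1 / real j \<le> q j k"
      using eventually_gt_at_top[of 0]
    proof eventually_elim
      case (elim j)
      have "real j * p k - 1 \<le> real (nat \<lfloor>real j * p k\<rfloor>)" by linarith
      then have "(real j * p k - 1) / real j \<le> q j k" unfolding q_def by (intro divide_right_mono) auto
      then show ?case using elim by (simp add: diff_divide_distrib)
    qed
    show "\<forall>\<^sub>F j in sequentially. q j k \<le> p k"
      using eventually_gt_at_top[of 0]
    proof eventually_elim
      case (elim j)
      have "0 \<le> real j * p k" using p0[OF that] by simp
      then have "real (nat \<lfloor>real j * p k\<rfloor>) \<le> real j * p k" by linarith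
      then show ?case using elim by (simp add: q_def pos_divide_le_eq mult.commute)
    qed
    have "(\<lambda>j. p k - 1 / real j) \<longlonglongrightarrow> p k - 0" by (intro tendsto_diff tendsto_const lim_1_over_n)
    then show "(\<lambda>j. p k - 1 / real j) \<longlonglongrightarrow> p k" by simp
  qed simp
  have cq: "(\<lambda>j. chi_form K Q (q j)) \<longlonglongrightarrow> chi_form K Q p"
    unfolding chi_form_def using Q
    by (intro tendsto_sum tendsto_divide tendsto_power tendsto_mult q tendsto_const) (auto simp: warden_ok_def
        less_imp_neq[symmetric])
  have Dq: "(\<lambda>j. weighted_relent K W (q j)) \<longlonglongrightarrow> weighted_relent K W p"
    unfolding weighted_relent_def by (intro tendsto_sum tendsto_mult q tendsto_const)
  have "(\<lambda>j. weighted_relent K W (q j) - L * sqrt (chi_form K Q (q j) / 2)) \<longlonglongrightarrow> weighted_relent K W p - L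
      * sqrt (chi_form K Q p / 2)"
    by (intro tendsto_diff Dq tendsto_mult tendsto_const tendsto_real_sqrt tendsto_divide cq) simp
  then have "\<forall>\<^sub>F j in sequentially. 0 < weighted_relent K W (q j) - L * sqrt (chi_form K Q (q j) / 2)"
    by (rule order_tendstoD(1)) (use lt in simp)
  moreover have "\<forall>\<^sub>F j in sequentially. 0 < chi_form K Q (q j)" by (rule order_tendstoD(1)[OF cq c])
  ultimately have "\<forall>\<^sub>F j in sequentially. 0 < weighted_relent K W (q j) - L * sqrt (chi_form K Q (q j) / 2)
      \<and> 0 < chi_form K Q (q j) \<and> 0 < j"
    using eventually_gt_at_top[of 0] by eventually_elim simp
  then obtain j where j: "0 < weighted_relent K W (q j) - L * sqrt (chi_form K Q (q j) / 2)"
      "0 < chi_form K Q (q j)" "0 < j" using eventually_happens'[OF sequentially_bot] by blast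
  define b where "b k = nat \<lfloor>real j * p k\<rfloor>" for k
  have bq: "(\<lambda>k. real (b k)) = (\<lambda>k. real j * q j k)" using j(3) by (simp add: b_def q_def)
  have wb: "weighted_relent K W (\<lambda>k. real (b k)) = real j * weighted_relent K W (q j)"
    unfolding bq weighted_relent_def by (simp add: sum_distrib_left mult.assoc)
  have cb: "chi_form K Q (\<lambda>k. real (b k)) = (real j)^2 * chi_form K Q (q j)" unfolding bq
      by (rule chi_form_scale)
  have sb: "L * sqrt (chi_form K Q (\<lambda>k. real (b k)) / 2) = real j * (L * sqrt (chi_form K Q (q j) / 2))"
    unfolding cb by (simp add: real_sqrt_mult real_sqrt_divide)
  have lt': "L * sqrt (chi_form K Q (\<lambda>k. real (b k)) / 2) < weighted_relent K W (\<lambda>k. real (b k))"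
    unfolding sb wb using j by (intro mult_strict_left_mono) auto
  have "0 < chi_form K Q (\<lambda>k. real (b k))" unfolding cb using j by simp
  then show thesis using lt' L(1) by (intro that[of b]) (auto intro: order_le_less_trans[rotated])
qed

lemma mix_eq:
  fixes W :: "nat \<Rightarrow> 'y \<Rightarrow> real"
  assumes N: "1 \<le> N"
    and g: "\<And>f :: nat \<Rightarrow> real. (\<Sum>t<N. f (g t)) = real N * f 0 + (\<Sum>k=1..K. real (b k) * (f k - f 0))"
  shows "mix W N g y = W 0 y + (\<Sum>k=1..K. real (b k) * (W k y - W 0 y)) / N"
  using N g[of "\<lambda>x. W x y"] by (simp add: mix_def add_divide_distrib)

text \<open>The deviation of the mixture from \<open>W 0\<close> has total mass 0, so the cross term
  vanishes and the chi-squared term remains.\<close>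

lemma mix_second_moment:
  fixes W :: "nat \<Rightarrow> 'y::finite \<Rightarrow> real"
  assumes W: "ac_channel K W" and N: "1 \<le> N"
    and g: "\<And>f :: nat \<Rightarrow> real. (\<Sum>t<N. f (g t)) = real N * f 0 + (\<Sum>k=1..K. real (b k) * (f k - f 0))"
  shows "mix_moment W N g = 1 + chi_form K W (\<lambda>k. real (b k)) / (real N)^2"
proof -
  have st: "stoch K W" using W by (simp add: ac_channel_def)
  define S where "S y = (\<Sum>k=1..K. real (b k) * (W k y - W 0 y))" for y
  have pt: "(mix W N g y)^2 / W 0 y = W 0 y + 2 * (S y / N) + S y^2 / W 0 y / (real N)^2" for y
  proof (cases "W 0 y = 0")
    case True
    then have "S y = 0" unfolding S_def using W by (intro sum.neutral) (auto simp: ac_channel_def)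
    then show ?thesis using True by simp
  next
    case False
    then show ?thesis using N unfolding mix_eq[OF N g] S_def[symmetric]
      by (simp add: field_simps power2_eq_square)
  qed
  have "(\<Sum>y\<in>UNIV. S y) = (\<Sum>k=1..K. \<Sum>y\<in>UNIV. real (b k) * (W k y - W 0 y))" unfolding S_def by (rule sum.swap)
  also have "\<dots> = 0"
  proof (rule sum.neutral, rule ballI)
    fix k assume "k \<in> {1..K}"
    then show "(\<Sum>y\<in>UNIV. real (b k) * (W k y - W 0 y)) = 0"
      by (subst sum_distrib_left[symmetric]) (simp add: sum_subtractf stoch_sum[OF st])
  qed
  finally have S0: "(\<Sum>y\<in>UNIV. S y) = 0" .
  have "mix_moment W N g
     = (\<Sum>y\<in>UNIV. W 0 y) + 2 * ((\<Sum>y\<in>UNIV. S y) / N) + (\<Sum>y\<in>UNIV. S y^2 / W 0 y) / (real N)^2"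
    unfolding pt sum.distrib by (simp add: sum_divide_distrib sum_distrib_left)
  then show ?thesis unfolding S0 chi_form_def S_def[symmetric] by (simp add: stoch_sum[OF st])
qed

section \<open>Chernoff exponents for small tilts\<close>

lemma tilt_0: "stoch K W \<Longrightarrow> tilt W t 0 = 1"
proof -
  assume st: "stoch K W"
  have "W 0 y * exp (- t * ln (W 0 y / W 0 y)) = W 0 y" for y by (cases "W 0 y = 0") auto
  then show ?thesis unfolding tilt_def using stoch_sum[OF st, of 0] by (simp only:)
qed

lemma tilt_deriv:
  fixes W :: "nat \<Rightarrow> 'y::finite \<Rightarrow> real"
  assumes W: "ac_channel K W" and k: "k \<le> K"
  shows "((\<lambda>t. tilt W t k) has_real_derivative - relent (W k) (W 0) UNIV) (at 0)"
proof -
  have "((\<lambda>t. tilt W t k) has_real_derivative (\<Sum>y\<in>UNIV. W k y * (exp (- 0 * ln (W k y / W 0 y)) * (- ln (W k y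
      / W 0 y))))) (at 0)"
    unfolding tilt_def by (auto intro!: derivative_eq_intros simp: mult.commute)
  also have "(\<Sum>y\<in>UNIV. W k y * (exp (- 0 * ln (W k y / W 0 y)) * (- ln (W k y / W 0 y))))
      = - relent (W k) (W 0) UNIV"
    unfolding relent_def sum_negf[symmetric] by (intro sum.cong refl) simp
  finally show ?thesis .
qed

text \<open>The exponent vanishes at \<open>t = 0\<close> and has slope
  \<open>weighted_relent K W b\<close> there, so a sufficiently small positive tilt beats every
  smaller slope \<open>D\<close>.\<close>

lemma tilt_exponent:
  fixes W :: "nat \<Rightarrow> 'y::finite \<Rightarrow> real"
  assumes W: "ac_channel K W" and D: "D < weighted_relent K W b"
  obtains t where "0 < t" "t * D < (\<Sum>k=1..K. b k * (1 - tilt W t k))"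
proof -
  define E where "E t = (\<Sum>k=1..K. b k * (1 - tilt W t k))" for t
  have st: "stoch K W" using W by (simp add: ac_channel_def)
  have t0: "tilt W 0 k = 1" if "k \<le> K" for k unfolding tilt_def using stoch_sum[OF st that] by simp
  have "(E has_real_derivative (\<Sum>k=1..K. b k * (0 - (- relent (W k) (W 0) UNIV)))) (at 0)"
    unfolding E_def by (intro DERIV_sum DERIV_cmult DERIV_diff DERIV_const tilt_deriv[OF W]) auto
  then have "(E has_real_derivative weighted_relent K W b) (at 0)" by (simp add: weighted_relent_def)
  then have "((\<lambda>t. (E t - E 0) / (t - 0)) \<longlongrightarrow> weighted_relent K W b) (at 0)"
    by (simp add: has_field_derivative_iff)
  moreover have "E 0 = 0" unfolding E_def by (intro sum.neutral) (auto simp: t0)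
  ultimately have "((\<lambda>t. E t / t) \<longlongrightarrow> weighted_relent K W b) (at_right 0)"
    by (simp add: filterlim_at_split)
  then have "\<forall>\<^sub>F t in at_right 0. D < E t / t" using D by (rule order_tendstoD(1))
  then obtain c where c: "0 < c" "\<And>t. 0 < t \<Longrightarrow> t < c \<Longrightarrow> D < E t / t"
    unfolding eventually_at_right_field by auto
  have "D < E (c/2) / (c/2)" using c(1) by (intro c(2)) auto
  then have "(c/2) * D < E (c/2)" using c(1) by (simp add: field_simps)
  then show thesis using c(1) by (intro that[of "c/2"]) (auto simp: E_def)
qed

text \<open>The decoder \<open>d\<close> receives the codebook \<open>\<kappa>\<close>, which the
  key will reveal. The error is the ensemble average, and it is required for every message
  separately.\<close>

definition segment_code :: "nat \<Rightarrow> (nat \<Rightarrow> 'y::finite \<Rightarrow> real) \<Rightarrow> nat \<Rightarrow> nat \<Rightarrow> (nat \<Rightarrow> nat) \<Rightarrow> nat \<Rightarrow>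
    ((nat \<Rightarrow> nat list) \<Rightarrow> 'y list \<Rightarrow> nat) \<Rightarrow> real \<Rightarrow> bool" where
  "segment_code K W m N g M d e \<longleftrightarrow> 1 \<le> N \<and> 1 \<le> M \<and> (\<forall>t<N. g t \<le> K) \<and> (\<forall>\<kappa> y. d \<kappa> y \<in> {1..M}) \<and>
     (\<forall>w\<in>{1..M}. codebook_avg M N m (\<lambda>\<kappa>. word_error W m (map g (\<kappa> w)) (d \<kappa>) w) \<le> e)"

lemma exp_scaled_tendsto_0:
  assumes "x \<longlonglongrightarrow> l" "l < 0"
  shows "(\<lambda>n. exp (x n * sqrt (real n))) \<longlonglongrightarrow> 0"
  by (intro filterlim_compose[OF exp_at_bot] filterlim_tendsto_neg_mult_at_bot[OF assms]
      filterlim_compose[OF sqrt_at_top filterlim_real_sequentially])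

lemma mix_prob:
  assumes Q: "stoch K Q" and N: "1 \<le> N" and g: "\<And>t. t < N \<Longrightarrow> g t \<le> K"
  shows "0 \<le> mix Q N g z" "(\<Sum>z\<in>UNIV. mix Q N g z) = 1"
proof -
  show "0 \<le> mix Q N g z" unfolding mix_def using g
      by (intro divide_nonneg_nonneg sum_nonneg stoch_nonneg[OF Q]) auto
  have "(\<Sum>z\<in>UNIV. mix Q N g z) = (\<Sum>t<N. \<Sum>z\<in>UNIV. Q (g t) z) / N"
    unfolding mix_def sum_divide_distrib[symmetric] by (subst sum.swap) simp
  also have "\<dots> = 1" using g N by (simp add: stoch_sum[OF Q])
  finally show "(\<Sum>z\<in>UNIV. mix Q N g z) = 1" .
qed

text \<open>With \<open>N\<close> close to \<open>C * sqrt n\<close>, the information density of a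
  codeword is about \<open>\<theta> * D * sqrt n / C\<close> and the divergence about
  \<open>\<theta> * cQ / (2 * C^2)\<close>. Rate and covertness thus bound \<open>C\<close> from
  opposite sides, and the window is nonempty exactly because \<open>L / \<theta>\<close> lies below
  the ratio achieved by \<open>b\<close>.\<close>

lemma segment_code_exists_pos:
  fixes W :: "nat \<Rightarrow> 'y::finite \<Rightarrow> real" and Q :: "nat \<Rightarrow> 'z::finite \<Rightarrow> real" and m :: "nat \<Rightarrow> nat"
  assumes Q: "warden_ok K Q" and W: "ac_channel K W" and \<delta>: "0 < \<delta>" and L: "0 < L" "L < \<theta> * covert_cap K W Q"
    and \<theta>: "0 < \<theta>" and m: "\<And>n. m n \<le> n" "(\<lambda>n. real (m n) / real n) \<longlonglongrightarrow> \<theta>"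
  shows "\<exists>N g M d e. (\<forall>n. segment_code K W (m n) (N n) (g n) (M n) (d n) (e n)) \<and> e \<longlonglongrightarrow> 0 \<and>
     (\<forall>n. L * sqrt (real n * \<delta>) \<le> ln (real (M n))) \<and>
     (\<forall>\<^sub>F n in sequentially. real (m n) * relent (mix Q (N n) (g n)) (Q 0) UNIV \<le> \<theta> * \<delta>)"
proof -
  have stQ: "stoch K Q" and Q0: "\<And>z. 0 < Q 0 z" using Q by (auto simp: warden_ok_def)
  have stW: "stoch K W" using W by (simp add: ac_channel_def)
  have "L / \<theta> < covert_cap K W Q" using L \<theta> by (simp add: pos_divide_less_eq mult.commute)
  then obtain b :: "nat \<Rightarrow> nat" where chi: "0 < chi_form K Q (\<lambda>k. real (b k))"
    and b: "L / \<theta> * sqrt (chi_form K Q (\<lambda>k. real (b k)) / 2) < weighted_relent K W (\<lambda>k. real (b k))"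
    using covert_cap_integer_approx[OF Q W, of "L / \<theta>"] L \<theta> by (metis divide_nonneg_pos less_imp_le)
  define cQ where "cQ = chi_form K Q (\<lambda>k. real (b k))"
  define D where "D = weighted_relent K W (\<lambda>k. real (b k))"
  define cW where "cW = chi_form K W (\<lambda>k. real (b k))"
  have cW0: "0 \<le> cW" unfolding cW_def chi_form_def
      by (intro sum_nonneg divide_nonneg_nonneg stoch_nonneg[OF stW]) auto
  have Ls: "0 < L * sqrt \<delta>" using L \<delta> by simp
  have "sqrt (cQ / (2 * \<delta>)) < \<theta> * D / (L * sqrt \<delta>)"
  proof -
    have "sqrt (cQ / (2 * \<delta>)) * (L * sqrt \<delta>) = \<theta> * (L / \<theta> * sqrt (cQ / 2))"
      using \<delta> \<theta> by (simp add: real_sqrt_divide real_sqrt_mult field_simps)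
    also have "\<dots> < \<theta> * D" using b \<theta> unfolding cQ_def D_def by (intro mult_strict_left_mono)
    finally show ?thesis using Ls by (simp add: pos_less_divide_eq)
  qed
  \<comment> \<open>The lower bound keeps the limiting divergence strictly below
    \<open>\<theta> * \<delta>\<close>; the upper bound leaves more information than the rate
    \<open>L * sqrt \<delta>\<close> requires.\<close>
  then obtain C where C: "sqrt (cQ / (2 * \<delta>)) < C" "C < \<theta> * D / (L * sqrt \<delta>)" using dense by blast
  have C0: "0 < C" 
  proof (rule order_le_less_trans[OF _ C(1)])
    show "0 \<le> sqrt (cQ / (2 * \<delta>))" using chi \<delta> by (simp add: cQ_def)
  qed
  have Cchi: "cQ / (2 * C^2) < \<delta>"
  proof -
    have "(sqrt (cQ / (2 * \<delta>)))^2 < C^2" using C(1) chi \<delta> by (intro power_strict_mono) (auto simp: cQ_def)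
    then have "cQ / (2 * \<delta>) < C^2" using chi \<delta> by (simp add: cQ_def)
    then show ?thesis using C0 \<delta> by (simp add: field_simps)
  qed
  have "C * (L * sqrt \<delta>) / \<theta> < D" using C(2) Ls \<theta> by (simp add: field_simps)
  \<comment> \<open>\<open>D'\<close> leaves room for a Chernoff exponent below the full slope
    \<open>D\<close>. The threshold constant \<open>\<gamma>0\<close> chosen next separates the rate
    from the information still available.\<close>
  then obtain D' where D': "C * (L * sqrt \<delta>) / \<theta> < D'" "D' < D" using dense by blast
  have "L * sqrt \<delta> < \<theta> * D' / C" using D'(1) C0 \<theta> by (simp add: field_simps)
  then obtain \<gamma>0 where \<gamma>0: "L * sqrt \<delta> < \<gamma>0" "\<gamma>0 < \<theta> * D' / C" using dense by blast
  obtain t where t: "0 < t" "t * D' < (\<Sum>k=1..K. real (b k) * (1 - tilt W t k))"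
    using tilt_exponent[OF W D'(2)[unfolded D_def]] by blast
  define E where "E = (\<Sum>k=1..K. real (b k) * (1 - tilt W t k))"
  \<comment> \<open>The first argument of \<open>max\<close> guarantees room for all nonzero symbols
    and \<open>N n \<ge> 1\<close> when \<open>n\<close> is small; for large \<open>n\<close> the
    second dominates.\<close>
  define N where "N n = max (1 + (\<Sum>k=1..K. b k)) (nat \<lceil>C * sqrt (real n)\<rceil>)" for n
  have N1: "1 \<le> N n" and Nb: "(\<Sum>k=1..K. b k) \<le> N n" for n by (auto simp: N_def)
  have Npos: "0 < real (N n)" for n using N1[of n] by simp
  have NC: "C * sqrt (real n) \<le> real (N n)" for n unfolding N_def by (simp add: le_max_iff_disj) linarith
  have "\<forall>n. \<exists>g. (\<forall>t<N n. g t \<le> K) \<and>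
     (\<forall>f :: nat \<Rightarrow> real. (\<Sum>t<N n. f (g t)) = real (N n) * f 0 + (\<Sum>k=1..K. real (b k) * (f k - f 0)))"
    using symbol_map_exists[OF Nb] by metis
  then obtain g where "\<forall>n. (\<forall>t<N n. g n t \<le> K) \<and>
     (\<forall>f :: nat \<Rightarrow> real. (\<Sum>t<N n. f (g n t)) = real (N n) * f 0 + (\<Sum>k=1..K. real (b k) * (f k - f 0)))"
    by (rule choice[THEN exE])
  then have g1: "\<And>n t. t < N n \<Longrightarrow> g n t \<le> K"
    and g2: "\<And>n (f :: nat \<Rightarrow> real). (\<Sum>t<N n. f (g n t)) = real (N n) * f 0 + (\<Sum>k=1..K. real (b k) * (f k - f 0))"
    by auto
  define M where "M n = nat \<lceil>exp (L * sqrt (real n * \<delta>))\<rceil>" for n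
  have Mge: "exp (L * sqrt (real n * \<delta>)) \<le> real (M n)" for n unfolding M_def by linarith
  have M1: "1 \<le> M n" for n
  proof -
    have "0 < real (M n)" using Mge[of n] by (rule less_le_trans[OF exp_gt_zero])
    then show ?thesis by simp
  qed
  have Mle: "real (M n) \<le> 2 * exp (L * sqrt (real n * \<delta>))" for n
  proof -
    have "1 \<le> exp (L * sqrt (real n * \<delta>))" using L \<delta> by simp
    then show ?thesis unfolding M_def by linarith
  qed
  define \<gamma> where "\<gamma> n = \<gamma>0 * sqrt (real n)" for n
  \<comment> \<open>The first summand bounds the missed word, the second the false acceptances. Its
    factor 2 comes from rounding up the number of messages, and \<open>exp (cW / C^2)\<close> is the
    bounded price of testing against the no-input law.\<close>
  define e where "e n = exp ((t * \<gamma>0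
      - (real (m n) / real n) * (sqrt (real n) / real (N n)) * E) * sqrt (real n))
     + 2 * exp (cW / C^2) * exp ((L * sqrt \<delta> - \<gamma>0) * sqrt (real n))" for n
  have seg: "segment_code K W (m n) (N n) (g n) (M n) (threshold_dec W (m n) (\<gamma> n) (M n) (g n)) (e n)" for n
    unfolding segment_code_def
  proof (intro conjI allI impI ballI)
    fix w assume w: "w \<in> {1..M n}"
    have "codebook_avg (M n) (N n) (m n) (\<lambda>\<kappa>. word_error W (m n) (map (g n) (\<kappa> w)) (threshold_dec W (m n) (\<gamma> n)
        (M n) (g n) \<kappa>) w)
      \<le> exp (t * \<gamma> n) * ((\<Sum>s<N n. tilt W t (g n s)) / N n)^(m n)
        + real (M n) * (exp (- \<gamma> n) * (mix_moment W (N n) (g n))^(m n))"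
      using t(1) by (intro ensemble_error[OF W _ N1 g1 w]) auto
    also have "\<dots> \<le> e n"
      unfolding e_def
    proof (rule add_mono)
      have av: "(\<Sum>s<N n. tilt W t (g n s)) / N n = 1 - E / N n"
        unfolding g2[where f = "tilt W t"] tilt_0[OF stW] E_def using Npos[of n]
        by (simp add: add_divide_distrib sum_subtractf right_diff_distrib diff_divide_distrib)
      have av0: "0 \<le> (\<Sum>s<N n. tilt W t (g n s)) / N n"
        unfolding tilt_def using g1
            by (intro divide_nonneg_nonneg sum_nonneg mult_nonneg_nonneg stoch_nonneg[OF stW]) auto
      have "((\<Sum>s<N n. tilt W t (g n s)) / N n)^(m n) \<le> (exp (- E / N n))^(m n)"
        using exp_ge_add_one_self[of "- E / N n"] av av0 by (intro power_mono) auto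
      also have "\<dots> = exp (- (real (m n) * E / N n))" by (simp flip: exp_of_nat_mult)
      finally have "exp (t * \<gamma> n) * ((\<Sum>s<N n. tilt W t (g n s)) / N n)^(m n)
          \<le> exp (t * \<gamma> n) * exp (- (real (m n) * E / N n))"
        by (intro mult_left_mono) auto
      also have "\<dots> = exp ((t * \<gamma>0 - (real (m n) / real n) * (sqrt (real n) / real (N n)) * E) * sqrt (real n))"
      proof -
        have "real (m n) / real n * (sqrt (real n) * sqrt (real n)) = real (m n)"
          using m(1)[of n] by (cases "n = 0") (auto simp: real_sqrt_mult_self)
        moreover have "(real (m n) / real n) * (sqrt (real n) / real (N n)) * E * sqrt (real n)
            = (real (m n) / real n * (sqrt (real n) * sqrt (real n))) * (E / N n)" by (simp add: mult_ac)
        ultimately have "real (m n) * E / N n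
            = (real (m n) / real n) * (sqrt (real n) / real (N n)) * E * sqrt (real n)"
          by simp
        then show ?thesis by (simp add: \<gamma>_def algebra_simps flip: exp_add)
      qed
      finally show "exp (t * \<gamma> n) * ((\<Sum>s<N n. tilt W t (g n s)) / N n)^(m n) \<le> \<dots>" .
    next
      have "(1 + cW / (real (N n))^2)^(m n) \<le> (exp (cW / (real (N n))^2))^(m n)"
        using cW0 by (intro power_mono exp_ge_add_one_self) auto
      also have "\<dots> = exp (real (m n) * (cW / (real (N n))^2))" by (simp flip: exp_of_nat_mult)
      also have "\<dots> \<le> exp (cW / C^2)"
      proof -
        have "C^2 * real (m n) \<le> C^2 * real n" using m(1)[of n] by (intro mult_left_mono) auto
        also have "\<dots> = (C * sqrt (real n))^2" by (simp add: power_mult_distrib)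
        also have "\<dots> \<le> (real (N n))^2" using NC[of n] C0 by (intro power_mono) auto
        finally have "cW * (C^2 * real (m n)) \<le> cW * (real (N n))^2" using cW0 by (intro mult_left_mono)
        then show ?thesis using C0 Npos[of n] by (simp add: field_simps)
      qed
      finally have p: "(mix_moment W (N n) (g n))^(m n) \<le> exp (cW / C^2)"
        unfolding mix_second_moment[OF W N1 g2] cW_def .
      have "real (M n) * (exp (- \<gamma> n) * (mix_moment W (N n) (g n))^(m n))
        \<le> (2 * exp (L * sqrt (real n * \<delta>))) * (exp (- \<gamma> n) * exp (cW / C^2))"
        using Mle[of n] p cW0 unfolding mix_second_moment[OF W N1 g2] cW_def[symmetric]
        by (intro mult_mono) (auto intro!: mult_nonneg_nonneg zero_le_power add_nonneg_nonneg)
      also have "\<dots> = 2 * exp (cW / C^2) * (exp (L * sqrt (real n * \<delta>)) * exp (- \<gamma> n))" by simp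
      also have "exp (L * sqrt (real n * \<delta>)) * exp (- \<gamma> n) = exp ((L * sqrt \<delta> - \<gamma>0) * sqrt (real n))"
        by (simp add: \<gamma>_def real_sqrt_mult algebra_simps flip: exp_add)
      finally show "real (M n) * (exp (- \<gamma> n) * (mix_moment W (N n) (g n))^(m n))
        \<le> 2 * exp (cW / C^2) * exp ((L * sqrt \<delta> - \<gamma>0) * sqrt (real n))" .
    qed
    finally show "codebook_avg (M n) (N n) (m n) (\<lambda>\<kappa>. word_error W (m n) (map (g n) (\<kappa> w)) (threshold_dec W (m
        n) (\<gamma> n) (M n) (g n) \<kappa>) w) \<le> e n" .
  qed (rule N1 M1 g1 threshold_dec_range[OF M1] | assumption)+
  have sqN: "(\<lambda>n. real (N n) / sqrt (real n)) \<longlonglongrightarrow> C"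
  proof (rule tendsto_sandwich)
    show "\<forall>\<^sub>F n in sequentially. C \<le> real (N n) / sqrt (real n)"
      using eventually_gt_at_top[of 0] by eventually_elim (use NC in \<open>simp add: pos_le_divide_eq\<close>)
    have up: "real (N n) \<le> C * sqrt (real n) + (2 + real (\<Sum>k=1..K. b k))" for n
    proof -
      have "real (nat \<lceil>C * sqrt (real n)\<rceil>) \<le> C * sqrt (real n) + 1"
        using C0 by (simp add: of_nat_nat)
      moreover have "0 \<le> C * sqrt (real n)" using C0 by simp
      moreover have "N n \<le> 1 + (\<Sum>k=1..K. b k) + nat \<lceil>C * sqrt (real n)\<rceil>"
        unfolding N_def by (rule max.boundedI) linarith+
      then have "real (N n) \<le> real (1 + (\<Sum>k=1..K. b k) + nat \<lceil>C * sqrt (real n)\<rceil>)" by (simp only: of_nat_le_iff)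
      then have "real (N n) \<le> 1 + real (\<Sum>k=1..K. b k) + real (nat \<lceil>C * sqrt (real n)\<rceil>)"
        by (simp only: of_nat_add of_nat_1)
      ultimately show ?thesis by linarith
    qed
    show "\<forall>\<^sub>F n in sequentially. real (N n) / sqrt (real n) \<le> C + (2 + real (\<Sum>k=1..K. b k)) / sqrt (real n)"
      using eventually_gt_at_top[of 0]
    proof eventually_elim
      case (elim n)
      have "real (N n) / sqrt (real n) \<le> (C * sqrt (real n) + (2 + real (\<Sum>k=1..K. b k))) / sqrt (real n)"
        by (intro divide_right_mono up) simp
      then show ?case using elim by (simp add: add_divide_distrib)
    qed
    have "(\<lambda>n. C + (2 + real (\<Sum>k=1..K. b k)) / sqrt (real n)) \<longlonglongrightarrow> C + 0"
      by (intro tendsto_add tendsto_const tendsto_divide_0[OF tendsto_const] filterlim_at_top_imp_at_infinity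
          filterlim_compose[OF sqrt_at_top filterlim_real_sequentially])
    then show "(\<lambda>n. C + (2 + real (\<Sum>k=1..K. b k)) / sqrt (real n)) \<longlonglongrightarrow> C" by simp
  qed simp
  have "(\<lambda>n. inverse (real (N n) / sqrt (real n))) \<longlonglongrightarrow> inverse C" by (intro tendsto_inverse sqN) (use C0 in simp)
  then have Nsq: "(\<lambda>n. sqrt (real n) / real (N n)) \<longlonglongrightarrow> 1 / C" by (simp add: inverse_eq_divide)
  have e0: "e \<longlonglongrightarrow> 0"
  proof -
    have "(\<lambda>n. t * \<gamma>0 - (real (m n) / real n) * (sqrt (real n) / real (N n)) * E) \<longlonglongrightarrow> t * \<gamma>0 - \<theta> * (1 / C) * E"
      by (intro tendsto_intros m(2) Nsq)
    moreover have "t * \<gamma>0 - \<theta> * (1 / C) * E < 0"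
    proof -
      have "t * \<gamma>0 < t * (\<theta> * D' / C)" using \<gamma>0(2) t(1) by (intro mult_strict_left_mono)
      also have "\<dots> = (\<theta> / C) * (t * D')" by simp
      also have "\<dots> \<le> (\<theta> / C) * E" using t(2) \<theta> C0 unfolding E_def by (intro mult_left_mono) auto
      finally show ?thesis by simp
    qed
    ultimately have 1: "(\<lambda>n. exp ((t * \<gamma>0
        - (real (m n) / real n) * (sqrt (real n) / real (N n)) * E) * sqrt (real n))) \<longlonglongrightarrow> 0"
      by (rule exp_scaled_tendsto_0)
    have 2: "(\<lambda>n. exp ((L * sqrt \<delta> - \<gamma>0) * sqrt (real n))) \<longlonglongrightarrow> 0"
      by (rule exp_scaled_tendsto_0[OF tendsto_const]) (use \<gamma>0 in simp)
    have "e \<longlonglongrightarrow> 0 + 2 * exp (cW / C^2) * 0" unfolding e_def[abs_def]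
        by (intro tendsto_add 1 tendsto_mult tendsto_const 2)
    then show ?thesis by simp
  qed
  have rate: "L * sqrt (real n * \<delta>) \<le> ln (real (M n))" for n
    using Mge[of n] M1[of n] by (subst ln_ge_iff) auto
  have cov: "\<forall>\<^sub>F n in sequentially. real (m n) * relent (mix Q (N n) (g n)) (Q 0) UNIV \<le> \<theta> * \<delta>"
  proof -
    define S where "S z = (\<Sum>k=1..K. real (b k) * (Q k z - Q 0 z))" for z
    \<comment> \<open>A bound on \<open>\<bar>S z\<bar> / Q 0 z\<close> over all \<open>z\<close>,
      so that the likelihood ratios deviate from 1 by at most \<open>U / N n\<close> and the
      second-order expansion applies.\<close>
    define U where "U = (\<Sum>z\<in>UNIV. \<bar>S z\<bar> / Q 0 z)"
    have mixS: "mix Q (N n) (g n) z = Q 0 z + S z / N n" for n z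
      unfolding mix_eq[OF N1 g2] S_def ..
    have u: "\<bar>mix Q (N n) (g n) z / Q 0 z - 1\<bar> \<le> U / N n" for n z
    proof -
      have "mix Q (N n) (g n) z / Q 0 z - 1 = S z / Q 0 z / N n"
        unfolding mixS using Q0[of z] by (simp add: add_divide_distrib)
      then have "\<bar>mix Q (N n) (g n) z / Q 0 z - 1\<bar> = \<bar>S z\<bar> / Q 0 z / N n" using Q0[of z] by simp
      also have "\<dots> \<le> U / N n"
        unfolding U_def using Q0 by (intro divide_right_mono member_le_sum) (auto simp: less_imp_le)
      finally show ?thesis .
    qed
    have chi2: "chi2 (mix Q (N n) (g n)) (Q 0) = cQ / (real (N n))^2" for n
      unfolding chi2_def mixS cQ_def chi_form_def S_def[symmetric] sum_divide_distrib
      by (intro sum.cong refl) (simp add: power_divide)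
    have inv: "(\<lambda>n. 1 / real (N n)) \<longlonglongrightarrow> 0"
    proof -
      have "(\<lambda>n. (sqrt (real n) / real (N n)) * (1 / sqrt (real n))) \<longlonglongrightarrow> 1 / C * 0"
        by (intro tendsto_mult Nsq tendsto_divide_0[OF tendsto_const] filterlim_at_top_imp_at_infinity
          filterlim_compose[OF sqrt_at_top filterlim_real_sequentially])
      moreover have "\<forall>\<^sub>F n in sequentially. (sqrt (real n) / real (N n)) * (1 / sqrt (real n)) = 1 / real (N n)"
        using eventually_gt_at_top[of 0] by eventually_elim simp
      ultimately show ?thesis by (simp add: tendsto_cong)
    qed
    have "(\<lambda>n. U * (1 / real (N n))) \<longlonglongrightarrow> U * 0" by (intro tendsto_mult tendsto_const inv)
    then have Un: "(\<lambda>n. U / real (N n)) \<longlonglongrightarrow> 0" by simp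
    have "(\<lambda>n. (real (m n) / real n) * (cQ / 2 * (sqrt (real n) / real (N n))^2 * (1 + U / real (N n)))) \<longlonglongrightarrow> \<theta>
        * (cQ / 2 * (1 / C)^2 * (1 + 0))"
      by (intro tendsto_mult m(2) tendsto_const tendsto_power Nsq tendsto_add Un)
    moreover have "\<theta> * (cQ / 2 * (1 / C)^2 * (1 + 0)) < \<theta> * \<delta>"
      using Cchi \<theta> by (intro mult_strict_left_mono) (auto simp: power_divide)
    ultimately have "\<forall>\<^sub>F n in sequentially. (real (m n) / real n)
        * (cQ / 2 * (sqrt (real n) / real (N n))^2 * (1 + U / real (N n))) < \<theta> * \<delta>"
      by (rule order_tendstoD(2))
    moreover have "\<forall>\<^sub>F n in sequentially. U / real (N n) < 1/2" using Un by (rule order_tendstoD(2)) simp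
    ultimately show ?thesis using eventually_gt_at_top[of 0]
    proof eventually_elim
      case (elim n)
      have "relent (mix Q (N n) (g n)) (Q 0) UNIV \<le> chi2 (mix Q (N n) (g n)) (Q 0) / 2 * (1 + U / N n)"
        using elim by (intro relent_chi2_bounds(2)[OF Q0 stoch_sum[OF stQ] mix_prob(2)[OF stQ N1 g1] u]) auto
      then have "real (m n) * relent (mix Q (N n) (g n)) (Q 0) UNIV
          \<le> real (m n) * (cQ / (real (N n))^2 / 2 * (1 + U / N n))"
        unfolding chi2 by (intro mult_left_mono) auto
      also have "\<dots> = (real (m n) / real n) * (cQ / 2 * (sqrt (real n) / real (N n))^2 * (1 + U / real (N n)))"
        using elim by (simp add: power_divide)
      finally show ?case using elim by linarith
    qed
  qed
  show ?thesis
    by (intro exI[of _ N] exI[of _ g] exI[of _ M] exI[of _ "\<lambda>n. threshold_dec W (m n) (\<gamma> n) (M n) (g n)"]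
        exI[of _ e])
       (use seg e0 rate cov in blast)
qed

text \<open>A user with rate 0 gets one message and the all-zero word, which causes no divergence.
  This also covers segments of vanishing fraction and users of zero capacity.\<close>

lemma segment_code_exists:
  fixes W :: "nat \<Rightarrow> 'y::finite \<Rightarrow> real" and Q :: "nat \<Rightarrow> 'z::finite \<Rightarrow> real" and m :: "nat \<Rightarrow> nat"
  assumes Q: "warden_ok K Q" and W: "ac_channel K W" and \<delta>: "0 < \<delta>" and \<theta>: "0 \<le> \<theta>"
    and L: "L = 0 \<or> 0 < L \<and> L < \<theta> * covert_cap K W Q"
    and m: "\<And>n. m n \<le> n" "(\<lambda>n. real (m n) / real n) \<longlonglongrightarrow> \<theta>"
  shows "\<exists>N g M d e. (\<forall>n. segment_code K W (m n) (N n) (g n) (M n) (d n) (e n)) \<and> e \<longlonglongrightarrow> 0 \<and>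
     (\<forall>n. L * sqrt (real n * \<delta>) \<le> ln (real (M n))) \<and>
     (\<forall>\<^sub>F n in sequentially. real (m n) * relent (mix Q (N n) (g n)) (Q 0) UNIV \<le> \<theta> * \<delta>)"
proof (cases "L = 0")
  case True
  have "segment_code K W (m n) 1 (\<lambda>_. 0) 1 (\<lambda>_ _. 1) 0" for n
    by (auto simp: segment_code_def word_error_def)
  moreover have "relent (mix Q 1 (\<lambda>_. 0)) (Q 0) UNIV = 0"
    by (auto simp: relent_def mix_def intro!: sum.neutral)
  ultimately show ?thesis using True \<theta> \<delta>
    by (intro exI[of _ "\<lambda>_. 1"] exI[of _ "\<lambda>_ _. 0"] exI[of _ "\<lambda>_ _ _. 1"] exI[of _ "\<lambda>_. 0"]) auto
next
  case False
  then have L': "0 < L" "L < \<theta> * covert_cap K W Q" using L by auto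
  then have "0 < \<theta>" using \<theta> by (cases "\<theta> = 0") auto
  then show ?thesis by (intro segment_code_exists_pos[OF Q W \<delta> L'] m)
qed

section \<open>Time sharing\<close>

text \<open>A decoder that reads only its own segment sees an error that does not depend on what is
  sent in the other, since the other output sums to 1.\<close>

lemma word_error_append:
  assumes W: "stoch K W" and x1: "x1 \<in> seqs {0..K} m1" and x2: "x2 \<in> seqs {0..K} m2"
  shows "word_error W (m1 + m2) (x1 @ x2) (\<lambda>y. d (take m1 y)) w = word_error W m1 x1 d w"
    and "word_error W (m1 + m2) (x1 @ x2) (\<lambda>y. d (drop m1 y)) w = word_error W m2 x2 d w"
proof -
  have split: "(\<Sum>ys\<in>seqs UNIV (m1 + m2). chn W (x1 @ x2) ys * f (take m1 ys) (drop m1 ys))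
    = (\<Sum>u\<in>seqs UNIV m1. \<Sum>v\<in>seqs UNIV m2. chn W x1 u * chn W x2 v * f u v)" for f
    unfolding sum_seqs_append
    by (intro sum.cong refl) (simp add: length_seqs length_seqs[OF x1] chn_append)
  show "word_error W (m1 + m2) (x1 @ x2) (\<lambda>y. d (take m1 y)) w = word_error W m1 x1 d w"
    unfolding word_error_def split[of "\<lambda>u v. if d u \<noteq> w then 1 else 0"]
  proof (intro sum.cong refl)
    fix u
    have "(\<Sum>v\<in>seqs UNIV m2. chn W x1 u * chn W x2 v * (if d u \<noteq> w then 1 else 0))
      = (chn W x1 u * (if d u \<noteq> w then 1 else 0)) * (\<Sum>v\<in>seqs UNIV m2. chn W x2 v)"
      by (simp add: sum_distrib_left mult_ac)
    then show "(\<Sum>v\<in>seqs UNIV m2. chn W x1 u * chn W x2 v * (if d u \<noteq> w then 1 else 0))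
        = chn W x1 u * (if d u \<noteq> w then 1 else 0)"
      by (simp add: sum_chn[OF W x2])
  qed
  have "(\<Sum>u\<in>seqs UNIV m1. \<Sum>v\<in>seqs UNIV m2. chn W x1 u * chn W x2 v * (if d v \<noteq> w then 1 else 0))
    = (\<Sum>u\<in>seqs UNIV m1. chn W x1 u) * (\<Sum>v\<in>seqs UNIV m2. chn W x2 v * (if d v \<noteq> w then 1 else 0))"
    by (simp add: sum_product mult.assoc)
  then show "word_error W (m1 + m2) (x1 @ x2) (\<lambda>y. d (drop m1 y)) w = word_error W m2 x2 d w"
    unfolding word_error_def split[of "\<lambda>u v. if d v \<noteq> w then 1 else 0"] by (simp add: sum_chn[OF W x1])
qed

lemma relent_cong: "(\<And>a. a \<in> A \<Longrightarrow> f a = f' a) \<Longrightarrow> relent f g A = relent f' g A"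
  unfolding relent_def by (intro sum.cong) auto

text \<open>The three laws are the rows of an artificial channel \<open>X\<close>, and the two-block
  product law is its output for a fixed word of \<open>m1\<close> ones and \<open>m2\<close> twos.
  The additivity of relative entropy already shown for channel words then applies.\<close>

lemma relent_two_blocks:
  fixes q R1 R2 :: "'z::finite \<Rightarrow> real"
  assumes q: "\<And>z. 0 < q z" "(\<Sum>z\<in>UNIV. q z) = 1"
    and R1: "\<And>z. 0 \<le> R1 z" "(\<Sum>z\<in>UNIV. R1 z) = 1" and R2: "\<And>z. 0 \<le> R2 z" "(\<Sum>z\<in>UNIV. R2 z) = 1"
  shows "relent (\<lambda>zs. (\<Prod>i<m1. R1 (take m1 zs ! i)) * (\<Prod>i<m2. R2 (drop m1 zs ! i))) (\<lambda>zs. \<Prod>i<m1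
      + m2. q (zs ! i)) (seqs UNIV (m1 + m2))
    = real m1 * relent R1 q UNIV + real m2 * relent R2 q UNIV"
proof -
  define X where "X x = (if x = 0 then q else if x = 1 then R1 else R2)" for x :: nat
  define xs :: "nat list" where "xs = replicate m1 1 @ replicate m2 2"
  let ?n = "m1 + m2"
  have X: "ac_channel 2 X"
    unfolding ac_channel_def stoch_def X_def using assms less_imp_neq[OF q(1)] by (auto simp: less_imp_le)
  have st: "stoch 2 X" using X by (simp add: ac_channel_def)
  have xs: "xs \<in> seqs {0..2} ?n" by (auto simp: xs_def seqs_def)
  have f: "(\<Prod>i<m1. R1 (take m1 zs ! i)) * (\<Prod>i<m2. R2 (drop m1 zs ! i)) = chn X xs zs"
      if zs: "zs \<in> seqs UNIV ?n" for zs
  proof -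
    have "chn X xs zs = chn X (replicate m1 1) (take m1 zs) * chn X (replicate m2 2) (drop m1 zs)"
      using chn_append[of "take m1 zs" "replicate m1 1" X "replicate m2 2" "drop m1 zs"] length_seqs[OF zs]
      by (simp add: xs_def)
    then show ?thesis by (simp add: chn_def X_def)
  qed
  have pos: "0 < (\<Prod>i<?n. q (zs ! i))" for zs using q by (intro prod_pos) auto
  have "relent (\<lambda>zs. (\<Prod>i<m1. R1 (take m1 zs ! i)) * (\<Prod>i<m2. R2 (drop m1 zs ! i))) (\<lambda>zs. \<Prod>i<?n. q (zs !
      i)) (seqs UNIV ?n)
    = relent (chn X xs) (\<lambda>zs. \<Prod>i<?n. q (zs ! i)) (seqs UNIV ?n)"
    by (rule relent_cong[OF f])
  also have "\<dots> = (\<Sum>zs\<in>seqs UNIV ?n. chn X xs zs * ln (chn X xs zs))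
      - (\<Sum>zs\<in>seqs UNIV ?n. chn X xs zs * ln (\<Prod>i<?n. q (zs ! i)))"
    using pos by (intro relent_eq chn_nonneg[OF st xs]) (auto simp: less_imp_le less_imp_neq[symmetric])
  also have "\<dots> = (\<Sum>i<?n. relent (X (xs ! i)) (X 0) UNIV)"
    using relent_chn[OF X xs] by (simp add: X_def)
  also have "\<dots> = sum_list (map (\<lambda>x. relent (X x) (X 0) UNIV) xs)"
    by (simp add: sum_list_sum_nth length_seqs[OF xs] atLeast0LessThan)
  also have "\<dots> = real m1 * relent R1 q UNIV + real m2 * relent R2 q UNIV"
    by (simp add: xs_def X_def sum_list_replicate)
  finally show ?thesis .
qed

text \<open>The key is a numbering of all pairs of codebooks. For each fixed message pair, averaging
  over the key alone already produces the two-block product law, so the covertness is an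
  equality.\<close>

lemma time_sharing_code:
  fixes P :: "nat \<Rightarrow> 'y1::finite \<Rightarrow> 'y2::finite \<Rightarrow> 'z::finite \<Rightarrow> real"
  assumes P: "bc_channel K P" and Q0: "\<And>z. 0 < chanQ P 0 z"
    and s1: "segment_code K (chanW P) m1 N1 g1 M1 d1 e1" and s2: "segment_code K (chanV P) m2 N2 g2 M2 d2 e2"
  shows "\<exists>Kn enc dec1 dec2. is_code K (m1 + m2) M1 M2 Kn enc dec1 dec2 \<and>
     code_error P (m1 + m2) M1 M2 Kn enc dec1 dec2 \<le> e1 + e2 \<and>
     covertness P (m1 + m2) M1 M2 Kn enc
       = real m1 * relent (mix (chanQ P) N1 g1) (chanQ P 0) UNIV + real m2 * relent (mix (chanQ P) N2 g2)
           (chanQ P 0) UNIV"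
proof -
  let ?C1 = "codebooks M1 N1 m1" and ?C2 = "codebooks M2 N2 m2"
  have N: "1 \<le> N1" "1 \<le> N2" and M: "1 \<le> M1" "1 \<le> M2" and g: "\<And>t. t < N1 \<Longrightarrow> g1 t \<le> K" "\<And>t. t < N2 \<Longrightarrow> g2 t \<le> K"
    and d: "\<And>\<kappa> y. d1 \<kappa> y \<in> {1..M1}" "\<And>\<kappa> y. d2 \<kappa> y \<in> {1..M2}"
    using s1 s2 by (auto simp: segment_code_def)
  have E1: "\<And>w. w \<in> {1..M1} \<Longrightarrow> (\<Sum>\<kappa>\<in>?C1. word_error (chanW P) m1 (map g1 (\<kappa> w)) (d1 \<kappa>) w) / card ?C1 \<le> e1"
    using s1 unfolding segment_code_def by blast
  have E2: "\<And>w. w \<in> {1..M2} \<Longrightarrow> (\<Sum>\<kappa>\<in>?C2. word_error (chanV P) m2 (map g2 (\<kappa> w)) (d2 \<kappa>) w) / card ?C2 \<le> e2"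
    using s2 unfolding segment_code_def by blast
  have c1: "0 < real (card ?C1)" and c2: "0 < real (card ?C2)"
    using finite_codebooks codebooks_nonempty[OF N(1)] codebooks_nonempty[OF N(2)] by (auto simp: card_gt_0_iff)
  define Kn where "Kn = card (?C1 \<times> ?C2)"
  have KnR: "real Kn = real (card ?C1) * real (card ?C2)" by (simp add: Kn_def card_cartesian_product)
  then have Kn0: "0 < real Kn" using c1 c2 by simp
  obtain h where h: "bij_betw h {1..Kn} (?C1 \<times> ?C2)"
    using ex_bij_betw_nat_finite_1[of "?C1 \<times> ?C2"] finite_codebooks unfolding Kn_def by blast
  have hin: "fst (h s) \<in> ?C1" "snd (h s) \<in> ?C2" if "s \<in> {1..Kn}" for s
    using bij_betwE[OF h] that by (auto simp: mem_Times_iff)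
  have avg: "(\<Sum>s=1..Kn. F (fst (h s)) (snd (h s))) / Kn = (\<Sum>\<kappa>1\<in>?C1. \<Sum>\<kappa>2\<in>?C2. F \<kappa>1 \<kappa>2) / (card ?C1 * card ?C2)"
      for F :: "_ \<Rightarrow> _ \<Rightarrow> real"
    using sum.reindex_bij_betw[OF h, of "\<lambda>k. F (fst k) (snd k)"]
    by (simp add: KnR sum.cartesian_product case_prod_unfold)
  define enc where "enc w1 w2 s = map g1 (fst (h s) w1) @ map g2 (snd (h s) w2)" for w1 w2 s
  define dec1 where "dec1 y s = d1 (fst (h s)) (take m1 y)" for y s
  define dec2 where "dec2 y s = d2 (snd (h s)) (drop m1 y)" for y s
  have x1: "map g1 (fst (h s) w1) \<in> seqs {0..K} m1" if "w1 \<in> {1..M1}" "s \<in> {1..Kn}" for w1 s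
    using hin(1)[OF that(2)] that(1) unfolding codebooks_def by (intro map_seqs[OF g(1)]) auto
  have x2: "map g2 (snd (h s) w2) \<in> seqs {0..K} m2" if "w2 \<in> {1..M2}" "s \<in> {1..Kn}" for w2 s
    using hin(2)[OF that(2)] that(1) unfolding codebooks_def by (intro map_seqs[OF g(2)]) auto
  have code: "is_code K (m1 + m2) M1 M2 Kn enc dec1 dec2"
    unfolding is_code_def
  proof (intro conjI ballI allI impI)
    fix w1 w2 s assume "w1 \<in> {1..M1}" "w2 \<in> {1..M2}" "s \<in> {1..Kn}"
    then show "length (enc w1 w2 s) = m1 + m2" "set (enc w1 w2 s) \<subseteq> {0..K}"
      using x1 x2 unfolding enc_def seqs_def by fastforce+
  qed (use M Kn0 d in \<open>auto simp: dec1_def dec2_def\<close>)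
  note ac = is_code_estimates[OF P code]
  have stW: "stoch K (chanW P)" and stV: "stoch K (chanV P)" and stQ: "stoch K (chanQ P)"
    by (intro stoch_chanW stoch_chanV stoch_chanQ P)+
  have avg_le: "code_avg M1 M2 Kn (\<lambda>w1 w2 s. f w1 w2 s) \<le> e"
    if f: "\<And>w1 w2. w1 \<in> {1..M1} \<Longrightarrow> w2 \<in> {1..M2} \<Longrightarrow> (\<Sum>s=1..Kn. f w1 w2 s) / Kn \<le> e"
        for f :: "nat \<Rightarrow> nat \<Rightarrow> nat \<Rightarrow> real" and e
  proof -
    have "(\<Sum>w1=1..M1. \<Sum>w2=1..M2. \<Sum>s=1..Kn. f w1 w2 s) \<le> (\<Sum>w1=1..M1. \<Sum>w2=1..M2. e * real Kn)"
      using f Kn0 by (intro sum_mono) (simp add: pos_divide_le_eq)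
    also have "\<dots> = e * (real M1 * real M2 * real Kn)" by simp
    finally show ?thesis using M Kn0 by (simp add: pos_divide_le_eq)
  qed
  have err1: "code_avg M1 M2 Kn (\<lambda>w1 w2 s. word_error (chanW P) (m1 + m2) (enc w1 w2 s) (\<lambda>y. dec1 y s) w1) \<le> e1"
  proof (rule avg_le)
    fix w1 w2 assume w: "w1 \<in> {1..M1}" "w2 \<in> {1..M2}"
    have "(\<Sum>s=1..Kn. word_error (chanW P) (m1 + m2) (enc w1 w2 s) (\<lambda>y. dec1 y s) w1) / Kn
      = (\<Sum>s=1..Kn. word_error (chanW P) m1 (map g1 (fst (h s) w1)) (d1 (fst (h s))) w1) / Kn"
      unfolding enc_def dec1_def using w
      by (intro arg_cong2[where f = "(/)"] sum.cong refl word_error_append(1)[OF stW x1 x2])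
    also have "\<dots> = (\<Sum>\<kappa>\<in>?C1. word_error (chanW P) m1 (map g1 (\<kappa> w1)) (d1 \<kappa>) w1) / card ?C1"
      using avg[of "\<lambda>\<kappa> _. word_error (chanW P) m1 (map g1 (\<kappa> w1)) (d1 \<kappa>) w1"] c1 c2
      by (simp flip: sum_distrib_left)
    finally show "(\<Sum>s=1..Kn. word_error (chanW P) (m1 + m2) (enc w1 w2 s) (\<lambda>y. dec1 y s) w1) / Kn \<le> e1"
      using E1[OF w(1)] by simp
  qed
  have err2: "code_avg M1 M2 Kn (\<lambda>w1 w2 s. word_error (chanV P) (m1 + m2) (enc w1 w2 s) (\<lambda>y. dec2 y s) w2) \<le> e2"
  proof (rule avg_le)
    fix w1 w2 assume w: "w1 \<in> {1..M1}" "w2 \<in> {1..M2}"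
    have "(\<Sum>s=1..Kn. word_error (chanV P) (m1 + m2) (enc w1 w2 s) (\<lambda>y. dec2 y s) w2) / Kn
      = (\<Sum>s=1..Kn. word_error (chanV P) m2 (map g2 (snd (h s) w2)) (d2 (snd (h s))) w2) / Kn"
      unfolding enc_def dec2_def using w
      by (intro arg_cong2[where f = "(/)"] sum.cong refl word_error_append(2)[OF stV x1 x2])
    also have "\<dots> = (\<Sum>\<kappa>\<in>?C2. word_error (chanV P) m2 (map g2 (\<kappa> w2)) (d2 \<kappa>) w2) / card ?C2"
      using avg[of "\<lambda>_ \<kappa>. word_error (chanV P) m2 (map g2 (\<kappa> w2)) (d2 \<kappa>) w2"] c1 c2 by simp
    finally show "(\<Sum>s=1..Kn. word_error (chanV P) (m1 + m2) (enc w1 w2 s) (\<lambda>y. dec2 y s) w2) / Kn \<le> e2"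
      using E2[OF w(2)] by simp
  qed
  have block: "codebook_avg M N m (\<lambda>\<kappa>. chn (chanQ P) (map g (\<kappa> w)) u) = (\<Prod>i<m. mix (chanQ P) N g (u ! i))"
    if "w \<in> {1..M}" "1 \<le> N" for M N m g w u
  proof -
    have "seqs {..<N} m \<noteq> {}" using codebooks_nonempty[OF that(2), of 1 m] unfolding codebooks_def by auto
    then have "codebook_avg M N m (\<lambda>\<kappa>. chn (chanQ P) (map g (\<kappa> w)) u)
      = (\<Sum>a\<in>seqs {..<N} m. chn (chanQ P) (map g a) u) / card (seqs {..<N} m)"
      unfolding codebooks_def using that(1) by (intro PiE_avg) auto
    then show ?thesis by (simp only: avg_chn[OF that(2)])
  qed
  have wd: "code_avg M1 M2 Kn (\<lambda>w1 w2 s. chn (chanQ P) (enc w1 w2 s) zs)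
     = (\<Prod>i<m1. mix (chanQ P) N1 g1 (take m1 zs ! i)) * (\<Prod>i<m2. mix (chanQ P) N2 g2 (drop m1 zs ! i))" (is "_ =
         ?R")
    if zs: "zs \<in> seqs UNIV (m1 + m2)" for zs
  proof -
    have "(\<Sum>s=1..Kn. chn (chanQ P) (enc w1 w2 s) zs) / Kn = ?R" if w: "w1 \<in> {1..M1}" "w2 \<in> {1..M2}" for w1 w2
    proof -
      have "chn (chanQ P) (enc w1 w2 s) zs
          = chn (chanQ P) (map g1 (fst (h s) w1)) (take m1 zs) * chn (chanQ P) (map g2 (snd (h s) w2)) (drop m1
          zs)"
        if "s \<in> {1..Kn}" for s
        using chn_append[of "take m1 zs" "map g1 (fst (h s) w1)" "chanQ P" "map g2 (snd (h s) w2)" "drop m1 zs"]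
          length_seqs[OF zs] length_seqs[OF x1[OF w(1) that]] by (simp add: enc_def)
      then have "(\<Sum>s=1..Kn. chn (chanQ P) (enc w1 w2 s) zs) / Kn
        = (\<Sum>s=1..Kn. chn (chanQ P) (map g1 (fst (h s) w1)) (take m1 zs) * chn (chanQ P) (map g2 (snd (h s) w2))
            (drop m1 zs)) / Kn"
        by (intro arg_cong2[where f = "(/)"] sum.cong refl)
      also have "\<dots> = ((\<Sum>\<kappa>\<in>?C1. chn (chanQ P) (map g1 (\<kappa> w1)) (take m1 zs)) / card ?C1)
          * ((\<Sum>\<kappa>\<in>?C2. chn (chanQ P) (map g2 (\<kappa> w2)) (drop m1 zs)) / card ?C2)"
        by (subst avg) (simp add: sum_product)
      also have "\<dots> = ?R" using w N by (simp only: block)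
      finally show ?thesis .
    qed
    then have "(\<Sum>s=1..Kn. chn (chanQ P) (enc w1 w2 s) zs) = ?R * Kn" if "w1 \<in> {1..M1}" "w2 \<in> {1..M2}" for w1 w2
      using that Kn0 by (simp add: field_simps)
    then have "(\<Sum>w1=1..M1. \<Sum>w2=1..M2. \<Sum>s=1..Kn. chn (chanQ P) (enc w1 w2 s) zs)
        = (\<Sum>w1=1..M1. \<Sum>w2=1..M2. ?R * Kn)"
      by (intro sum.cong refl)
    also have "\<dots> = ?R * (real M1 * real M2 * real Kn)" by simp
    finally show ?thesis using M Kn0 by (simp add: nonzero_divide_eq_eq)
  qed
  have "covertness P (m1 + m2) M1 M2 Kn enc
       = real m1 * relent (mix (chanQ P) N1 g1) (chanQ P 0) UNIV + real m2 * relent (mix (chanQ P) N2 g2)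
           (chanQ P 0) UNIV"
    unfolding ac(5)
    by (subst relent_cong[OF wd], assumption) (intro relent_two_blocks Q0 stoch_sum[OF stQ] mix_prob[OF stQ] N
        g; simp)
  then show ?thesis using code ac(4) err1 err2 by (intro exI conjI) (assumption, linarith, assumption)
qed

text \<open>Achievability demands the covertness constraint at every blocklength, whereas the
  construction meets it only eventually. This code fills the remaining blocklengths.\<close>

lemma trivial_code:
  fixes P :: "nat \<Rightarrow> 'y1::finite \<Rightarrow> 'y2::finite \<Rightarrow> 'z::finite \<Rightarrow> real"
  assumes P: "bc_channel K P" and Q0: "\<And>z. 0 < chanQ P 0 z"
  shows "\<exists>M1 M2 Kn enc dec1 dec2. is_code K n M1 M2 Kn enc (dec1 :: 'y1 list \<Rightarrow> nat \<Rightarrow> nat) (dec2 :: 'y2 list \<Rightarrow>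
      nat \<Rightarrow> nat)
     \<and> covertness P n M1 M2 Kn enc = 0"
proof -
  have s1: "segment_code K (chanW P) n 1 (\<lambda>_. 0) 1 (\<lambda>_ _. 1) 0"
      and s2: "segment_code K (chanV P) 0 1 (\<lambda>_. 0) 1 (\<lambda>_ _. 1) 0"
    by (auto simp: segment_code_def word_error_def)
  have "relent (mix (chanQ P) 1 (\<lambda>_. 0)) (chanQ P 0) UNIV = 0"
    by (auto simp: relent_def mix_def intro!: sum.neutral)
  then obtain Kn enc and dec1 :: "'y1 list \<Rightarrow> nat \<Rightarrow> nat" and dec2 :: "'y2 list \<Rightarrow> nat \<Rightarrow> nat"
    where "is_code K n 1 1 Kn enc dec1 dec2" "covertness P n 1 1 Kn enc = 0"
    using time_sharing_code[OF P Q0 s1 s2] by auto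
  then show ?thesis by blast
qed

section \<open>From codes at large blocklengths to achievable pairs and the region\<close>

lemma Liminf_geI:
  fixes f :: "nat \<Rightarrow> real"
  assumes "\<forall>\<^sub>F n in sequentially. l \<le> f n"
  shows "ereal l \<le> Liminf sequentially (\<lambda>n. ereal (f n))"
  using assms by (intro Liminf_bounded) (auto elim: eventually_mono)

lemma achievableI:
  fixes P :: "nat \<Rightarrow> 'y1::finite \<Rightarrow> 'y2::finite \<Rightarrow> 'z::finite \<Rightarrow> real"
  assumes P: "bc_channel K P" and Q0: "\<And>z. 0 < chanQ P 0 z" and \<delta>: "0 < \<delta>" and \<epsilon>: "0 < \<epsilon>"
      and L: "0 \<le> fst L" "0 \<le> snd L"
    and e: "e \<longlonglongrightarrow> 0"
    and ev: "\<forall>\<^sub>F n in sequentially. \<exists>M1 M2 Kn enc dec1 dec2. is_code K n M1 M2 Kn enc dec1 dec2 \<and>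
       covertness P n M1 M2 Kn enc \<le> \<delta> \<and> fst L * sqrt (real n * \<delta>) \<le> ln (real M1) \<and> snd L * sqrt (real n * \<delta>) \<le>
           ln (real M2) \<and>
       code_error P n M1 M2 Kn enc dec1 dec2 \<le> e n"
  shows "achievable K P \<epsilon> \<delta> L"
proof -
  \<comment> \<open>\<open>ok\<close> must hold at every blocklength, \<open>good\<close> only
    eventually. The choice prefers a code with both properties and falls back on one that is merely
    \<open>ok\<close>.\<close>
  define ok where "ok n c = (case c of (M1, M2, Kn, enc, dec1, dec2) \<Rightarrow>
       is_code K n M1 M2 Kn enc (dec1 :: 'y1 list \<Rightarrow> nat \<Rightarrow> nat) (dec2 :: 'y2 list \<Rightarrow> nat \<Rightarrow> nat) \<and>
       covertness P n M1 M2 Kn enc \<le> \<delta>)" for n c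
  define good where "good n c = (case c of (M1, M2, Kn, enc, dec1, dec2) \<Rightarrow>
       fst L * sqrt (real n * \<delta>) \<le> ln (real M1) \<and> snd L * sqrt (real n * \<delta>) \<le> ln (real M2) \<and>
       code_error P n M1 M2 Kn enc dec1 dec2 \<le> e n)" for n c
  have ev': "\<forall>\<^sub>F n in sequentially. \<exists>c. ok n c \<and> good n c"
    using ev by (rule eventually_mono) (auto simp: ok_def good_def)
  have "\<exists>c. ok n c \<and> ((\<exists>c. ok n c \<and> good n c) \<longrightarrow> good n c)" for n
  proof (cases "\<exists>c. ok n c \<and> good n c")
    case False
    have "\<exists>c. ok n c" using trivial_code[OF P Q0, of n] \<delta> by (fastforce simp: ok_def)
    then show ?thesis using False by blast
  qed blast
  then have "\<forall>n. \<exists>c. ok n c \<and> ((\<exists>c. ok n c \<and> good n c) \<longrightarrow> good n c)" by blast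
  then obtain c where c: "\<forall>n. ok n (c n) \<and> ((\<exists>c. ok n c \<and> good n c) \<longrightarrow> good n (c n))" by (rule choice[THEN exE])
  define M1 where "M1 n = fst (c n)" for n
  define M2 where "M2 n = fst (snd (c n))" for n
  define Kn where "Kn n = fst (snd (snd (c n)))" for n
  define enc where "enc n = fst (snd (snd (snd (c n))))" for n
  define dec1 where "dec1 n = fst (snd (snd (snd (snd (c n)))))" for n
  define dec2 where "dec2 n = snd (snd (snd (snd (snd (c n)))))" for n
  note defs = M1_def M2_def Kn_def enc_def dec1_def dec2_def
  have code: "is_code K n (M1 n) (M2 n) (Kn n) (enc n) (dec1 n) (dec2 n)
      \<and> covertness P n (M1 n) (M2 n) (Kn n) (enc n) \<le> \<delta>" for n
    using c[rule_format, of n] unfolding ok_def defs by (simp add: case_prod_unfold)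
  have good: "\<forall>\<^sub>F n in sequentially. fst L * sqrt (real n * \<delta>) \<le> ln (real (M1 n)) \<and> snd L * sqrt (real n * \<delta>)
      \<le> ln (real (M2 n)) \<and>
       code_error P n (M1 n) (M2 n) (Kn n) (enc n) (dec1 n) (dec2 n) \<le> e n"
    using ev'
  proof eventually_elim
    case (elim n)
    then have "good n (c n)" using c by blast
    then show ?case unfolding good_def defs by (simp add: case_prod_unfold)
  qed
  have rate: "ereal l \<le> Liminf sequentially (\<lambda>n. ereal (ln (real (M n)) / sqrt (real n * \<delta>)))"
    if "\<forall>\<^sub>F n in sequentially. l * sqrt (real n * \<delta>) \<le> ln (real (M n))" for l and M :: "nat \<Rightarrow> nat"
    using that eventually_gt_at_top[of 0]
    by (intro Liminf_geI, eventually_elim) (use \<delta> in \<open>simp add: pos_le_divide_eq\<close>)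
  have "\<forall>\<^sub>F n in sequentially. e n < \<epsilon>" using e \<epsilon> by (rule order_tendstoD(2))
  then have "\<forall>\<^sub>F n in sequentially. ereal (code_error P n (M1 n) (M2 n) (Kn n) (enc n) (dec1 n) (dec2 n))
      \<le> ereal \<epsilon>"
    using good by eventually_elim simp
  then have "Limsup sequentially (\<lambda>n. ereal (code_error P n (M1 n) (M2 n) (Kn n) (enc n) (dec1 n) (dec2 n)))
      \<le> ereal \<epsilon>"
    by (rule Limsup_bounded)
  moreover have "ereal (fst L) \<le> Liminf sequentially (\<lambda>n. ereal (ln (real (M1 n)) / sqrt (real n * \<delta>)))"
    by (rule rate) (use good in eventually_elim, simp)
  moreover have "ereal (snd L) \<le> Liminf sequentially (\<lambda>n. ereal (ln (real (M2 n)) / sqrt (real n * \<delta>)))"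
    by (rule rate) (use good in eventually_elim, simp)
  ultimately show ?thesis unfolding achievable_def using L code by blast
qed

lemma achievable_time_sharing:
  fixes P :: "nat \<Rightarrow> 'y1::finite \<Rightarrow> 'y2::finite \<Rightarrow> 'z::finite \<Rightarrow> real"
  assumes P: "bc_channel K P" and Q: "warden_ok K (chanQ P)"
    and W: "ac_channel K (chanW P)" and V: "ac_channel K (chanV P)" and \<delta>: "0 < \<delta>" and \<epsilon>: "0 < \<epsilon>"
    and \<theta>: "0 \<le> \<theta>" "\<theta> \<le> 1"
    and L1: "L1 = 0 \<or> 0 < L1 \<and> L1 < \<theta> * covert_cap K (chanW P) (chanQ P)"
    and L2: "L2 = 0 \<or> 0 < L2 \<and> L2 < (1 - \<theta>) * covert_cap K (chanV P) (chanQ P)"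
  shows "achievable K P \<epsilon> \<delta> (L1, L2)"
proof -
  have Q0: "\<And>z. 0 < chanQ P 0 z" using Q by (auto simp: warden_ok_def)
  define m1 where "m1 n = nat \<lfloor>\<theta> * real n\<rfloor>" for n
  define m2 where "m2 n = n - m1 n" for n
  have fl: "real (m1 n) \<le> \<theta> * real n" "\<theta> * real n - 1 \<le> real (m1 n)" for n
  proof -
    have "0 \<le> \<theta> * real n" using \<theta> by simp
    then show "real (m1 n) \<le> \<theta> * real n" "\<theta> * real n - 1 \<le> real (m1 n)" unfolding m1_def by linarith+
  qed
  have m1n: "m1 n \<le> n" for n
  proof -
    have "\<theta> * real n \<le> real n" using \<theta> by (intro mult_left_le_one_le) auto
    then have "real (m1 n) \<le> real n" using fl(1)[of n] by linarith
    then show ?thesis by simp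
  qed
  have m1: "(\<lambda>n. real (m1 n) / real n) \<longlonglongrightarrow> \<theta>"
  proof (rule tendsto_sandwich)
    show "\<forall>\<^sub>F n in sequentially. \<theta> - 1 / real n \<le> real (m1 n) / real n"
      using eventually_gt_at_top[of 0]
    proof eventually_elim
      case (elim n)
      have "(\<theta> * real n - 1) / real n \<le> real (m1 n) / real n" by (intro divide_right_mono fl) simp
      then show ?case using elim by (simp add: diff_divide_distrib)
    qed
    show "\<forall>\<^sub>F n in sequentially. real (m1 n) / real n \<le> \<theta>"
      using eventually_gt_at_top[of 0] by eventually_elim (use fl(1) in \<open>simp add: pos_divide_le_eq\<close>)
    have "(\<lambda>n. \<theta> - 1 / real n) \<longlonglongrightarrow> \<theta> - 0" by (intro tendsto_diff tendsto_const lim_1_over_n)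
    then show "(\<lambda>n. \<theta> - 1 / real n) \<longlonglongrightarrow> \<theta>" by simp
  qed simp
  have "(\<lambda>n. 1 - real (m1 n) / real n) \<longlonglongrightarrow> 1 - \<theta>" by (intro tendsto_diff tendsto_const m1)
  moreover have "\<forall>\<^sub>F n in sequentially. 1 - real (m1 n) / real n = real (m2 n) / real n"
    using eventually_gt_at_top[of 0]
    by eventually_elim (use m1n in \<open>simp add: m2_def of_nat_diff diff_divide_distrib\<close>)
  ultimately have m2: "(\<lambda>n. real (m2 n) / real n) \<longlonglongrightarrow> 1 - \<theta>" by (simp add: tendsto_cong)
  have m2n: "m2 n \<le> n" for n by (simp add: m2_def)
  have sum: "m1 n + m2 n = n" for n using m1n[of n] by (simp add: m2_def)
  have \<theta>': "0 \<le> 1 - \<theta>" using \<theta> by simp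
  obtain N1 g1 M1 d1 e1 where
    s1: "\<And>n. segment_code K (chanW P) (m1 n) (N1 n) (g1 n) (M1 n) (d1 n) (e1 n)" and e1: "e1 \<longlonglongrightarrow> 0"
    and r1: "\<And>n. L1 * sqrt (real n * \<delta>) \<le> ln (real (M1 n))"
    and c1: "\<forall>\<^sub>F n in sequentially. real (m1 n) * relent (mix (chanQ P) (N1 n) (g1 n)) (chanQ P 0) UNIV \<le> \<theta> * \<delta>"
    using segment_code_exists[OF Q W \<delta> \<theta>(1) L1 m1n m1] by blast
  obtain N2 g2 M2 d2 e2 where
    s2: "\<And>n. segment_code K (chanV P) (m2 n) (N2 n) (g2 n) (M2 n) (d2 n) (e2 n)" and e2: "e2 \<longlonglongrightarrow> 0"
    and r2: "\<And>n. L2 * sqrt (real n * \<delta>) \<le> ln (real (M2 n))"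
    and c2: "\<forall>\<^sub>F n in sequentially. real (m2 n) * relent (mix (chanQ P) (N2 n) (g2 n)) (chanQ P 0) UNIV
        \<le> (1 - \<theta>) * \<delta>"
    using segment_code_exists[OF Q V \<delta> \<theta>' L2 m2n m2] by blast
  have e: "(\<lambda>n. e1 n + e2 n) \<longlonglongrightarrow> 0" using tendsto_add[OF e1 e2] by simp
  show ?thesis
  proof (rule achievableI[OF P Q0 \<delta> \<epsilon> _ _ e])
    show "\<forall>\<^sub>F n in sequentially. \<exists>M1 M2 Kn enc dec1 dec2. is_code K n M1 M2 Kn enc dec1 dec2 \<and>
       covertness P n M1 M2 Kn enc \<le> \<delta> \<and> fst (L1, L2) * sqrt (real n * \<delta>) \<le> ln (real M1) \<and> snd (L1, L2) * sqrt
           (real n * \<delta>) \<le> ln (real M2) \<and>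
       code_error P n M1 M2 Kn enc dec1 dec2 \<le> e1 n + e2 n"
      using c1 c2
    proof eventually_elim
      case (elim n)
      obtain Kn enc dec1 dec2 where code: "is_code K n (M1 n) (M2 n) Kn enc dec1 dec2"
        "code_error P n (M1 n) (M2 n) Kn enc dec1 dec2 \<le> e1 n + e2 n"
        "covertness P n (M1 n) (M2 n) Kn enc
            = real (m1 n) * relent (mix (chanQ P) (N1 n) (g1 n)) (chanQ P 0) UNIV
          + real (m2 n) * relent (mix (chanQ P) (N2 n) (g2 n)) (chanQ P 0) UNIV"
        using time_sharing_code[OF P Q0 s1[of n] s2[of n]] unfolding sum by blast
      have "covertness P n (M1 n) (M2 n) Kn enc \<le> \<theta> * \<delta> + (1 - \<theta>) * \<delta>"
        unfolding code(3) using elim by (rule add_mono)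
      then have "covertness P n (M1 n) (M2 n) Kn enc \<le> \<delta>" by (simp add: algebra_simps)
      then show ?case using code(1,2) r1[of n] r2[of n] by (simp only: fst_conv snd_conv) blast
    qed
  qed (use L1 L2 in auto)
qed

lemma covert_region_achievability:
  fixes P :: "nat \<Rightarrow> 'y1::finite \<Rightarrow> 'y2::finite \<Rightarrow> 'z::finite \<Rightarrow> real"
  assumes P: "bc_channel K P" and Q: "warden_ok K (chanQ P)"
    and W: "ac_channel K (chanW P)" and V: "ac_channel K (chanV P)" and \<delta>: "0 < \<delta>"
  defines "A \<equiv> covert_cap K (chanW P) (chanQ P)" and "B \<equiv> covert_cap K (chanV P) (chanQ P)"
  assumes L: "0 \<le> fst L" "0 \<le> snd L" "ratio_term (fst L) A + ratio_term (snd L) B \<le> 1"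
  shows "L \<in> covert_region K P \<delta>"
proof -
  have A0: "0 \<le> A" and B0: "0 \<le> B" unfolding A_def B_def by (intro covert_cap_nonneg Q W V)+
  \<comment> \<open>User 1 receives exactly the share its rate requires. User 2 receives the rest,
    which is at least \<open>\<theta>2\<close>. A zero capacity forces a zero rate and gets share
    0.\<close>
  define \<theta> where "\<theta> = (if A = 0 then 0 else fst L / A)"
  define \<theta>2 where "\<theta>2 = (if B = 0 then 0 else snd L / B)"
  have zA: "A = 0 \<Longrightarrow> fst L = 0" and zB: "B = 0 \<Longrightarrow> snd L = 0"
    using L(3) by (auto simp: ratio_term_def split: if_splits)
  have "ratio_term (fst L) A = ereal \<theta>" "ratio_term (snd L) B = ereal \<theta>2"
    using zA zB by (auto simp: ratio_term_def \<theta>_def \<theta>2_def zero_ereal_def)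
  then have sum: "\<theta> + \<theta>2 \<le> 1" using L(3) by (simp add: one_ereal_def)
  have t0: "0 \<le> \<theta>" "0 \<le> \<theta>2" using L A0 B0 by (auto simp: \<theta>_def \<theta>2_def)
  have LA: "fst L = \<theta> * A" and LB: "snd L = \<theta>2 * B" using zA zB by (auto simp: \<theta>_def \<theta>2_def)
  \<comment> \<open>Shrinking by \<open>r < 1\<close> makes the rates strictly smaller than the
    shares allow, as the code construction requires; the closure recovers the boundary.\<close>
  have ach: "achievable K P \<epsilon> \<delta> (r * fst L, r * snd L)" if \<epsilon>: "0 < \<epsilon>" and r: "0 < r" "r < 1" for \<epsilon> r
  proof (rule achievable_time_sharing[OF P Q W V \<delta> \<epsilon>, where \<theta> = \<theta>])
    have "r * fst L < fst L" if "fst L \<noteq> 0" using that r L(1) by simp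
    then have "r * fst L < \<theta> * A" if "fst L \<noteq> 0" using that LA by simp
    then show "r * fst L = 0 \<or> 0 < r * fst L \<and> r * fst L < \<theta> * covert_cap K (chanW P) (chanQ P)"
      using r L(1) unfolding A_def by auto
    have "r * snd L < (1 - \<theta>) * B" if "snd L \<noteq> 0"
    proof -
      have "r * snd L < snd L" using that r L(2) by simp
      also have "\<dots> \<le> (1 - \<theta>) * B" unfolding LB using sum B0 by (intro mult_right_mono) auto
      finally show ?thesis .
    qed
    then show "r * snd L = 0 \<or> 0 < r * snd L \<and> r * snd L < (1 - \<theta>) * covert_cap K (chanV P) (chanQ P)"
      using r L(2) unfolding B_def by auto
  qed (use t0 sum in auto)
  have "L \<in> closure {L. achievable K P \<epsilon> \<delta> L}" if \<epsilon>: "0 < \<epsilon>" for \<epsilon>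
  proof -
    \<comment> \<open>The double successor keeps every \<open>r j\<close> strictly between 0 and 1;
      \<open>r 0\<close> is \<open>1/2\<close>.\<close>
    define r where "r j = 1 - 1 / real (Suc (Suc j))" for j
    have "(\<lambda>j. 1 / real (Suc (Suc j))) \<longlonglongrightarrow> 0" using LIMSEQ_Suc[OF LIMSEQ_Suc[OF lim_1_over_n]] by simp
    then have "r \<longlonglongrightarrow> 1 - 0" unfolding r_def by (intro tendsto_diff tendsto_const)
    then have "(\<lambda>j. (r j * fst L, r j * snd L)) \<longlonglongrightarrow> ((1 - 0) * fst L, (1 - 0) * snd L)"
      by (intro tendsto_Pair tendsto_mult tendsto_const)
    then have lim: "(\<lambda>j. (r j * fst L, r j * snd L)) \<longlonglongrightarrow> L" by simp
    have "achievable K P \<epsilon> \<delta> (r j * fst L, r j * snd L)" for j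
      by (rule ach[OF \<epsilon>]) (auto simp: r_def)
    then show ?thesis
      using lim unfolding closure_sequential by (intro exI[of _ "\<lambda>j. (r j * fst L, r j * snd L)"]) simp
  qed
  then show ?thesis by (auto simp: covert_region_def region_eps_def)
qed

theorem theorem2:
  fixes K :: nat
    and P :: "nat \<Rightarrow> 'y1::finite \<Rightarrow> 'y2::finite \<Rightarrow> 'z::finite \<Rightarrow> real"
    and \<delta> :: real
  assumes K_pos: "1 \<le> K"
    and chan: "bc_channel K P"
    and supp_Q0: "\<forall>z. chanQ P 0 z > 0"
    and not_redundant: "\<not> (\<exists>p\<in>prob_vecs K. \<forall>z. chanQ P 0 z = (\<Sum>k=1..K. p k * chanQ P k z))"
    and acW: "\<forall>k\<in>{1..K}. abs_cont (chanW P k) (chanW P 0)"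
    and acV: "\<forall>k\<in>{1..K}. abs_cont (chanV P k) (chanV P 0)"
    and cond1: "covert_cap K (chanV P) (chanQ P) \<le> covert_cap K (chanW P) (chanQ P) \<longrightarrow>
       (\<forall>p\<in>input_dists K. mutual_info K p (chanW P) * covert_cap K (chanV P) (chanQ P)
                          \<le> covert_cap K (chanW P) (chanQ P) * mutual_info K p (chanV P))"
    and cond2: "covert_cap K (chanW P) (chanQ P) < covert_cap K (chanV P) (chanQ P) \<longrightarrow>
       (\<forall>p\<in>input_dists K. mutual_info K p (chanV P) * covert_cap K (chanW P) (chanQ P)
                          \<le> covert_cap K (chanV P) (chanQ P) * mutual_info K p (chanW P))"
    and delta_pos: "\<delta> > 0"
  shows "covert_region K P \<delta> =
    {L. fst L \<ge> 0 \<and> snd L \<ge> 0 \<and>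
        ratio_term (fst L) (covert_cap K (chanW P) (chanQ P))
          + ratio_term (snd L) (covert_cap K (chanV P) (chanQ P)) \<le> 1}"
proof -
  have Q: "warden_ok K (chanQ P)"
    using K_pos stoch_chanQ[OF chan] supp_Q0 not_redundant by (auto simp: warden_ok_def)
  have W: "ac_channel K (chanW P)" by (rule ac_channelI[OF stoch_chanW[OF chan] acW])
  have V: "ac_channel K (chanV P)" by (rule ac_channelI[OF stoch_chanV[OF chan] acV])
  show ?thesis
    using covert_region_converse[OF chan Q W V delta_pos cond1 cond2] covert_region_nonneg[of _ K P \<delta>]
      covert_region_achievability[OF chan Q W V delta_pos] by blast
qed

end
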